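(* Let $X$ be a diagonal Hopf surface, and let $E$ be a non-split extension of $H$ by $\mathcal{O}_X$, where $H\in[\mathrm{Div}(X)]$ has $\deg(H)\le0$. If $\phi\in H^0(X,\mathcal{E}nd_0(E)\otimes\lambda)$ is a $\lambda$-twisted Higgs field for some $\lambda\in[\mathrm{Div}(X)]$, then $\phi=s\phi_0$ for some $s\in H^0(X,\lambda\otimes H^{-1})$, where $\phi_0:=(\iota\otimes\mathrm{id}_H)\circ\rho$ with $$0\to\mathcal{O}_X\xrightarrow{\iota}E\xrightarrow{\rho}H\to0$$ being the short exact sequence corresponding to the extension class of $E$. The inclusion $\iota$ gives the unique $\phi_0$-invariant sub-line bundle.
   Context: A diagonal Hopf surface is $X=(\mathbb{C}^2\setminus\{0\})/\langle F\rangle$ with $F(x,y)=(ax,by)$, $0<|a|\le|b|<1$. For $t\in\mathbb{C}^*$, $L_t$ is the line bundle obtained from $(\mathbb{C}^2\setminus\{0\})\times\mathbb{C}$ by identifying $(p,v)\sim(F(p),tv)$; every line bundle is isomorphic to a unique $L_t$, and $\deg(L_t)=\log|t|/\log|b|$. $[\mathrm{Div}(X)]$ is the subgroup of $\mathrm{Pic}(X)$ generated by line bundles with a nonzero section. $\mathcal{E}nd_0(E)$ is the bundle of trace-free endomorphisms. A sub-line bundle $M\subset E$ (taken with torsion-free quotient) is $\phi_0$-invariant if $\phi_0(M)\subseteq M\otimes H$. *)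

theory Defs
  imports "HOL-Analysis.Analysis"
begin

section \<open>The diagonal Hopf surface as a complex manifold\<close>

text \<open>
  Points of \<open>X\<close> are the orbits in \<open>C\<^sup>2 - {0}\<close> of the group generated by
  \<open>F (x, y) = (a x, b y)\<close>.  The projection is a local biholomorphism, so the topology and
  the holomorphic functions of \<open>X\<close> are the ones whose pullbacks to \<open>C\<^sup>2 - {0}\<close> are
  open, respectively holomorphic.
\<close>

type_synonym hopf_point = "(complex \<times> complex) set"

definition hopf_act :: "complex \<Rightarrow> complex \<Rightarrow> int \<Rightarrow> complex \<times> complex \<Rightarrow> complex \<times> complex" where
  "hopf_act a b n p = (a powi n * fst p, b powi n * snd p)"

definition hopf_proj :: "complex \<Rightarrow> complex \<Rightarrow> complex \<times> complex \<Rightarrow> hopf_point" where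
  "hopf_proj a b p = range (\<lambda>n. hopf_act a b n p)"

definition hopf_surface :: "complex \<Rightarrow> complex \<Rightarrow> hopf_point set" where
  "hopf_surface a b = hopf_proj a b ` (- {0})"

definition hopf_preimage :: "complex \<Rightarrow> complex \<Rightarrow> hopf_point set \<Rightarrow> (complex \<times> complex) set" where
  "hopf_preimage a b U = {p. p \<noteq> 0 \<and> hopf_proj a b p \<in> U}"

definition hopf_open :: "complex \<Rightarrow> complex \<Rightarrow> hopf_point set \<Rightarrow> bool" where
  "hopf_open a b U \<longleftrightarrow> U \<subseteq> hopf_surface a b \<and> open (hopf_preimage a b U)"

definition holomorphic2_on :: "(complex \<times> complex \<Rightarrow> complex) \<Rightarrow> (complex \<times> complex) set \<Rightarrow> bool" where
  "holomorphic2_on f S \<longleftrightarrow>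
     (\<forall>p\<in>S. \<exists>c d. (f has_derivative (\<lambda>(u, v). c * u + d * v)) (at p))"

definition hopf_holo :: "complex \<Rightarrow> complex \<Rightarrow> hopf_point set \<Rightarrow> (hopf_point \<Rightarrow> complex) \<Rightarrow> bool" where
  "hopf_holo a b U f \<longleftrightarrow> holomorphic2_on (\<lambda>p. f (hopf_proj a b p)) (hopf_preimage a b U)"

definition hopf_holo_vec ::
    "complex \<Rightarrow> complex \<Rightarrow> hopf_point set \<Rightarrow> (hopf_point \<Rightarrow> complex ^ 'n) \<Rightarrow> bool" where
  "hopf_holo_vec a b U f \<longleftrightarrow> (\<forall>r. hopf_holo a b U (\<lambda>x. f x $ r))"

definition hopf_holo_mat ::
    "complex \<Rightarrow> complex \<Rightarrow> hopf_point set \<Rightarrow> (hopf_point \<Rightarrow> complex ^ 'n ^ 'm) \<Rightarrow> bool" where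
  "hopf_holo_mat a b U f \<longleftrightarrow> (\<forall>r c. hopf_holo a b U (\<lambda>x. f x $ r $ c))"


section \<open>Holomorphic vector bundles\<close>

text \<open>
  A bundle of rank \<open>CARD('n)\<close> is given by a trivialising open cover and its transition
  functions: the coordinates \<open>v i\<close> of a vector in the trivialisations \<open>i\<close> and \<open>j\<close> are
  related by \<open>v i = trans E i j x *v v j\<close>.  Sections and morphisms are families of coordinate
  vectors and matrices; only their values on the relevant domains are significant.
\<close>

record ('i, 'n::finite) hbundle =
  idx :: "'i set"
  cover :: "'i \<Rightarrow> hopf_point set"
  trans :: "'i \<Rightarrow> 'i \<Rightarrow> hopf_point \<Rightarrow> complex ^ 'n ^ 'n"

definition holo_bundle :: "complex \<Rightarrow> complex \<Rightarrow> ('i, 'n::finite) hbundle \<Rightarrow> bool" where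
  "holo_bundle a b E \<longleftrightarrow>
     (\<forall>i\<in>idx E. hopf_open a b (cover E i)) \<and>
     (\<Union>i\<in>idx E. cover E i) = hopf_surface a b \<and>
     (\<forall>i\<in>idx E. \<forall>j\<in>idx E. hopf_holo_mat a b (cover E i \<inter> cover E j) (trans E i j)) \<and>
     (\<forall>i\<in>idx E. \<forall>x\<in>cover E i. trans E i i x = mat 1) \<and>
     (\<forall>i\<in>idx E. \<forall>j\<in>idx E. \<forall>k\<in>idx E. \<forall>x\<in>cover E i \<inter> cover E j \<inter> cover E k.
        trans E i j x ** trans E j k x = trans E i k x)"

definition holo_section ::
    "complex \<Rightarrow> complex \<Rightarrow> ('i, 'n::finite) hbundle \<Rightarrow> hopf_point set
      \<Rightarrow> ('i \<Rightarrow> hopf_point \<Rightarrow> complex ^ 'n) \<Rightarrow> bool" where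
  "holo_section a b E V s \<longleftrightarrow>
     (\<forall>i\<in>idx E. hopf_holo_vec a b (V \<inter> cover E i) (s i)) \<and>
     (\<forall>i\<in>idx E. \<forall>j\<in>idx E. \<forall>x\<in>V \<inter> cover E i \<inter> cover E j. s i x = trans E i j x *v s j x)"

text \<open>
  A morphism \<open>E \<rightarrow> E'\<close> is a family \<open>\<Phi>\<close>, where \<open>\<Phi> j i\<close> is its matrix with respect to
  the trivialisation \<open>i\<close> of \<open>E\<close> and the trivialisation \<open>j\<close> of \<open>E'\<close>.
\<close>

definition bundle_mor ::
    "complex \<Rightarrow> complex \<Rightarrow> ('i, 'n::finite) hbundle \<Rightarrow> ('j, 'm::finite) hbundle
      \<Rightarrow> ('j \<Rightarrow> 'i \<Rightarrow> hopf_point \<Rightarrow> complex ^ 'n ^ 'm) \<Rightarrow> bool" where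
  "bundle_mor a b E E' \<Phi> \<longleftrightarrow>
     (\<forall>i\<in>idx E. \<forall>j\<in>idx E'. hopf_holo_mat a b (cover E i \<inter> cover E' j) (\<Phi> j i)) \<and>
     (\<forall>i\<in>idx E. \<forall>i'\<in>idx E. \<forall>j\<in>idx E'. \<forall>j'\<in>idx E'.
        \<forall>x\<in>cover E i \<inter> cover E i' \<inter> cover E' j \<inter> cover E' j'.
          \<Phi> j i x ** trans E i i' x = trans E' j j' x ** \<Phi> j' i' x)"

definition inverse_mors ::
    "complex \<Rightarrow> complex \<Rightarrow> ('i, 'n::finite) hbundle \<Rightarrow> ('j, 'm::finite) hbundle
      \<Rightarrow> ('j \<Rightarrow> 'i \<Rightarrow> hopf_point \<Rightarrow> complex ^ 'n ^ 'm)
      \<Rightarrow> ('i \<Rightarrow> 'j \<Rightarrow> hopf_point \<Rightarrow> complex ^ 'm ^ 'n) \<Rightarrow> bool" where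
  "inverse_mors a b E E' \<Phi> \<Psi> \<longleftrightarrow>
     bundle_mor a b E E' \<Phi> \<and> bundle_mor a b E' E \<Psi> \<and>
     (\<forall>i\<in>idx E. \<forall>j\<in>idx E'. \<forall>x\<in>cover E i \<inter> cover E' j.
        \<Psi> i j x ** \<Phi> j i x = mat 1 \<and> \<Phi> j i x ** \<Psi> i j x = mat 1)"

definition bundle_iso ::
    "complex \<Rightarrow> complex \<Rightarrow> ('i, 'n::finite) hbundle \<Rightarrow> ('j, 'm::finite) hbundle
      \<Rightarrow> ('j \<Rightarrow> 'i \<Rightarrow> hopf_point \<Rightarrow> complex ^ 'n ^ 'm) \<Rightarrow> bool" where
  "bundle_iso a b E E' \<Phi> \<longleftrightarrow> (\<exists>\<Psi>. inverse_mors a b E E' \<Phi> \<Psi>)"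

definition maps_section ::
    "('i, 'n::finite) hbundle \<Rightarrow> ('j, 'm::finite) hbundle
      \<Rightarrow> ('j \<Rightarrow> 'i \<Rightarrow> hopf_point \<Rightarrow> complex ^ 'n ^ 'm) \<Rightarrow> hopf_point set
      \<Rightarrow> ('i \<Rightarrow> hopf_point \<Rightarrow> complex ^ 'n) \<Rightarrow> ('j \<Rightarrow> hopf_point \<Rightarrow> complex ^ 'm) \<Rightarrow> bool" where
  "maps_section E E' \<Phi> V s s' \<longleftrightarrow>
     (\<forall>i\<in>idx E. \<forall>j\<in>idx E'. \<forall>x\<in>V \<inter> cover E i \<inter> cover E' j. s' j x = \<Phi> j i x *v s i x)"

definition scale_mat :: "complex \<Rightarrow> complex ^ 'n ^ 'm \<Rightarrow> complex ^ 'n ^ 'm" where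
  "scale_mat c A = (\<chi> r k. c * A $ r $ k)"

definition trivial_bundle :: "complex \<Rightarrow> complex \<Rightarrow> (unit, 1) hbundle" where
  "trivial_bundle a b =
     \<lparr>idx = UNIV, cover = (\<lambda>_. hopf_surface a b), trans = (\<lambda>_ _ _. mat 1)\<rparr>"

definition twist :: "('i, 'n::finite) hbundle \<Rightarrow> ('k, 1) hbundle \<Rightarrow> ('i \<times> 'k, 'n) hbundle" where
  "twist E L =
     \<lparr>idx = idx E \<times> idx L,
      cover = (\<lambda>(i, k). cover E i \<inter> cover L k),
      trans = (\<lambda>(i, k) (i', k') x. scale_mat (trans L k k' x $ 1 $ 1) (trans E i i' x))\<rparr>"

definition dual_line :: "('k, 1) hbundle \<Rightarrow> ('k, 1) hbundle" where
  "dual_line L =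
     \<lparr>idx = idx L, cover = cover L,
      trans = (\<lambda>k k' x. mat (inverse (trans L k k' x $ 1 $ 1)))\<rparr>"

text \<open>The morphism \<open>\<Phi> \<otimes> id : E \<otimes> L \<rightarrow> E' \<otimes> L\<close>.\<close>

definition tensor_id ::
    "('k, 1) hbundle \<Rightarrow> ('j \<Rightarrow> 'i \<Rightarrow> hopf_point \<Rightarrow> complex ^ 'n ^ 'm)
      \<Rightarrow> ('j \<times> 'k \<Rightarrow> 'i \<times> 'k \<Rightarrow> hopf_point \<Rightarrow> complex ^ 'n ^ 'm)" where
  "tensor_id L \<Phi> = (\<lambda>(j, k) (i, k') x. scale_mat (trans L k k' x $ 1 $ 1) (\<Phi> j i x))"


section \<open>Line bundles on the Hopf surface\<close>

text \<open>
  \<open>L\<^sub>t\<close> is the quotient of \<open>(C\<^sup>2 - {0}) \<times> C\<close> by \<open>(p, v) \<sim> (F p, t v)\<close>.  Every open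
  \<open>V\<close> disjoint from its translates gives the trivialisation \<open>(p, v) \<mapsto> [(p, v)]\<close>, \<open>p \<in> V\<close>,
  over the image of \<open>V\<close>.  If \<open>p' \<in> V'\<close> and \<open>F\<^sup>n p' \<in> V\<close> then \<open>[(p', v)] = [(F\<^sup>n p', t\<^sup>n v)]\<close>,
  so the transition function from \<open>V'\<close> to \<open>V\<close> is \<open>t\<^sup>n\<close>.
\<close>

definition Lt :: "complex \<Rightarrow> complex \<Rightarrow> complex \<Rightarrow> ((complex \<times> complex) set, 1) hbundle" where
  "Lt a b t =
     \<lparr>idx = {V. open V \<and> 0 \<notin> V \<and> (\<forall>n. n \<noteq> 0 \<longrightarrow> hopf_act a b n ` V \<inter> V = {})},
      cover = (\<lambda>V. hopf_proj a b ` V),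
      trans = (\<lambda>V V' x. mat (t powi (THE n. \<exists>p\<in>V'. p \<in> x \<and> hopf_act a b n p \<in> V)))\<rparr>"

definition line_class :: "complex \<Rightarrow> complex \<Rightarrow> ('k, 1) hbundle \<Rightarrow> complex \<Rightarrow> bool" where
  "line_class a b L t \<longleftrightarrow> t \<noteq> 0 \<and> (\<exists>\<Phi>. bundle_iso a b L (Lt a b t) \<Phi>)"

definition line_deg :: "complex \<Rightarrow> complex \<Rightarrow> ('k, 1) hbundle \<Rightarrow> real" where
  "line_deg a b L = ln (cmod (THE t. line_class a b L t)) / ln (cmod b)"

definition has_nonzero_section :: "complex \<Rightarrow> complex \<Rightarrow> ('i, 'n::finite) hbundle \<Rightarrow> bool" where
  "has_nonzero_section a b E \<longleftrightarrow>
     (\<exists>s. holo_section a b E (hopf_surface a b) s \<and> (\<exists>i\<in>idx E. \<exists>x\<in>cover E i. s i x \<noteq> 0))"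

text \<open>
  \<open>Pic(X)\<close> is identified with the multiplicative group of nonzero complex numbers by
  \<open>t \<mapsto> L\<^sub>t\<close>; the following is \<open>[Div(X)]\<close> as a subgroup of it.
\<close>

inductive_set Div_group :: "complex \<Rightarrow> complex \<Rightarrow> complex set" for a b :: complex where
  Div_generator: "t \<noteq> 0 \<Longrightarrow> has_nonzero_section a b (Lt a b t) \<Longrightarrow> t \<in> Div_group a b"
| Div_one: "1 \<in> Div_group a b"
| Div_mult: "s \<in> Div_group a b \<Longrightarrow> t \<in> Div_group a b \<Longrightarrow> s * t \<in> Div_group a b"
| Div_inverse: "t \<in> Div_group a b \<Longrightarrow> inverse t \<in> Div_group a b"

definition in_Div :: "complex \<Rightarrow> complex \<Rightarrow> ('k, 1) hbundle \<Rightarrow> bool" where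
  "in_Div a b L \<longleftrightarrow> (\<exists>t\<in>Div_group a b. line_class a b L t)"


section \<open>Extensions, Higgs fields and invariant sub-line bundles\<close>

definition short_exact ::
    "complex \<Rightarrow> complex \<Rightarrow> ('i, 'n::finite) hbundle \<Rightarrow> ('j, 'm::finite) hbundle
      \<Rightarrow> ('k, 'l::finite) hbundle
      \<Rightarrow> ('j \<Rightarrow> 'i \<Rightarrow> hopf_point \<Rightarrow> complex ^ 'n ^ 'm)
      \<Rightarrow> ('k \<Rightarrow> 'j \<Rightarrow> hopf_point \<Rightarrow> complex ^ 'm ^ 'l) \<Rightarrow> bool" where
  "short_exact a b A E H \<iota> \<rho> \<longleftrightarrow>
     bundle_mor a b A E \<iota> \<and> bundle_mor a b E H \<rho> \<and>
     (\<forall>i\<in>idx A. \<forall>j\<in>idx E. \<forall>k\<in>idx H. \<forall>x\<in>cover A i \<inter> cover E j \<inter> cover H k.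
        inj ((*v) (\<iota> j i x)) \<and>
        range ((*v) (\<iota> j i x)) = {v. \<rho> k j x *v v = 0} \<and>
        surj ((*v) (\<rho> k j x)))"

definition split_by ::
    "complex \<Rightarrow> complex \<Rightarrow> ('j, 'm::finite) hbundle \<Rightarrow> ('k, 'l::finite) hbundle
      \<Rightarrow> ('k \<Rightarrow> 'j \<Rightarrow> hopf_point \<Rightarrow> complex ^ 'm ^ 'l)
      \<Rightarrow> ('j \<Rightarrow> 'k \<Rightarrow> hopf_point \<Rightarrow> complex ^ 'l ^ 'm) \<Rightarrow> bool" where
  "split_by a b E H \<rho> \<sigma> \<longleftrightarrow>
     bundle_mor a b H E \<sigma> \<and>
     (\<forall>j\<in>idx E. \<forall>k\<in>idx H. \<forall>x\<in>cover E j \<inter> cover H k. \<rho> k j x ** \<sigma> j k x = mat 1)"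

text \<open>
  Global sections of \<open>End\<^sub>0(E) \<otimes> L\<close>: \<open>\<phi> (i, k)\<close> is the trace-free matrix of \<open>\<phi>\<close> in the
  trivialisation \<open>i\<close> of \<open>E\<close> and \<open>k\<close> of \<open>L\<close>, and \<open>trans E i' i x\<close> is the
  inverse of \<open>trans E i i' x\<close>.
\<close>

definition higgs_field ::
    "complex \<Rightarrow> complex \<Rightarrow> ('i, 'n::finite) hbundle \<Rightarrow> ('k, 1) hbundle
      \<Rightarrow> ('i \<times> 'k \<Rightarrow> hopf_point \<Rightarrow> complex ^ 'n ^ 'n) \<Rightarrow> bool" where
  "higgs_field a b E L \<phi> \<longleftrightarrow>
     (\<forall>i\<in>idx E. \<forall>k\<in>idx L. hopf_holo_mat a b (cover E i \<inter> cover L k) (\<phi> (i, k)) \<and>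
        (\<forall>x\<in>cover E i \<inter> cover L k. trace (\<phi> (i, k) x) = 0)) \<and>
     (\<forall>i\<in>idx E. \<forall>i'\<in>idx E. \<forall>k\<in>idx L. \<forall>k'\<in>idx L.
        \<forall>x\<in>cover E i \<inter> cover E i' \<inter> cover L k \<inter> cover L k'.
          \<phi> (i, k) x = scale_mat (trans L k k' x $ 1 $ 1)
                         (trans E i i' x ** \<phi> (i', k') x ** trans E i' i x))"

text \<open>
  \<open>\<phi>\<^sub>0 = (\<iota> \<otimes> id\<^sub>H) \<circ> \<rho>\<close>; the trivialisation \<open>((), k)\<close> of \<open>O\<^sub>X \<otimes> H\<close> is the
  trivialisation \<open>k\<close> of \<open>H\<close>.
\<close>

definition phi0 ::
    "('k, 1) hbundle \<Rightarrow> ('i \<Rightarrow> unit \<Rightarrow> hopf_point \<Rightarrow> complex ^ 1 ^ 'n)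
      \<Rightarrow> ('k \<Rightarrow> 'i \<Rightarrow> hopf_point \<Rightarrow> complex ^ 'n ^ 1)
      \<Rightarrow> ('i \<times> 'k \<Rightarrow> hopf_point \<Rightarrow> complex ^ 'n ^ 'n)" where
  "phi0 H \<iota> \<rho> = (\<lambda>(i, k) x. tensor_id H \<iota> (i, k) ((), k) x ** \<rho> k i x)"

definition nowhere_locally_zero ::
    "complex \<Rightarrow> complex \<Rightarrow> hopf_point set \<Rightarrow> (hopf_point \<Rightarrow> complex) \<Rightarrow> bool" where
  "nowhere_locally_zero a b V f \<longleftrightarrow>
     (\<forall>V'. hopf_open a b V' \<and> V' \<subseteq> V \<and> V' \<noteq> {} \<longrightarrow> (\<exists>x\<in>V'. f x \<noteq> 0))"

text \<open>
  The morphism \<open>j : M \<rightarrow> E\<close> is injective on sheaves of sections and the stalks of \<open>E / j(M)\<close>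
  are torsion-free.  A bundle map \<open>j\<close> with these properties may vanish at isolated points.
\<close>

definition sub_line_bundle ::
    "complex \<Rightarrow> complex \<Rightarrow> ('l, 1) hbundle \<Rightarrow> ('i, 'n::finite) hbundle
      \<Rightarrow> ('i \<Rightarrow> 'l \<Rightarrow> hopf_point \<Rightarrow> complex ^ 1 ^ 'n) \<Rightarrow> bool" where
  "sub_line_bundle a b M E j \<longleftrightarrow>
     holo_bundle a b M \<and> bundle_mor a b M E j \<and>
     (\<forall>V m. hopf_open a b V \<and> holo_section a b M V m \<and> maps_section M E j V m (\<lambda>_ _. 0) \<longrightarrow>
        (\<forall>l\<in>idx M. \<forall>x\<in>V \<inter> cover M l. m l x = 0)) \<and>
     (\<forall>V f e m. hopf_open a b V \<and> hopf_holo a b V f \<and> nowhere_locally_zero a b V f \<and>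
        holo_section a b E V e \<and> holo_section a b M V m \<and>
        maps_section M E j V m (\<lambda>i x. f x *s e i x) \<longrightarrow>
        (\<forall>x\<in>V. \<exists>V' n. hopf_open a b V' \<and> x \<in> V' \<and> V' \<subseteq> V \<and>
           holo_section a b M V' n \<and> maps_section M E j V' n e))"

text \<open>\<open>\<phi>(j(M)) \<subseteq> (j \<otimes> id\<^sub>L)(M \<otimes> L)\<close> inside \<open>E \<otimes> L\<close>.\<close>

definition invariant_sub ::
    "complex \<Rightarrow> complex \<Rightarrow> ('l, 1) hbundle \<Rightarrow> ('i, 'n::finite) hbundle \<Rightarrow> ('k, 1) hbundle
      \<Rightarrow> ('i \<Rightarrow> 'l \<Rightarrow> hopf_point \<Rightarrow> complex ^ 1 ^ 'n)
      \<Rightarrow> ('i \<times> 'k \<Rightarrow> hopf_point \<Rightarrow> complex ^ 'n ^ 'n) \<Rightarrow> bool" where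
  "invariant_sub a b M E L j \<phi> \<longleftrightarrow>
     (\<forall>V m e. hopf_open a b V \<and> holo_section a b M V m \<and> holo_section a b E V e \<and>
        maps_section M E j V m e \<longrightarrow>
        (\<exists>n. holo_section a b (twist M L) V n \<and>
           maps_section (twist M L) (twist E L) (tensor_id L j) V n
             (\<lambda>(i, k) x. \<phi> (i, k) x *v e i x)))"

text \<open>Two morphisms into \<open>E\<close> define the same sub-line bundle.\<close>

definition same_sub ::
    "complex \<Rightarrow> complex \<Rightarrow> ('l, 1) hbundle \<Rightarrow> ('k, 1) hbundle \<Rightarrow> ('i, 'n::finite) hbundle
      \<Rightarrow> ('i \<Rightarrow> 'l \<Rightarrow> hopf_point \<Rightarrow> complex ^ 1 ^ 'n)
      \<Rightarrow> ('i \<Rightarrow> 'k \<Rightarrow> hopf_point \<Rightarrow> complex ^ 1 ^ 'n) \<Rightarrow> bool" where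
  "same_sub a b M N E j j' \<longleftrightarrow>
     (\<exists>u. bundle_iso a b M N u \<and>
        (\<forall>i\<in>idx E. \<forall>l\<in>idx M. \<forall>k\<in>idx N. \<forall>x\<in>cover E i \<inter> cover M l \<inter> cover N k.
           j i l x = j' i k x ** u k l x))"

end

theory Submission
  imports Defs "HOL-Complex_Analysis.Conformal_Mappings"
begin

text \<open>
  Pull everything back to \<open>W = C\<^sup>2 - {0}\<close> with the action of \<open>F (x, y) = (a x, b y)\<close>.
  With \<open>H = L\<^sub>t\<close> and \<open>\<lambda> = L\<^sub>\<tau>\<close>, sections become functions \<open>f\<close> with \<open>f \<circ> F = s f\<close>.
  In local splittings of the extension, \<open>\<phi>\<close> has a global lower left entry \<open>\<delta>\<close> of weight
  \<open>t \<tau>\<close> and lower right entries \<open>\<alpha> i\<close> with \<open>\<alpha> i - \<alpha> j = \<delta> g i j\<close>, where \<open>g\<close> is the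
  extension cocycle.  If \<open>\<delta>\<close> were not zero, then \<open>g\<close> would be a coboundary: \<open>\<delta>\<close> is a product
  of factors \<open>x\<close>, \<open>y\<close> and \<open>x^p - c y^q\<close>, and on the zero curve of such a factor the
  \<open>\<alpha> i\<close> agree and are given by a Laurent monomial in the parameter of the curve, which because
  of \<open>|t| \<ge> 1\<close> (that is, \<open>deg H \<le> 0\<close>) is the restriction of a monomial in \<open>x\<close>, \<open>y\<close>.  Subtracting
  it, one can divide by the factor.  So \<open>\<delta> = 0\<close>.  Now the diagonal entry is global and plays the
  role of \<open>\<delta>\<close> for the upper right entries, hence it vanishes as well.
\<close>

section \<open>Holomorphic functions of two variables\<close>

text \<open>The removal of factors from \<delta> must end, and the modulus of the weight measures
  this. Orbits run into the origin, near which functions on the punctured plane with a weight stay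
  bounded, so the weight of a nonzero one has modulus at most 1. Each factor has a weight of modulus
  at most \<open>max (cmod a) (cmod b)\<close>, which is below 1, so dividing by it enlarges the
  weight. Once no factor is left, \<delta> is a nonzero constant, and the quotients of the \<alpha>
  i by it split g. Binomial factors need a resonance \<open>a ^ m = b ^ n\<close>, and their zero
  set is a single curve only for coprime exponents. If \<open>a = - b\<close>, for instance, F
  exchanges the lines \<open>x = c y\<close> and \<open>x = - c y\<close>; a power of F repairs
  this. The obstacle is the extension from the curve: with parameter z, the monomials in x and y
  restrict to the powers \<open>z ^ (q i + p j)\<close>, and the semigroup of these exponents has
  gaps. The degree hypothesis gives \<open>cmod s \<le> cmod w\<close> for the weight s of the
  \<alpha> i and the weight w of the factor, so the exponent is at least \<open>p q\<close>, beyond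
  all gaps.\<close>

lemma holomorphic2_on_subset: "holomorphic2_on f S \<Longrightarrow> T \<subseteq> S \<Longrightarrow> holomorphic2_on f T"
  unfolding holomorphic2_on_def by blast

lemma holomorphic2_on_continuous: "holomorphic2_on f S \<Longrightarrow> continuous_on S f"
  unfolding holomorphic2_on_def
  by (meson continuous_at_imp_continuous_on has_derivative_continuous)

lemma holomorphic2_on_cong:
  assumes "holomorphic2_on f S" "open S" "\<And>p. p \<in> S \<Longrightarrow> f p = g p"
  shows "holomorphic2_on g S"
  unfolding holomorphic2_on_def
proof
  fix p assume p: "p \<in> S"
  then obtain c d where "(f has_derivative (\<lambda>(u, v). c * u + d * v)) (at p)"
    using assms(1) unfolding holomorphic2_on_def by blast
  then have "(g has_derivative (\<lambda>(u, v). c * u + d * v)) (at p)"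
    using has_derivative_transform_within_open[OF _ assms(2) p] assms(3) by blast
  then show "\<exists>c d. (g has_derivative (\<lambda>(u, v). c * u + d * v)) (at p)" by blast
qed

lemma holomorphic2_on_local:
  assumes "\<And>p. p \<in> S \<Longrightarrow> \<exists>T. p \<in> T \<and> holomorphic2_on f T"
  shows "holomorphic2_on f S"
  using assms unfolding holomorphic2_on_def by blast

lemma holomorphic2_onD:
  assumes "holomorphic2_on f S" "p \<in> S"
  shows "\<exists>c d. (f has_derivative (\<lambda>q. c * fst q + d * snd q)) (at p)"
  using assms unfolding holomorphic2_on_def by (auto simp: case_prod_unfold)

lemma holomorphic2_onI:
  assumes "\<And>p. p \<in> S \<Longrightarrow> \<exists>c d. (f has_derivative (\<lambda>q. c * fst q + d * snd q)) (at p)"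
  shows "holomorphic2_on f S"
  using assms unfolding holomorphic2_on_def by (auto simp: case_prod_unfold)

lemma holomorphic2_on_const [simp]: "holomorphic2_on (\<lambda>p. c) S"
  by (rule holomorphic2_onI, rule exI[of _ 0], rule exI[of _ 0]) auto

lemma holomorphic2_on_fst [simp]: "holomorphic2_on fst S"
  by (rule holomorphic2_onI, rule exI[of _ 1], rule exI[of _ 0])
     (auto intro!: derivative_eq_intros)

lemma holomorphic2_on_snd [simp]: "holomorphic2_on snd S"
  by (rule holomorphic2_onI, rule exI[of _ 0], rule exI[of _ 1])
     (auto intro!: derivative_eq_intros)

lemma holomorphic2_on_add:
  assumes "holomorphic2_on f S" "holomorphic2_on g S"
  shows "holomorphic2_on (\<lambda>p. f p + g p) S"
proof (rule holomorphic2_onI)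
  fix p assume "p \<in> S"
  with holomorphic2_onD[OF assms(1)] holomorphic2_onD[OF assms(2)] obtain c d c' d' where
    "(f has_derivative (\<lambda>q. c * fst q + d * snd q)) (at p)"
    "(g has_derivative (\<lambda>q. c' * fst q + d' * snd q)) (at p)"
    by blast
  from has_derivative_add[OF this]
  show "\<exists>c d. ((\<lambda>p. f p + g p) has_derivative (\<lambda>q. c * fst q + d * snd q)) (at p)"
    by (intro exI[of _ "c + c'"] exI[of _ "d + d'"]) (simp add: algebra_simps)
qed

lemma holomorphic2_on_mult:
  assumes "holomorphic2_on f S" "holomorphic2_on g S"
  shows "holomorphic2_on (\<lambda>p. f p * g p) S"
proof (rule holomorphic2_onI)
  fix p assume "p \<in> S"
  with holomorphic2_onD[OF assms(1)] holomorphic2_onD[OF assms(2)] obtain c d c' d' where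
    "(f has_derivative (\<lambda>q. c * fst q + d * snd q)) (at p)"
    "(g has_derivative (\<lambda>q. c' * fst q + d' * snd q)) (at p)"
    by blast
  from has_derivative_mult[OF this]
  show "\<exists>c d. ((\<lambda>p. f p * g p) has_derivative (\<lambda>q. c * fst q + d * snd q)) (at p)"
    by (intro exI[of _ "f p * c' + c * g p"] exI[of _ "f p * d' + d * g p"]) (simp add: algebra_simps)
qed

lemma holomorphic2_on_compose:
  assumes "holomorphic2_on f S" "g holomorphic_on A" "open A" "f ` S \<subseteq> A"
  shows "holomorphic2_on (\<lambda>p. g (f p)) S"
proof (rule holomorphic2_onI)
  fix p assume p: "p \<in> S"
  with holomorphic2_onD[OF assms(1)] obtain c d where 1: "(f has_derivative (\<lambda>q. c * fst q + d * snd q)) (at p)"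
    by blast
  have "(g has_field_derivative deriv g (f p)) (at (f p))"
    using assms p by (meson holomorphic_derivI image_subset_iff)
  from has_derivative_compose[OF 1 this[THEN has_field_derivative_imp_has_derivative]]
  show "\<exists>c d. ((\<lambda>p. g (f p)) has_derivative (\<lambda>q. c * fst q + d * snd q)) (at p)"
    by (intro exI[of _ "deriv g (f p) * c"] exI[of _ "deriv g (f p) * d"]) (simp add: algebra_simps)
qed

lemma holomorphic2_on_diff:
  assumes "holomorphic2_on f S" "holomorphic2_on g S"
  shows "holomorphic2_on (\<lambda>p. f p - g p) S"
  using holomorphic2_on_add[OF assms(1) holomorphic2_on_mult[OF holomorphic2_on_const[of "-1"] assms(2)]]
  by simp

lemma holomorphic2_on_power: "holomorphic2_on f S \<Longrightarrow> holomorphic2_on (\<lambda>p. f p ^ n) S"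
  by (induction n) (simp_all add: holomorphic2_on_mult)

lemma holomorphic2_on_inverse:
  assumes "holomorphic2_on f S" "\<And>p. p \<in> S \<Longrightarrow> f p \<noteq> 0"
  shows "holomorphic2_on (\<lambda>p. inverse (f p)) S"
  by (rule holomorphic2_on_compose[OF assms(1), of _ "- {0}"]) (use assms(2) in \<open>auto intro!: holomorphic_intros\<close>)

lemma holomorphic2_on_divide:
  assumes "holomorphic2_on f S" "holomorphic2_on g S" "\<And>p. p \<in> S \<Longrightarrow> g p \<noteq> 0"
  shows "holomorphic2_on (\<lambda>p. f p / g p) S"
  using holomorphic2_on_mult[OF assms(1) holomorphic2_on_inverse[OF assms(2,3)]]
  by (simp add: divide_inverse)

lemma holomorphic2_on_sum:
  "(\<And>i. i \<in> I \<Longrightarrow> holomorphic2_on (f i) S) \<Longrightarrow> holomorphic2_on (\<lambda>p. \<Sum>i\<in>I. f i p) S"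
  by (induction I rule: infinite_finite_induct) (simp_all add: holomorphic2_on_add)

lemmas holomorphic2_intros =
  holomorphic2_on_const holomorphic2_on_fst holomorphic2_on_snd holomorphic2_on_add
  holomorphic2_on_diff holomorphic2_on_mult holomorphic2_on_power holomorphic2_on_divide
  holomorphic2_on_sum holomorphic2_on_inverse

lemma holomorphic2_on_curve:
  assumes "holomorphic2_on f S" "g1 holomorphic_on A" "g2 holomorphic_on A" "open A"
    and "\<And>z. z \<in> A \<Longrightarrow> (g1 z, g2 z) \<in> S"
  shows "(\<lambda>z. f (g1 z, g2 z)) holomorphic_on A"
proof (rule holomorphic_onI)
  fix z assume z: "z \<in> A"
  obtain c d where 1: "(f has_derivative (\<lambda>q. c * fst q + d * snd q)) (at (g1 z, g2 z))"
    using holomorphic2_onD[OF assms(1) assms(5)[OF z]] by blast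
  have "(g1 has_derivative (*) (deriv g1 z)) (at z)" "(g2 has_derivative (*) (deriv g2 z)) (at z)"
    using assms(2-4) z holomorphic_derivI has_field_derivative_imp_has_derivative by blast+
  then have "((\<lambda>z. (g1 z, g2 z)) has_derivative (\<lambda>h. (deriv g1 z * h, deriv g2 z * h))) (at z)"
    by (rule has_derivative_Pair)
  from has_derivative_compose[OF this 1]
  have "((\<lambda>z. f (g1 z, g2 z)) has_derivative (*) (c * deriv g1 z + d * deriv g2 z)) (at z)"
    by (rule has_derivative_eq_rhs) (auto simp: algebra_simps)
  then have "(\<lambda>z. f (g1 z, g2 z)) field_differentiable at z"
    unfolding field_differentiable_def has_field_derivative_def by blast
  then show "(\<lambda>z. f (g1 z, g2 z)) field_differentiable at z within A"
    by (rule field_differentiable_at_within)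
qed

lemma holomorphic2_on_linear:
  assumes "holomorphic2_on f S" "\<And>p. p \<in> T \<Longrightarrow> L p \<in> S" and L: "bounded_linear L"
    and "\<And>p. L p = (c1 * fst p + d1 * snd p, c2 * fst p + d2 * snd p)"
  shows "holomorphic2_on (\<lambda>p. f (L p)) T"
proof (rule holomorphic2_onI)
  fix p assume "p \<in> T"
  then obtain c d where 1: "(f has_derivative (\<lambda>q. c * fst q + d * snd q)) (at (L p))"
    using holomorphic2_onD[OF assms(1) assms(2)] by blast
  from has_derivative_compose[OF bounded_linear_imp_has_derivative[OF L] 1]
  show "\<exists>c d. ((\<lambda>p. f (L p)) has_derivative (\<lambda>q. c * fst q + d * snd q)) (at p)"
    by (intro exI[of _ "c * c1 + d * c2"] exI[of _ "c * d1 + d * d2"])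
       (simp add: assms(4) algebra_simps)
qed

lemma holomorphic2_on_scale:
  assumes "holomorphic2_on f S" "\<And>p. p \<in> T \<Longrightarrow> (a * fst p, b * snd p) \<in> S"
  shows "holomorphic2_on (\<lambda>p. f (a * fst p, b * snd p)) T"
  by (rule holomorphic2_on_linear[OF assms, where ?c1.0 = a and ?d1.0 = 0 and ?c2.0 = 0 and ?d2.0 = b])
     (auto intro!: bounded_linear_Pair bounded_linear_compose[OF bounded_linear_mult_right]
       bounded_linear_fst bounded_linear_snd)

lemma holomorphic2_on_swap:
  assumes "holomorphic2_on f S" "\<And>p. p \<in> T \<Longrightarrow> (snd p, fst p) \<in> S"
  shows "holomorphic2_on (\<lambda>p. f (snd p, fst p)) T"
  by (rule holomorphic2_on_linear[OF assms, where ?c1.0 = 0 and ?d1.0 = 1 and ?c2.0 = 1 and ?d2.0 = 0])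
     (auto intro!: bounded_linear_Pair bounded_linear_fst bounded_linear_snd)

text \<open>Cauchy's formula for the derivative on a fixed circle expresses the partial derivative
  as an integral whose kernel is jointly continuous in the point and the angle.\<close>

lemma deriv_param_continuous:
  fixes f :: "complex \<times> complex \<Rightarrow> complex"
  assumes S: "open S" and cf: "continuous_on S f"
    and d: "\<And>p. p \<in> S \<Longrightarrow> (\<lambda>v. f (fst p, v)) field_differentiable at (snd p)"
  shows "continuous_on S (\<lambda>p. deriv (\<lambda>v. f (fst p, v)) (snd p))"
proof -
  have "\<exists>T. open T \<and> p0 \<in> T \<and> continuous_on T (\<lambda>p. deriv (\<lambda>v. f (fst p, v)) (snd p))"
    if p0: "p0 \<in> S" for p0
  proof -
    obtain A B where AB: "open A" "open B" "p0 \<in> A \<times> B" "A \<times> B \<subseteq> S"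
      using open_prod_elim[OF S p0] by metis
    then obtain r where r: "r > 0" "cball (snd p0) r \<subseteq> B"
      by (metis mem_Times_iff open_contains_cball)
    define T where "T = A \<times> ball (snd p0) r"
    define c where "c = circlepath (snd p0) r"
    \<comment> \<open>The velocity of the circle, which turns the contour integral into an integral
      over the unit interval.\<close>
    define c' where "c' = (\<lambda>\<theta>. 2 * of_real pi * \<i> * of_real r * exp (2 * of_real pi * \<i> * of_real \<theta>))"
    have cin: "c \<theta> \<in> sphere (snd p0) r" for \<theta>
      using r by (auto simp: c_def circlepath dist_norm norm_mult)
    define K where "K = (\<lambda>p \<theta>. f (fst p, c \<theta>) / (c \<theta> - snd p)\<^sup>2 * c' \<theta>)"
    have eq: "deriv (\<lambda>v. f (fst p, v)) (snd p) = 1 / (2 * of_real pi * \<i>) * integral {0..1} (K p)"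
      if p: "p \<in> T" for p
    proof -
      have hol: "(\<lambda>v. f (fst p, v)) holomorphic_on cball (snd p0) r"
      proof (rule holomorphic_onI)
        fix v assume "v \<in> cball (snd p0) r"
        then have "(fst p, v) \<in> S" using p r(2) by (intro subsetD[OF AB(4)]) (auto simp: T_def)
        from d[OF this] show "(\<lambda>v. f (fst p, v)) field_differentiable at v within cball (snd p0) r"
          by (simp add: field_differentiable_at_within)
      qed
      have "((\<lambda>v. f (fst p, v)) has_field_derivative
          (1 / (2 * of_real pi * \<i>) * contour_integral c (\<lambda>u. f (fst p, u) / (u - snd p)\<^sup>2))) (at (snd p))"
        unfolding c_def
        by (rule Cauchy_derivative_integral_circlepath)
           (use p in \<open>auto simp: T_def intro!: holomorphic_on_imp_continuous_on[OF hol]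
             holomorphic_on_subset[OF hol]\<close>)
      then show ?thesis
        by (simp add: DERIV_imp_deriv K_def c'_def c_def contour_integral_integral vector_derivative_circlepath)
    qed
    have "continuous_on (T \<times> cbox 0 1) (\<lambda>(p, \<theta>). K p \<theta>)"
      unfolding K_def case_prod_unfold c'_def
    proof (intro continuous_intros)
      show "continuous_on (T \<times> cbox 0 1) (\<lambda>x. f (fst (fst x), c (snd x)))"
        apply (rule continuous_on_compose2[OF cf])
        subgoal unfolding c_def circlepath by (intro continuous_intros)
        subgoal using cin AB r by (force simp: T_def)
        done
      show "continuous_on (T \<times> cbox 0 1) (\<lambda>x. c (snd x))"
        unfolding c_def circlepath by (intro continuous_intros)
      show "\<forall>x\<in>T \<times> cbox 0 1. (c (snd x) - snd (fst x))\<^sup>2 \<noteq> 0"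
        using cin by (force simp: T_def)
    qed
    from integral_continuous_on_param[OF this]
    have "continuous_on T (\<lambda>p. deriv (\<lambda>v. f (fst p, v)) (snd p))"
      by (subst continuous_on_cong[OF refl eq]) (auto intro!: continuous_intros)
    moreover have "open T" "p0 \<in> T" using AB r by (auto simp: T_def open_Times mem_Times_iff)
    ultimately show ?thesis by blast
  qed
  then have "isCont (\<lambda>p. deriv (\<lambda>v. f (fst p, v)) (snd p)) p" if "p \<in> S" for p
    using that continuous_on_eq_continuous_at by blast
  then show ?thesis by (simp add: continuous_at_imp_continuous_on)
qed

text \<open>Osgood's lemma. Total differentiability follows from the existence of both partial
  derivatives and the continuity of one of them; Cauchy's formula supplies that continuity for the
  second variable.\<close>

lemma holomorphic2_on_osgood:
  assumes S: "open S" and cf: "continuous_on S f"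
    and d1: "\<And>x y. (x, y) \<in> S \<Longrightarrow> (\<lambda>u. f (u, y)) field_differentiable at x"
    and d2: "\<And>x y. (x, y) \<in> S \<Longrightarrow> (\<lambda>v. f (x, v)) field_differentiable at y"
  shows "holomorphic2_on f S"
proof (rule holomorphic2_onI)
  fix p assume p: "p \<in> S"
  define D where "D = (\<lambda>p. deriv (\<lambda>v. f (fst p, v)) (snd p))"
  have D: "continuous_on S D"
    unfolding D_def by (rule deriv_param_continuous[OF S cf]) (use d2 in auto)
  obtain A B where AB: "open A" "open B" "p \<in> A \<times> B" "A \<times> B \<subseteq> S"
    using open_prod_elim[OF S p] by metis
  then obtain r where r: "r > 0" "ball (snd p) r \<subseteq> B"
    by (metis mem_Times_iff open_contains_ball)
  \<comment> \<open>A ball, because the criterion by partial derivatives asks for a convex second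
    factor.\<close>
  define Y where "Y = ball (snd p) r"
  obtain x y where xy: "p = (x, y)" by (cases p)
  have xyin: "x \<in> A" "y \<in> Y" "open Y" "A \<times> Y \<subseteq> S" using AB r xy by (auto simp: Y_def)
  have C: "continuous (at (x, y) within A \<times> Y) (\<lambda>(x, y). blinfun_mult_right (D (x, y)))"
  proof -
    have "continuous_on (A \<times> Y) (\<lambda>(x, y). blinfun_mult_right (D (x, y)))"
      unfolding case_prod_unfold
      by (intro bounded_linear.continuous_on[OF bounded_linear_blinfun_mult_right])
         (use xyin in \<open>simp add: continuous_on_subset[OF D]\<close>)
    then show ?thesis using xyin by (simp add: continuous_on_eq_continuous_within case_prod_unfold)
  qed
  have "((\<lambda>(x, y). f (x, y)) has_derivative
        (\<lambda>(tx, ty). deriv (\<lambda>u. f (u, y)) x * tx + blinfun_apply (blinfun_mult_right (D (x, y))) ty)) (at (x, y) within A \<times> Y)"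
  proof (rule has_derivative_partialsI[OF _ _ C])
    show "((\<lambda>x. f (x, y)) has_derivative (*) (deriv (\<lambda>u. f (u, y)) x)) (at x within A)"
      using d1[of x y] xyin has_field_derivative_imp_has_derivative has_derivative_at_withinI
      by (metis field_differentiable_derivI mem_Sigma_iff subsetD)
    show "((\<lambda>y. f (x, y)) has_derivative blinfun_apply (blinfun_mult_right (D (x, y)))) (at y within Y)"
      if "x \<in> A" "y \<in> Y" for x y
    proof -
      have "((\<lambda>y. f (x, y)) has_field_derivative D (x, y)) (at y)"
        using d2[of x y] xyin that by (auto simp: D_def field_differentiable_derivI)
      then show ?thesis
        by (simp add: has_field_derivative_def has_derivative_at_withinI)
    qed
  qed (use xyin in \<open>simp_all add: Y_def\<close>)
  moreover have "at (x, y) within A \<times> Y = at (x, y)"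
    by (rule at_within_open) (use xyin AB in \<open>simp_all add: open_Times\<close>)
  ultimately have "((\<lambda>(x, y). f (x, y)) has_derivative
        (\<lambda>(tx, ty). deriv (\<lambda>u. f (u, y)) x * tx + blinfun_apply (blinfun_mult_right (D (x, y))) ty)) (at p)"
    by (simp only: xy)
  then show "\<exists>c d. (f has_derivative (\<lambda>q. c * fst q + d * snd q)) (at p)"
    by (intro exI[of _ "deriv (\<lambda>u. f (u, y)) x"] exI[of _ "D (x, y)"])
       (simp add: case_prod_unfold)
qed

text \<open>A function of \<open>(x, y)\<close> that is holomorphic in \<open>x\<close> is recovered by Cauchy's formula from its
  values on a circle, so joint holomorphy on the circle propagates to the disc.\<close>

lemma holomorphic2_on_disc:
  assumes N: "open N" and r: "0 < r" "r < R"
    and hx: "\<And>y. y \<in> N \<Longrightarrow> (\<lambda>x. h (x, y)) holomorphic_on ball x0 R"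
    and T: "open T" "sphere x0 r \<times> N \<subseteq> T" "holomorphic2_on h T"
  shows "holomorphic2_on h (ball x0 r \<times> N)"
proof -
  define c where "c = circlepath x0 r"
  define c' where "c' = (\<lambda>\<theta>. 2 * of_real pi * \<i> * of_real r * exp (2 * of_real pi * \<i> * of_real \<theta>))"
  have cin: "c \<theta> \<in> sphere x0 r" for \<theta>
    using r by (auto simp: c_def circlepath dist_norm norm_mult)
  have cc: "continuous_on X c" for X unfolding c_def circlepath by (intro continuous_intros)
  have cc': "continuous_on X c'" for X unfolding c'_def by (intro continuous_intros)
  have ch: "continuous_on T h" by (rule holomorphic2_on_continuous[OF T(3)])
  have dT: "(\<lambda>v. h (x, v)) field_differentiable at y" if xyT: "(x, y) \<in> T" for x y
  proof -
    obtain A B where AB: "open A" "open B" "(x, y) \<in> A \<times> B" "A \<times> B \<subseteq> T"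
      using open_prod_elim[OF T(1) xyT] by metis
    have "(\<lambda>v. h (x, v)) holomorphic_on B"
      by (rule holomorphic2_on_curve[OF T(3)]) (use AB in auto)
    then show ?thesis using AB holomorphic_on_imp_differentiable_at by auto
  qed
  define D where "D = (\<lambda>p. deriv (\<lambda>v. h (fst p, v)) (snd p))"
  have D: "continuous_on T D" unfolding D_def
    by (rule deriv_param_continuous[OF T(1) ch]) (use dT in auto)
  define K where "K = (\<lambda>p \<theta>. h (c \<theta>, snd p) / (c \<theta> - fst p) * c' \<theta>)"
  have eq: "h p = 1 / (2 * of_real pi * \<i>) * integral (cbox 0 1) (K p)" if p: "p \<in> ball x0 r \<times> N" for p
  proof -
    have hol: "(\<lambda>x. h (x, snd p)) holomorphic_on cball x0 r"
      by (rule holomorphic_on_subset[OF hx]) (use p r in auto)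
    have "((\<lambda>u. h (u, snd p) / (u - fst p)) has_contour_integral (2 * of_real pi * \<i>) * h (fst p, snd p)) c"
      unfolding c_def
      by (rule Cauchy_integral_circlepath)
         (use p in \<open>auto simp: dist_norm norm_minus_commute intro!: holomorphic_on_imp_continuous_on[OF hol]
             holomorphic_on_subset[OF hol]\<close>)
    then have "contour_integral c (\<lambda>u. h (u, snd p) / (u - fst p)) = (2 * of_real pi * \<i>) * h p"
      by (simp add: contour_integral_unique)
    then show ?thesis
      by (simp add: K_def c'_def c_def contour_integral_integral vector_derivative_circlepath)
  qed
  have Kcont: "continuous_on ((ball x0 r \<times> N) \<times> cbox 0 1) (\<lambda>(p, \<theta>). K p \<theta>)"
    unfolding K_def case_prod_unfold
  proof (intro continuous_intros continuous_on_compose2[OF cc] continuous_on_compose2[OF cc'])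
    show "continuous_on ((ball x0 r \<times> N) \<times> cbox 0 1) (\<lambda>x. h (c (snd x), snd (fst x)))"
      apply (rule continuous_on_compose2[OF ch])
      subgoal by (intro continuous_intros continuous_on_compose2[OF cc]) auto
      subgoal using cin T(2) by force
      done
    show "\<forall>x\<in>(ball x0 r \<times> N) \<times> cbox 0 1. c (snd x) - fst (fst x) \<noteq> 0"
      using cin by force
  qed auto
  show ?thesis
  proof (rule holomorphic2_on_osgood)
    show "open (ball x0 r \<times> N)" using N by (simp add: open_Times)
    show "continuous_on (ball x0 r \<times> N) h"
      using integral_continuous_on_param[OF Kcont]
      by (subst continuous_on_cong[OF refl eq]) (auto intro!: continuous_intros)
    show "(\<lambda>u. h (u, y)) field_differentiable at x" if "(x, y) \<in> ball x0 r \<times> N" for x y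
      using hx[of y] that r by (auto intro!: holomorphic_on_imp_differentiable_at)
    show "(\<lambda>v. h (x, v)) field_differentiable at y" if xy: "(x, y) \<in> ball x0 r \<times> N" for x y
    proof -
      \<comment> \<open>In the second variable the Cauchy integral is differentiated under the
        integral sign. The derivative of the kernel is continuous because \<open>D\<close> is
        continuous near the circle.\<close>
      obtain e where e: "e > 0" "ball y e \<subseteq> N" using N xy by (auto simp: open_contains_ball)
      have "(\<lambda>v. integral (cbox 0 1) (\<lambda>\<theta>. K (x, v) \<theta>)) holomorphic_on ball y e"
      proof (rule leibniz_rule_holomorphic[where fx = "\<lambda>v \<theta>. D (c \<theta>, v) / (c \<theta> - x) * c' \<theta>"])
        fix v \<theta> assume v: "v \<in> ball y e" "\<theta> \<in> cbox 0 (1::real)"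
        have "((\<lambda>v. h (c \<theta>, v)) has_field_derivative D (c \<theta>, v)) (at v)"
          using dT[of "c \<theta>" v] set_mp[OF T(2), of "(c \<theta>, v)"] cin[of \<theta>] v e by (simp add: D_def field_differentiable_derivI subset_eq)
        then have "((\<lambda>v. h (c \<theta>, v)) has_field_derivative D (c \<theta>, v)) (at v within ball y e)"
          by (rule has_field_derivative_at_within)
        from DERIV_cmult[OF this, of "c' \<theta> / (c \<theta> - x)"]
        show "((\<lambda>v. K (x, v) \<theta>) has_field_derivative D (c \<theta>, v) / (c \<theta> - x) * c' \<theta>) (at v within ball y e)"
          by (simp add: K_def algebra_simps)
      next
        fix v assume v: "v \<in> ball y e"
        have "continuous_on (cbox 0 1) (\<lambda>\<theta>. (\<lambda>(p, \<theta>). K p \<theta>) ((x, v), \<theta>))"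
          by (rule continuous_on_compose2[OF Kcont]) (use v e xy in \<open>auto intro!: continuous_intros\<close>)
        then show "K (x, v) integrable_on cbox 0 1"
          by (simp add: integrable_continuous_interval)
      next
        show "continuous_on (ball y e \<times> cbox 0 1) (\<lambda>(v, \<theta>). D (c \<theta>, v) / (c \<theta> - x) * c' \<theta>)"
          unfolding case_prod_unfold
        proof (intro continuous_intros continuous_on_compose2[OF cc] continuous_on_compose2[OF cc'])
          show "continuous_on (ball y e \<times> cbox 0 1) (\<lambda>x. D (c (snd x), fst x))"
            apply (rule continuous_on_compose2[OF D])
            subgoal by (intro continuous_intros continuous_on_compose2[OF cc]) auto
            subgoal using cin T(2) e by force
            done
          show "\<forall>xa\<in>ball y e \<times> cbox 0 1. c (snd xa) - x \<noteq> 0"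
            using cin xy by force
        qed auto
      qed auto
      then have "(\<lambda>v. 1 / (2 * of_real pi * \<i>) * integral (cbox 0 1) (K (x, v))) holomorphic_on ball y e"
        by (intro holomorphic_intros)
      then have "(\<lambda>v. h (x, v)) holomorphic_on ball y e"
      proof (rule holomorphic_transform)
        fix v assume "v \<in> ball y e"
        then have "(x, v) \<in> ball x0 r \<times> N" using xy e by blast
        from eq[OF this, symmetric]
        show "1 / (2 * of_real pi * \<i>) * integral (cbox 0 1) (K (x, v)) = h (x, v)" .
      qed
      moreover have "y \<in> ball y e" using e by simp
      ultimately show ?thesis using holomorphic_on_imp_differentiable_at open_ball by blast
    qed
  qed
qed

section \<open>Division by functions with simple zeros\<close>

text \<open>The set of disagreement is open, so if it were nonempty near \<open>p\<close> it would
  meet \<open>D\<close>. This carries identities that have been divided by a factor across the zero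
  set of that factor.\<close>

lemma eq_on_dense:
  fixes f g :: "'a::topological_space \<Rightarrow> 'b::real_normed_vector"
  assumes "continuous_on S f" "continuous_on S g" "open S" "p \<in> S" "p \<in> closure D"
    and eq: "\<And>q. q \<in> S \<Longrightarrow> q \<in> D \<Longrightarrow> f q = g q"
  shows "f p = g p"
proof (rule ccontr)
  assume "f p \<noteq> g p"
  define V where "V = S \<inter> (\<lambda>q. f q - g q) -` (- {0})"
  have "open V" unfolding V_def
    by (rule continuous_open_preimage) (use assms in \<open>auto intro!: continuous_intros\<close>)
  moreover have "p \<in> V" using \<open>f p \<noteq> g p\<close> assms by (auto simp: V_def)
  ultimately have "V \<inter> D \<noteq> {}" using assms(5) open_Int_closure_eq_empty[of V D] by blast
  then show False using eq by (auto simp: V_def)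
qed

text \<open>Near a zero \<open>w\<close> the quotient equals that of the two difference quotients at
  \<open>w\<close>. These are holomorphic once completed by the derivatives at \<open>w\<close>, and
  the denominator does not vanish at \<open>w\<close> because the zero is simple.\<close>

lemma holomorphic_quotient_simple_zeros:
  assumes D: "open D" and f: "f holomorphic_on D" and u: "u holomorphic_on D"
    and z: "\<And>z. z \<in> D \<Longrightarrow> u z = 0 \<Longrightarrow> f z = 0 \<and> deriv u z \<noteq> 0"
  shows "(\<lambda>z. if u z = 0 then deriv f z / deriv u z else f z / u z) holomorphic_on D" (is "?q holomorphic_on D")
proof (rule holomorphic_onI)
  fix w assume w: "w \<in> D"
  have "\<exists>N. open N \<and> w \<in> N \<and> ?q holomorphic_on N"
  proof (cases "u w = 0")
    case False
    define N where "N = D \<inter> u -` (- {0})"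
    have "open N" unfolding N_def
      by (rule continuous_open_preimage) (use D u in \<open>auto intro: holomorphic_on_imp_continuous_on\<close>)
    moreover have "(\<lambda>z. f z / u z) holomorphic_on N"
      by (intro holomorphic_intros holomorphic_on_subset[OF f] holomorphic_on_subset[OF u]) (auto simp: N_def)
    then have "?q holomorphic_on N" by (rule holomorphic_transform) (auto simp: N_def)
    ultimately show ?thesis using w False by (auto simp: N_def)
  next
    case True
    define f1 where "f1 = (\<lambda>z. if z = w then deriv f w else (f z - f w) / (z - w))"
    define u1 where "u1 = (\<lambda>z. if z = w then deriv u w else (u z - u w) / (z - w))"
    have hol: "f1 holomorphic_on D" "u1 holomorphic_on D" unfolding f1_def u1_def
      by (rule pole_lemma[OF f] pole_lemma[OF u]; use w D in \<open>simp add: interior_open\<close>)+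
    define N where "N = D \<inter> u1 -` (- {0})"
    have "open N" unfolding N_def
      by (rule continuous_open_preimage) (use D hol in \<open>auto intro: holomorphic_on_imp_continuous_on\<close>)
    moreover have "w \<in> N" using z[OF w True] w by (simp add: N_def u1_def)
    moreover have "(\<lambda>z. f1 z / u1 z) holomorphic_on N"
      by (intro holomorphic_intros holomorphic_on_subset[OF hol(1)] holomorphic_on_subset[OF hol(2)]) (auto simp: N_def)
    then have "?q holomorphic_on N"
      by (rule holomorphic_transform)
         (use True z[OF w True] in \<open>auto simp: N_def f1_def u1_def divide_simps split: if_splits\<close>)
    ultimately show ?thesis by auto
  qed
  then show "?q field_differentiable at w within D"
    by (meson field_differentiable_at_within holomorphic_on_imp_differentiable_at)
qed

text \<open>For fixed y the quotient extends over the simple zeros in x. Joint holomorphy comes from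
  a circle in the x-line that avoids the zeros for all nearby y: the quotient is clearly holomorphic
  near the circle, and \<open>holomorphic2_on_disc\<close> fills in the disc.\<close>

lemma holomorphic2_divide_simple_zeros:
  assumes S: "open S" and f: "holomorphic2_on f S" and u: "holomorphic2_on u S"
    and z: "\<And>x y. (x, y) \<in> S \<Longrightarrow> u (x, y) = 0 \<Longrightarrow> f (x, y) = 0 \<and> deriv (\<lambda>x. u (x, y)) x \<noteq> 0"
  shows "\<exists>g. holomorphic2_on g S \<and> (\<forall>p\<in>S. f p = u p * g p)"
proof -
  define g where "g = (\<lambda>p. if u p = 0 then deriv (\<lambda>x. f (x, snd p)) (fst p) / deriv (\<lambda>x. u (x, snd p)) (fst p)
    else f p / u p)"
  have g0: "\<exists>T. open T \<and> p \<in> T \<and> holomorphic2_on g T" if "p \<in> S" "u p \<noteq> 0" for p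
  proof -
    define T where "T = S \<inter> u -` (- {0})"
    have "open T" unfolding T_def
      by (rule continuous_open_preimage) (use S holomorphic2_on_continuous[OF u] in auto)
    moreover have "holomorphic2_on g T"
    proof (rule holomorphic2_on_cong[OF _ \<open>open T\<close>])
      show "holomorphic2_on (\<lambda>p. f p / u p) T"
        by (intro holomorphic2_on_divide holomorphic2_on_subset[OF f] holomorphic2_on_subset[OF u]) (auto simp: T_def)
    qed (auto simp: T_def g_def)
    ultimately show ?thesis using that by (auto simp: T_def)
  qed
  have "\<exists>T. p \<in> T \<and> holomorphic2_on g T" if p: "p \<in> S" for p
  proof (cases "u p = 0")
    case False
    then show ?thesis using g0 p by blast
  next
    case True
    obtain x0 y0 where p0: "p = (x0, y0)" by (cases p)
    obtain A B where AB: "open A" "open B" "p \<in> A \<times> B" "A \<times> B \<subseteq> S"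
      using open_prod_elim[OF S p] by metis
    obtain r0 where r0: "r0 > 0" "ball x0 r0 \<subseteq> A" using AB p0 by (auto simp: open_contains_ball)
    have hol: "(\<lambda>x. w (x, y)) holomorphic_on ball x0 r0" if "holomorphic2_on w S" "y \<in> B" for w y
      by (rule holomorphic2_on_curve[OF that(1)]) (use AB r0 that in auto)
    have y0: "y0 \<in> B" using AB p0 by auto
    \<comment> \<open>A simple zero excludes that \<open>u\<close> vanishes along the whole slice,
      so the zero is isolated there.\<close>
    have "\<exists>\<beta>\<in>ball x0 r0. u (\<beta>, y0) \<noteq> 0"
    proof (rule ccontr)
      assume "\<not> ?thesis"
      then have "((\<lambda>x. u (x, y0)) has_field_derivative 0) (at x0)"
        by (intro has_field_derivative_transform_within[OF DERIV_const[of 0] r0(1)]) (auto simp: dist_commute)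
      then show False using z[of x0 y0] p p0 True by (auto dest: DERIV_imp_deriv)
    qed
    then obtain \<beta> where "\<beta> \<in> ball x0 r0" "u (\<beta>, y0) \<noteq> 0" by blast
    then obtain r1 where r1: "0 < r1" "ball x0 r1 \<subseteq> ball x0 r0"
        "\<And>x. x \<in> ball x0 r1 - {x0} \<Longrightarrow> u (x, y0) \<noteq> 0"
      using isolated_zeros[OF hol[OF u y0], of x0 \<beta>] r0 True p0 by auto
    define r where "r = r1 / 2"
    have r: "0 < r" "r < r1" using r1 by (auto simp: r_def)
    define T where "T = (A \<times> B) \<inter> u -` (- {0})"
    have T: "open T" unfolding T_def
      by (rule continuous_open_preimage)
         (use AB holomorphic2_on_continuous[OF u] in \<open>auto simp: open_Times intro: continuous_on_subset\<close>)
    have "sphere x0 r \<times> {y0} \<subseteq> T"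
    proof
      fix q assume "q \<in> sphere x0 r \<times> {y0}"
      then obtain x where q: "q = (x, y0)" "dist x0 x = r" by auto
      then have "x \<in> ball x0 r1 - {x0}" using r by auto
      then show "q \<in> T" using q r1 r0 y0 by (auto simp: T_def)
    qed
    \<comment> \<open>The circle is compact, so by the tube lemma it stays free of zeros of
      \<open>u\<close> when y moves a little.\<close>
    then obtain U N where UN: "open N" "y0 \<in> N" "sphere x0 r \<subseteq> U" "U \<times> N \<subseteq> T"
      using tube_lemma_left[of euclidean euclidean T "sphere x0 r" y0] T by (auto simp: euclidean_product_topology)
    then have N: "open N" "y0 \<in> N" "sphere x0 r \<times> N \<subseteq> T" by auto
    have "holomorphic2_on g (ball x0 r \<times> (N \<inter> B))"
    proof (rule holomorphic2_on_disc[where R = r1 and T = T])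
      show "(\<lambda>x. g (x, y)) holomorphic_on ball x0 r1" if "y \<in> N \<inter> B" for y
      proof -
        have "(\<lambda>x. if u (x, y) = 0 then deriv (\<lambda>x. f (x, y)) x / deriv (\<lambda>x. u (x, y)) x
            else f (x, y) / u (x, y)) holomorphic_on ball x0 r1"
        proof (rule holomorphic_quotient_simple_zeros)
          show "f (x, y) = 0 \<and> deriv (\<lambda>x. u (x, y)) x \<noteq> 0" if "x \<in> ball x0 r1" "u (x, y) = 0" for x
          proof -
            have "x \<in> A" using that(1) r1(2) r0(2) by blast
            then have "(x, y) \<in> S" using \<open>y \<in> N \<inter> B\<close> AB(4) by blast
            then show ?thesis using z that(2) by blast
          qed
        qed (use that r1 in \<open>auto intro!: holomorphic_on_subset[OF hol[OF f]] holomorphic_on_subset[OF hol[OF u]]\<close>)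
        then show ?thesis unfolding g_def fst_conv snd_conv .
      qed
      show "holomorphic2_on g T"
      proof (rule holomorphic2_on_local)
        fix q assume "q \<in> T"
        then have "q \<in> S" "u q \<noteq> 0" using AB(4) unfolding T_def by blast+
        then show "\<exists>T. q \<in> T \<and> holomorphic2_on g T" using g0 by blast
      qed
    qed (use N T AB r in auto)
    then show ?thesis using N y0 p0 r by (intro exI[of _ "ball x0 r \<times> (N \<inter> B)"]) auto
  qed
  then have "holomorphic2_on g S" by (rule holomorphic2_on_local)
  moreover have "f p = u p * g p" if "p \<in> S" for p
    using z[of "fst p" "snd p"] that by (auto simp: g_def)
  ultimately show ?thesis by blast
qed

section \<open>Functions of one variable that are scaled by a contraction of the parameter\<close>

lemma norm_power_lessE:
  assumes "cmod \<beta> < 1" "e > 0"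
  obtains k where "cmod \<beta> ^ k < e"
  using real_arch_pow_inv[OF assms(2,1)] by blast

lemma power_inj_complex:
  assumes "0 < cmod \<beta>" "cmod \<beta> < 1" "\<beta> ^ m = \<beta> ^ n"
  shows "m = n"
proof -
  have "cmod \<beta> ^ m = cmod \<beta> ^ n" using assms(3) by (metis norm_power)
  then show ?thesis
    using assms(1,2) by (metis linorder_neqE_nat order_less_irrefl power_strict_decreasing)
qed

text \<open>Comparing Taylor coefficients gives \<open>\<beta> ^ n * e n = s * e n\<close>. The
  powers of \<beta> are distinct, so at most one coefficient survives.\<close>

lemma entire_scaling_monomial:
  assumes f: "f holomorphic_on UNIV" and b: "0 < cmod \<beta>" "cmod \<beta> < 1"
    and sc: "\<And>z. f (\<beta> * z) = s * f z" and nz: "f z1 \<noteq> 0"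
  shows "\<exists>c n. \<forall>z. f z = c * z ^ n"
proof -
  define e where "e = (\<lambda>n. (deriv ^^ n) f 0 / fact n)"
  have ser: "(\<lambda>n. e n * z ^ n) sums f z" for z
    using holomorphic_power_series[of f 0 "cmod z + 1" z] f holomorphic_on_subset by (auto simp: e_def)
  have e: "\<beta> ^ n * e n = s * e n" for n
  proof -
    have 1: "(deriv ^^ n) (\<lambda>w. f (\<beta> * w)) 0 = \<beta> ^ n * (deriv ^^ n) f (\<beta> * 0)"
      by (rule higher_deriv_compose_linear[OF f, of UNIV]) auto
    have 2: "(deriv ^^ n) (\<lambda>w. f (\<beta> * w)) 0 = s * (deriv ^^ n) f 0"
      unfolding sc by (rule higher_deriv_cmult[OF f]) auto
    have "\<beta> ^ n * (deriv ^^ n) f 0 = s * (deriv ^^ n) f 0"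
      using trans[OF 1[symmetric] 2] by (simp only: mult_zero_right)
    then show ?thesis unfolding e_def by (simp only: times_divide_eq_right)
  qed
  have "\<exists>n. e n \<noteq> 0"
  proof (rule ccontr)
    assume "\<not> ?thesis"
    then have "(\<lambda>n. 0) sums f z1" using ser[of z1] by simp
    then show False using nz sums_unique by fastforce
  qed
  then obtain n where n: "e n \<noteq> 0" by blast
  have "e m = 0" if "m \<noteq> n" for m
    using e[of m] e[of n] n power_inj_complex[OF b, of m n] that by auto
  then have "(\<lambda>m. e m * z ^ m) = (\<lambda>m. if m = n then e n * z ^ n else 0)" for z by auto
  then have "(\<lambda>m. if m = n then e n * z ^ n else 0) sums f z" for z using ser[of z] by simp
  then have "f z = e n * z ^ n" for z using sums_single[of n "\<lambda>_. e n * z ^ n"] sums_unique2 by blast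
  then show ?thesis by blast
qed

text \<open>After multiplication by a high power of z the multiplier has modulus at most 1. The
  bound on an annulus then propagates to the whole punctured disc, the singularity at 0 is
  removable, and the entire case applies.\<close>

lemma punctured_scaling_monomial:
  assumes f: "f holomorphic_on (- {0})" and b: "0 < cmod \<beta>" "cmod \<beta> < 1"
    and sc: "\<And>z. z \<noteq> 0 \<Longrightarrow> f (\<beta> * z) = s * f z" and z1: "z1 \<noteq> 0" "f z1 \<noteq> 0"
  shows "\<exists>c n. c \<noteq> 0 \<and> \<beta> powi n = s \<and> (\<forall>z. z \<noteq> 0 \<longrightarrow> f z = c * z powi n)"
proof -
  \<comment> \<open>Chosen to make the new multiplier \<open>\<beta> ^ M * s\<close> at most 1 in
    modulus; the summand 1 keeps the bound meaningful for \<open>s = 0\<close>.\<close>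
  obtain M where M: "cmod \<beta> ^ M < 1 / (cmod s + 1)"
    by (rule norm_power_lessE[OF b(2), of "1 / (cmod s + 1)"]) (simp_all add: add_nonneg_pos)
  define s' where "s' = \<beta> ^ M * s"
  have s': "cmod s' \<le> 1"
  proof -
    have "cmod \<beta> ^ M * (cmod s + 1) < 1" using M by (simp add: pos_less_divide_eq add_nonneg_pos)
    moreover have "cmod s' \<le> cmod \<beta> ^ M * (cmod s + 1)"
      by (simp add: s'_def norm_mult norm_power algebra_simps)
    ultimately show ?thesis by simp
  qed
  define g where "g = (\<lambda>z. z ^ M * f z)"
  have g: "g holomorphic_on (- {0})" unfolding g_def by (intro holomorphic_intros f)
  have gs: "g (\<beta> * z) = s' * g z" if "z \<noteq> 0" for z
    using sc[OF that] by (simp add: g_def s'_def power_mult_distrib)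
  \<comment> \<open>The closed annulus between the radii \<open>cmod \<beta>\<close> and 1, which
    meets every orbit of multiplication by \<beta> outside 0.\<close>
  define K where "K = cball (0::complex) 1 - ball 0 (cmod \<beta>)"
  have "compact K" unfolding K_def by (intro compact_diff) auto
  then have "bounded (g ` K)"
    using b by (intro compact_imp_bounded compact_continuous_image holomorphic_on_imp_continuous_on holomorphic_on_subset[OF g])
       (auto simp: K_def)
  then obtain B where B: "\<And>z. z \<in> K \<Longrightarrow> cmod (g z) \<le> B" by (auto simp: bounded_iff)
  have Bk: "cmod (g z) \<le> B" if "cmod \<beta> ^ Suc k \<le> cmod z" "cmod z \<le> 1" for k z
    using that
  proof (induction k arbitrary: z)
    case 0
    then show ?case by (intro B) (auto simp: K_def)
  next
    case (Suc k)
    show ?case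
    proof (cases "cmod \<beta> \<le> cmod z")
      case True
      then show ?thesis using Suc by (intro B) (auto simp: K_def)
    next
      case False
      define w where "w = z / \<beta>"
      have z: "z = \<beta> * w" using b by (auto simp: w_def)
      have w: "cmod \<beta> ^ Suc k \<le> cmod w" "cmod w \<le> 1"
        using Suc.prems False b by (auto simp: w_def norm_divide divide_simps mult.commute mult.assoc)
      then have "w \<noteq> 0" using b
by (metis norm_zero not_less zero_less_power)
      then have "cmod (g z) = cmod s' * cmod (g w)" using gs z by (simp add: norm_mult)
      also have "\<dots> \<le> 1 * B" using s' Suc.IH[OF w] by (intro mult_mono) auto
      finally show ?thesis by simp
    qed
  qed
  have "cmod (g z) \<le> B" if z: "z \<noteq> 0" "cmod z < 1" for z
  proof -
    obtain k where "cmod \<beta> ^ k < cmod z"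
      by (rule norm_power_lessE[OF b(2), of "cmod z"]) (use z in simp_all)
    moreover have "cmod \<beta> ^ Suc k \<le> cmod \<beta> ^ k" using b by (intro power_decreasing) auto
    ultimately have "cmod \<beta> ^ Suc k \<le> cmod z" by linarith
    then show ?thesis using Bk z(2) by (meson less_imp_le)
  qed
  then have "eventually (\<lambda>z. cmod (g z) \<le> B) (at 0)"
    unfolding eventually_at by (intro exI[of _ 1]) auto
  then obtain G where G: "G holomorphic_on UNIV" "\<And>z. z \<noteq> 0 \<Longrightarrow> G z = g z"
    using holomorphic_on_extend_bounded[of g UNIV 0] g by (auto simp: Compl_eq_Diff_UNIV)
  have cG: "continuous_on UNIV G" by (rule holomorphic_on_imp_continuous_on[OF G(1)])
  have "G (\<beta> * z) = s' * G z" for z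
  proof (rule eq_on_dense[where f = "\<lambda>z. G (\<beta> * z)" and g = "\<lambda>z. s' * G z" and S = UNIV and D = "- {0}"])
    show "continuous_on UNIV (\<lambda>z. G (\<beta> * z))"
      by (rule continuous_on_compose2[OF cG]) (auto intro!: continuous_intros)
    show "continuous_on UNIV (\<lambda>z. s' * G z)" by (intro continuous_intros cG)
    show "z \<in> closure (- {0})" by (simp add: closure_complement)
  qed (use G gs b in auto)
  then obtain c n where cn: "\<And>z. G z = c * z ^ n"
    using entire_scaling_monomial[OF G(1) b, of s' z1] G(2)[of z1] z1 by (auto simp: g_def)
  have fz: "f z = c * z powi (int n - int M)" if "z \<noteq> 0" for z
    using cn[of z] G(2)[OF that] that by (simp add: g_def power_int_diff divide_simps mult.commute)
  have "c \<noteq> 0" using fz[OF z1(1)] z1 by auto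
  moreover have "\<beta> powi (int n - int M) = s"
    using sc[of 1] fz[of 1] fz[of \<beta>] b \<open>c \<noteq> 0\<close> by auto
  ultimately show ?thesis using fz by blast
qed

section \<open>Semi-invariant functions on the punctured plane\<close>

definition dil :: "complex \<Rightarrow> complex \<Rightarrow> complex \<times> complex \<Rightarrow> complex \<times> complex" where
  "dil a b p = (a * fst p, b * snd p)"

lemma dil_eq_0_iff: "a \<noteq> 0 \<Longrightarrow> b \<noteq> 0 \<Longrightarrow> dil a b p = 0 \<longleftrightarrow> p = 0"
  by (cases p) (auto simp: dil_def zero_prod_def)

lemma holomorphic2_on_dil:
  "holomorphic2_on f S \<Longrightarrow> (\<And>p. p \<in> T \<Longrightarrow> dil a b p \<in> S) \<Longrightarrow> holomorphic2_on (\<lambda>p. f (dil a b p)) T"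
  unfolding dil_def by (rule holomorphic2_on_scale)

lemma continuous_on_dil [continuous_intros]: "continuous_on S (dil a b)"
  unfolding dil_def by (intro continuous_intros)

text \<open>Every point other than the origin lies on a horizontal or vertical line that misses the
  origin. On such a line the maximum principle bounds the value by the values on the boundary set
  \<open>K\<close>, which is compact and stays away from 0.\<close>

lemma holomorphic2_bounded_on_bidisc:
  assumes f: "holomorphic2_on f (- {0})"
  shows "\<exists>B. \<forall>x y. (x, y) \<noteq> 0 \<longrightarrow> cmod x \<le> 1 \<longrightarrow> cmod y \<le> 1 \<longrightarrow> cmod (f (x, y)) \<le> B"
proof -
  define K where "K = sphere (0::complex) 1 \<times> cball (0::complex) 1 \<union> cball 0 1 \<times> sphere 0 1"
  have K0: "K \<subseteq> - {0}" by (auto simp: K_def zero_prod_def)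
  have "compact K" unfolding K_def by (intro compact_Un compact_Times) auto
  then have "bounded (f ` K)"
    by (intro compact_imp_bounded compact_continuous_image continuous_on_subset[OF holomorphic2_on_continuous[OF f] K0])
  then obtain B where B: "\<And>p. p \<in> K \<Longrightarrow> cmod (f p) \<le> B" by (auto simp: bounded_iff)
  have "cmod (f (x, y)) \<le> B" if "(x, y) \<noteq> 0" "cmod x \<le> 1" "cmod y \<le> 1" for x y
  proof (cases "y = 0")
    case False
    have hol: "(\<lambda>u. f (u, y)) holomorphic_on UNIV"
      by (rule holomorphic2_on_curve[OF f]) (use False in \<open>auto simp: zero_prod_def\<close>)
    show ?thesis
      by (rule maximum_modulus_frontier[of "\<lambda>u. f (u, y)" "cball 0 1" B x])
         (use hol that in \<open>auto intro!: B holomorphic_on_imp_continuous_on holomorphic_on_subset[OF hol] simp: K_def\<close>)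
  next
    case True
    have hol: "(\<lambda>v. f (x, v)) holomorphic_on UNIV"
      by (rule holomorphic2_on_curve[OF f]) (use True that in \<open>auto simp: zero_prod_def\<close>)
    show ?thesis
      by (rule maximum_modulus_frontier[of "\<lambda>v. f (x, v)" "cball 0 1" B y])
         (use hol that in \<open>auto intro!: B holomorphic_on_imp_continuous_on holomorphic_on_subset[OF hol] simp: K_def\<close>)
  qed
  then show ?thesis by blast
qed

text \<open>The orbit of \<open>p\<close> enters the unit bidisc, where \<open>f\<close> is bounded,
  while the values along it are \<open>s ^ k * f p\<close>. This bound excludes weights throughout
  the proof: it forces functions to vanish and makes the removal of factors terminate.\<close>

lemma semi_invariant_norm_le_1:
  assumes ab: "0 < cmod a" "cmod a < 1" "0 < cmod b" "cmod b < 1"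
    and f: "holomorphic2_on f (- {0})"
    and sc: "\<And>p. p \<noteq> 0 \<Longrightarrow> f (dil a b p) = s * f p" and p: "p \<noteq> 0" and nz: "f p \<noteq> 0"
  shows "cmod s \<le> 1"
proof (rule ccontr)
  assume "\<not> cmod s \<le> 1"
  then have s: "1 < cmod s" by simp
  obtain B where B: "\<And>x y. (x, y) \<noteq> 0 \<Longrightarrow> cmod x \<le> 1 \<Longrightarrow> cmod y \<le> 1 \<Longrightarrow> cmod (f (x, y)) \<le> B"
    using holomorphic2_bounded_on_bidisc[OF f] by blast
  define q where "q = (\<lambda>k. (a ^ k * fst p, b ^ k * snd p))"
  have q0: "q k \<noteq> 0" for k using p ab by (cases p) (auto simp: q_def zero_prod_def)
  have fq: "f (q k) = s ^ k * f p" for k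
  proof (induction k)
    case (Suc k)
    have "q (Suc k) = dil a b (q k)" by (simp add: q_def dil_def mult.assoc)
    then show ?case using sc[OF q0[of k]] Suc by (simp add: mult.assoc)
  qed (simp add: q_def)
  have "\<forall>\<^sub>F k in sequentially. cmod (a ^ k * fst p) \<le> 1"
  proof -
    have "(\<lambda>k. a ^ k * fst p) \<longlonglongrightarrow> 0 * fst p"
      by (intro tendsto_intros LIMSEQ_power_zero) (use ab in auto)
    then have "(\<lambda>k. a ^ k * fst p) \<longlonglongrightarrow> 0" by simp
    from tendstoD[OF this, of 1] show ?thesis by (auto elim: eventually_mono)
  qed
  moreover have "\<forall>\<^sub>F k in sequentially. cmod (b ^ k * snd p) \<le> 1"
  proof -
    have "(\<lambda>k. b ^ k * snd p) \<longlonglongrightarrow> 0 * snd p"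
      by (intro tendsto_intros LIMSEQ_power_zero) (use ab in auto)
    then have "(\<lambda>k. b ^ k * snd p) \<longlonglongrightarrow> 0" by simp
    from tendstoD[OF this, of 1] show ?thesis by (auto elim: eventually_mono)
  qed
  moreover have "\<forall>\<^sub>F k in sequentially. B / cmod (f p) < cmod s ^ k"
  proof -
    obtain K where "B / cmod (f p) < cmod s ^ K" using real_arch_pow[OF s] by blast
    then have "B / cmod (f p) < cmod s ^ k" if "K \<le> k" for k
      using power_increasing[OF that, of "cmod s"] s by linarith
    then show ?thesis by (rule eventually_sequentiallyI)
  qed
  ultimately have "\<forall>\<^sub>F k in sequentially. False"
  proof eventually_elim
    case (elim k)
    have "cmod (f (q k)) \<le> B" using B q0[of k] elim by (simp add: q_def)
    then have "cmod s ^ k * cmod (f p) \<le> B" by (simp add: fq norm_mult norm_power)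
    then show False using elim nz by (simp add: divide_simps)
  qed
  then show False by simp
qed

section \<open>Curves invariant under a diagonal contraction\<close>

text \<open>The zero set of \<open>u\<close> in the punctured plane is a single complex curve \<open>(\<kappa>1, \<kappa>2)\<close>
  with parameter in the punctured line, on which \<open>dil a b\<close> acts by \<open>z \<mapsto> \<beta> z\<close>.  The last
  condition extends semi-invariant functions from the curve to the plane.\<close>

definition curve_param ::
    "complex \<Rightarrow> complex \<Rightarrow> (complex \<times> complex \<Rightarrow> complex) \<Rightarrow> complex
      \<Rightarrow> (complex \<Rightarrow> complex) \<Rightarrow> (complex \<Rightarrow> complex) \<Rightarrow> complex \<Rightarrow> bool" where
  "curve_param a b u w \<kappa>1 \<kappa>2 \<beta> \<longleftrightarrow>
     0 < cmod \<beta> \<and> cmod \<beta> < 1 \<and> \<kappa>1 holomorphic_on UNIV \<and> \<kappa>2 holomorphic_on UNIV \<and>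
     {p. p \<noteq> 0 \<and> u p = 0} = (\<lambda>z. (\<kappa>1 z, \<kappa>2 z)) ` (- {0}) \<and>
     (\<forall>z. (\<kappa>1 (\<beta> * z), \<kappa>2 (\<beta> * z)) = dil a b (\<kappa>1 z, \<kappa>2 z)) \<and>
     (\<forall>M. cmod (\<beta> powi M) \<le> cmod w \<longrightarrow>
        (\<exists>A. holomorphic2_on A UNIV \<and> (\<forall>p. A (dil a b p) = \<beta> powi M * A p) \<and>
           (\<forall>z. z \<noteq> 0 \<longrightarrow> A (\<kappa>1 z, \<kappa>2 z) = z powi M)))"

text \<open>Collects what the removal of one factor needs. \<open>w\<close> is the weight of
  \<open>u\<close>. Density of the set where \<open>u\<close> does not vanish permits cancelling
  \<open>u\<close>. Divisibility is asked for only on sets without the origin, where a cuspidal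
  curve has its singular point.\<close>

definition curve_factor :: "complex \<Rightarrow> complex \<Rightarrow> (complex \<times> complex \<Rightarrow> complex) \<Rightarrow> complex \<Rightarrow> bool" where
  "curve_factor a b u w \<longleftrightarrow>
     holomorphic2_on u UNIV \<and> w \<noteq> 0 \<and> (\<forall>p. u (dil a b p) = w * u p) \<and>
     closure {p. u p \<noteq> 0} = UNIV \<and>
     (\<forall>S f. open S \<longrightarrow> 0 \<notin> S \<longrightarrow> holomorphic2_on f S \<longrightarrow> (\<forall>p\<in>S. u p = 0 \<longrightarrow> f p = 0) \<longrightarrow>
        (\<exists>g. holomorphic2_on g S \<and> (\<forall>p\<in>S. f p = u p * g p))) \<and>
     (\<exists>\<kappa>1 \<kappa>2 \<beta>. curve_param a b u w \<kappa>1 \<kappa>2 \<beta>)"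

section \<open>The invariant curves: coordinate axes and curves
  \<open>x ^ p = e * y ^ q\<close>\<close>

lemma power_int_norm_le_imp:
  assumes "0 < cmod \<beta>" "cmod \<beta> < 1" "cmod (\<beta> powi M) \<le> cmod \<beta> ^ N"
  shows "int N \<le> M"
proof (rule ccontr)
  assume "\<not> int N \<le> M"
  then have "cmod \<beta> powi int N < cmod \<beta> powi M"
    using assms by (intro power_int_strict_decreasing) auto
  then show False using assms by (simp add: norm_power_int)
qed

lemma closure_Compl_finite:
  assumes "finite (F :: complex set)"
  shows "closure (- F) = UNIV"
  using assms by (simp add: closure_complement empty_interior_finite)

text \<open>The zero curve is the y-axis, on which F multiplies the parameter by \<open>b\<close>.
  Since \<open>cmod a < 1\<close>, the exponents that must be extended are nonnegative, and a power
  of y does it.\<close>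

lemma curve_factor_fst:
  assumes "0 < cmod a" "cmod a < 1" "0 < cmod b" "cmod b < 1"
  shows "curve_factor a b fst a"
  unfolding curve_factor_def
proof (intro conjI allI impI)
  have "{p. fst p \<noteq> (0::complex)} = (- {0}) \<times> (UNIV :: complex set)" by auto
  then show "closure {p :: complex \<times> complex. fst p \<noteq> 0} = UNIV"
    by (simp add: closure_Times closure_Compl_finite)
next
  fix S and f :: "complex \<times> complex \<Rightarrow> complex"
  assume "open S" "0 \<notin> S" "holomorphic2_on f S" "\<forall>p\<in>S. fst p = 0 \<longrightarrow> f p = 0"
  then show "\<exists>g. holomorphic2_on g S \<and> (\<forall>p\<in>S. f p = fst p * g p)"
    by (intro holomorphic2_divide_simple_zeros) auto
next
  show "\<exists>\<kappa>1 \<kappa>2 \<beta>. curve_param a b fst a \<kappa>1 \<kappa>2 \<beta>"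
    unfolding curve_param_def
  proof (rule exI[of _ "\<lambda>_. 0"], rule exI[of _ "\<lambda>z. z"], rule exI[of _ b], intro conjI allI impI)
    fix M assume "cmod (b powi M) \<le> cmod a"
    then have "int 0 \<le> M" using assms by (intro power_int_norm_le_imp[of b]) auto
    then obtain m where M: "M = int m" using nonneg_int_cases by auto
    show "\<exists>A. holomorphic2_on A UNIV \<and> (\<forall>p. A (dil a b p) = b powi M * A p) \<and>
              (\<forall>z. z \<noteq> 0 \<longrightarrow> A (0, z) = z powi M)"
      by (rule exI[of _ "\<lambda>p. snd p ^ m"])
         (auto simp: M dil_def power_mult_distrib intro!: holomorphic2_intros)
  qed (use assms in \<open>auto simp: dil_def zero_prod_def image_iff\<close>)
qed (use assms in \<open>auto simp: dil_def\<close>)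

text \<open>The mirror image of the previous case. The division lemma differentiates in the first
  variable, hence the exchange of coordinates.\<close>

lemma curve_factor_snd:
  assumes "0 < cmod a" "cmod a < 1" "0 < cmod b" "cmod b < 1"
  shows "curve_factor a b snd b"
  unfolding curve_factor_def
proof (intro conjI allI impI)
  have "{p. snd p \<noteq> (0::complex)} = (UNIV :: complex set) \<times> (- {0})" by auto
  then show "closure {p :: complex \<times> complex. snd p \<noteq> 0} = UNIV"
    by (simp add: closure_Times closure_Compl_finite)
next
  fix S and f :: "complex \<times> complex \<Rightarrow> complex"
  assume S: "open S" "0 \<notin> S" "holomorphic2_on f S" "\<forall>p\<in>S. snd p = 0 \<longrightarrow> f p = 0"
  define S' where "S' = (\<lambda>p. (snd p, fst p)) -` S"
  have "open S'" unfolding S'_def by (rule open_vimage[OF S(1)]) (intro continuous_intros)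
  then have "\<exists>g. holomorphic2_on g S' \<and> (\<forall>p\<in>S'. f (snd p, fst p) = fst p * g p)"
    by (rule holomorphic2_divide_simple_zeros)
       (use S in \<open>auto simp: S'_def intro!: holomorphic2_on_swap[OF S(3)]\<close>)
  then obtain g where g: "holomorphic2_on g S'" "\<And>p. p \<in> S' \<Longrightarrow> f (snd p, fst p) = fst p * g p" by blast
  have "holomorphic2_on (\<lambda>p. g (snd p, fst p)) S"
    by (rule holomorphic2_on_swap[OF g(1)]) (auto simp: S'_def)
  moreover have "f p = snd p * g (snd p, fst p)" if "p \<in> S" for p
    using g(2)[of "(snd p, fst p)"] that by (simp add: S'_def)
  ultimately show "\<exists>g. holomorphic2_on g S \<and> (\<forall>p\<in>S. f p = snd p * g p)" by blast
next
  show "\<exists>\<kappa>1 \<kappa>2 \<beta>. curve_param a b snd b \<kappa>1 \<kappa>2 \<beta>"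
    unfolding curve_param_def
  proof (rule exI[of _ "\<lambda>z. z"], rule exI[of _ "\<lambda>_. 0"], rule exI[of _ a], intro conjI allI impI)
    fix M assume "cmod (a powi M) \<le> cmod b"
    then have "int 0 \<le> M" using assms by (intro power_int_norm_le_imp[of a]) auto
    then obtain m where M: "M = int m" using nonneg_int_cases by auto
    show "\<exists>A. holomorphic2_on A UNIV \<and> (\<forall>p. A (dil a b p) = a powi M * A p) \<and>
              (\<forall>z. z \<noteq> 0 \<longrightarrow> A (z, 0) = z powi M)"
      by (rule exI[of _ "\<lambda>p. fst p ^ m"])
         (auto simp: M dil_def power_mult_distrib intro!: holomorphic2_intros)
  qed (use assms in \<open>auto simp: dil_def zero_prod_def image_iff\<close>)
qed (use assms in \<open>auto simp: dil_def\<close>)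

text \<open>With a Bezout relation \<open>k * q + l * p = 1\<close>, the number
  \<open>X powi k * Y powi l\<close> works. Geometrically, it is the parameter of the point on the
  curve \<open>x ^ p = y ^ q\<close>.\<close>

lemma coprime_common_root:
  fixes X Y :: complex
  assumes "coprime p q" "X \<noteq> 0" "Y \<noteq> 0" "X ^ p = Y ^ q"
  shows "\<exists>z. z \<noteq> 0 \<and> z ^ q = X \<and> z ^ p = Y"
proof -
  obtain k l :: int where kl: "k * int q + l * int p = 1"
    using bezout_int[of "int q" "int p"] assms(1) by (auto simp: coprime_iff_gcd_eq_1 gcd.commute)
  have e: "X powi (int p * n) = Y powi (int q * n)" for n
    using assms(4) by (simp add: power_int_mult)
  define z where "z = X powi k * Y powi l"
  have "z ^ q = X powi (k * int q) * Y powi (int q * l)"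
    by (simp add: z_def power_mult_distrib power_int_mult mult.commute[of "int q"])
  also have "\<dots> = X powi (k * int q + l * int p)"
    using assms e[of l] by (simp add: power_int_add mult.commute[of l])
  finally have 1: "z ^ q = X" by (simp add: kl)
  have "z ^ p = X powi (int p * k) * Y powi (l * int p)"
    by (simp add: z_def power_mult_distrib power_int_mult mult.commute[of "int p"])
  also have "\<dots> = Y powi (k * int q + l * int p)"
    using assms e[of k] by (simp add: power_int_add mult.commute[of k])
  finally have "z ^ p = Y" by (simp add: kl)
  with 1 assms show ?thesis by (intro exI[of _ z]) (auto simp: z_def)
qed

text \<open>Applied to the eigenvalues of F, the common root is the multiplier by which F acts on
  the parameter of the curve.\<close>

lemma coprime_common_contraction:
  assumes "coprime p q" "0 < q" "0 < cmod a" "cmod a < 1" "0 < cmod b" "a ^ p = b ^ q"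
  obtains \<beta> where "0 < cmod \<beta>" "cmod \<beta> < 1" "\<beta> ^ q = a" "\<beta> ^ p = b"
proof -
  obtain \<beta> where \<beta>: "\<beta> \<noteq> 0" "\<beta> ^ q = a" "\<beta> ^ p = b"
    using coprime_common_root[of p q a b] assms by auto
  have "cmod \<beta> < 1"
  proof (rule ccontr)
    assume "\<not> ?thesis"
    then have "1 \<le> cmod \<beta> ^ q" by simp
    then show False using \<beta> assms(4) by (simp add: norm_power[symmetric])
  qed
  with \<beta> show ?thesis using that by auto
qed

text \<open>If \<open>k * q\<close> is 1 modulo \<open>p\<close>, then
  \<open>i = k * M mod p\<close> makes \<open>M - q * i\<close> divisible by \<open>p\<close>, and
  \<open>i \<le> p\<close> keeps this difference nonnegative. The bound \<open>p * q\<close> is the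
  one that the weight of the binomial factor supplies.\<close>

lemma coprime_semigroup:
  fixes p q M :: nat
  assumes "coprime p q" "0 < p" "p * q \<le> M"
  shows "\<exists>i j. M = q * i + p * j"
proof -
  obtain k l :: int where kl: "k * int q + l * int p = 1"
    using bezout_int[of "int q" "int p"] assms(1) by (auto simp: coprime_iff_gcd_eq_1 gcd.commute)
  define r where "r = (k * int M) mod int p"
  have r: "0 \<le> r" "r < int p" using assms(2) by (simp_all add: r_def)
  define i where "i = nat r"
  have "int q * r = int q * (k * int M) - int p * (int q * ((k * int M) div int p))"
    by (simp add: r_def minus_mult_div_eq_mod[symmetric] algebra_simps)
  also have "int q * (k * int M) = (1 - l * int p) * int M"
    by (simp add: kl[symmetric] algebra_simps)
  finally have "int M - int q * r = int p * (l * int M + int q * ((k * int M) div int p))"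
    by (simp add: algebra_simps)
  then have "int p dvd int M - int q * int i" using r by (simp add: i_def)
  moreover have "i \<le> p" using r by (simp add: i_def)
  then have le: "q * i \<le> M" using assms(3) by (metis mult.commute mult_le_mono2 order_trans)
  ultimately have "p dvd M - q * i" by (metis int_dvd_int_iff of_nat_diff of_nat_mult)
  then obtain j where "M - q * i = p * j" by blast
  then have "M = q * i + p * j" using le by simp
  then show ?thesis by blast
qed

text \<open>The constant \<open>e\<close> places the curve through \<open>(x0, y0)\<close>. The
  curve is then parametrised by \<open>(x0 * z ^ q, y0 * z ^ p)\<close>, bijectively outside the
  origin because the exponents are coprime, and the given point has parameter 1.\<close>

lemma curve_factor_binomial:
  assumes ab: "0 < cmod a" "cmod a < 1" "0 < cmod b" "cmod b < 1"
    and pq: "coprime p q" "0 < p" "0 < q" "a ^ p = b ^ q" and xy: "x0 \<noteq> 0" "y0 \<noteq> 0"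
  defines "e \<equiv> x0 ^ p / y0 ^ q"
  shows "curve_factor a b (\<lambda>r. fst r ^ p - e * snd r ^ q) (a ^ p)"
  unfolding curve_factor_def
proof (intro conjI allI impI)
  have e: "e \<noteq> 0" using xy by (simp add: e_def)
  show "holomorphic2_on (\<lambda>r. fst r ^ p - e * snd r ^ q) UNIV" by (intro holomorphic2_intros)
  show "a ^ p \<noteq> 0" using ab by auto
  show "fst (dil a b r) ^ p - e * snd (dil a b r) ^ q = a ^ p * (fst r ^ p - e * snd r ^ q)" for r
    using pq by (simp add: dil_def power_mult_distrib algebra_simps)
  have "(x, y) \<in> closure {r. fst r ^ p - e * snd r ^ q \<noteq> 0}" for x y
  proof -
    \<comment> \<open>On each horizontal line the zero set is finite, so already within that line
      its complement is dense.\<close>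
    have "finite {z. z ^ p = e * y ^ q}" using pq by (intro finite_nth_roots) auto
    then have "(x, y) \<in> closure ((- {z. z ^ p = e * y ^ q}) \<times> {y})"
      by (simp add: closure_Times closure_Compl_finite)
    moreover have "(- {z. z ^ p = e * y ^ q}) \<times> {y} \<subseteq> {r. fst r ^ p - e * snd r ^ q \<noteq> 0}" by auto
    ultimately show ?thesis using closure_mono by blast
  qed
  then show "closure {r. fst r ^ p - e * snd r ^ q \<noteq> 0} = UNIV" by auto
  show "\<exists>g. holomorphic2_on g S \<and> (\<forall>r\<in>S. f r = (fst r ^ p - e * snd r ^ q) * g r)"
    if S: "open S" "0 \<notin> S" "holomorphic2_on f S" "\<forall>r\<in>S. fst r ^ p - e * snd r ^ q = 0 \<longrightarrow> f r = 0" for S f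
  proof (rule holomorphic2_divide_simple_zeros[OF S(1,3)])
    show "holomorphic2_on (\<lambda>r. fst r ^ p - e * snd r ^ q) S" by (intro holomorphic2_intros)
    \<comment> \<open>On the curve, \<open>x = 0\<close> would force \<open>y = 0\<close>, which
      \<open>S\<close> excludes; so the x-derivative \<open>p * x ^ (p - 1)\<close> is
      nonzero.\<close>
    fix x y assume r: "(x, y) \<in> S" "fst (x, y) ^ p - e * snd (x, y) ^ q = 0"
    then have "x \<noteq> 0" using S(2) e pq by (cases "x = 0") (auto simp: zero_prod_def zero_power)
    moreover have "deriv (\<lambda>x. x ^ p - e * y ^ q) x = of_nat p * x ^ (p - 1)"
      by (rule DERIV_imp_deriv) (auto intro!: derivative_eq_intros)
    ultimately show "f (x, y) = 0 \<and> deriv (\<lambda>x. fst (x, y) ^ p - e * snd (x, y) ^ q) x \<noteq> 0"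
      using r S(4) pq by auto
  qed
  obtain \<beta> where \<beta>0: "0 < cmod \<beta>" and \<beta>1: "cmod \<beta> < 1" and \<beta>: "\<beta> ^ q = a" "\<beta> ^ p = b"
    using coprime_common_contraction[OF pq(1,3) ab(1-3) pq(4)] .
  show "\<exists>\<kappa>1 \<kappa>2 \<beta>. curve_param a b (\<lambda>r. fst r ^ p - e * snd r ^ q) (a ^ p) \<kappa>1 \<kappa>2 \<beta>"
    unfolding curve_param_def
  proof (rule exI[of _ "\<lambda>z. x0 * z ^ q"], rule exI[of _ "\<lambda>z. y0 * z ^ p"], rule exI[of _ \<beta>], intro conjI allI impI)
    show "{r. r \<noteq> 0 \<and> fst r ^ p - e * snd r ^ q = 0} = (\<lambda>z. (x0 * z ^ q, y0 * z ^ p)) ` (- {0})"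
    proof (intro set_eqI iffI)
      fix r assume "r \<in> (\<lambda>z. (x0 * z ^ q, y0 * z ^ p)) ` (- {0})"
      then obtain z where z: "z \<noteq> 0" "r = (x0 * z ^ q, y0 * z ^ p)" by auto
      then show "r \<in> {r. r \<noteq> 0 \<and> fst r ^ p - e * snd r ^ q = 0}"
        using xy by (simp add: zero_prod_def e_def power_mult_distrib power_mult[symmetric] mult.commute[of p])
    next
      fix r assume "r \<in> {r. r \<noteq> 0 \<and> fst r ^ p - e * snd r ^ q = 0}"
      then obtain x y where r: "r = (x, y)" "(x, y) \<noteq> 0" "x ^ p = e * y ^ q" by (cases r) auto
      have "x = 0 \<longleftrightarrow> y = 0"
        using arg_cong[OF r(3), of "\<lambda>z. z = 0"] e pq(2,3) by simp
      then have "x \<noteq> 0" "y \<noteq> 0" using r(2) by (auto simp: zero_prod_def)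
      moreover have "(x / x0) ^ p = (y / y0) ^ q" using r xy by (simp add: e_def power_divide)
      ultimately obtain z where "z \<noteq> 0" "z ^ q = x / x0" "z ^ p = y / y0"
        using coprime_common_root[OF pq(1), of "x / x0" "y / y0"] xy by auto
      then show "r \<in> (\<lambda>z. (x0 * z ^ q, y0 * z ^ p)) ` (- {0})"
        using xy r by (intro image_eqI[of _ _ z]) auto
    qed
    \<comment> \<open>The weight of the factor is \<open>a ^ p = \<beta> ^ (p * q)\<close>. The
      assumption therefore means \<open>M \<ge> p * q\<close>, so z to the power M is the
      restriction of a monomial in x and y.\<close>
    fix M assume "cmod (\<beta> powi M) \<le> cmod (a ^ p)"
    moreover have "cmod (a ^ p) = cmod \<beta> ^ (p * q)"
      by (simp add: \<beta>(1)[symmetric] norm_power power_mult[symmetric] mult.commute)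
    ultimately have "int (p * q) \<le> M" using \<beta>0 \<beta>1 by (intro power_int_norm_le_imp[of \<beta>]) auto
    then obtain m where M: "M = int m" "p * q \<le> m" by (metis nonneg_int_cases of_nat_0_le_iff of_nat_le_iff order_trans)
    obtain i j where m: "m = q * i + p * j" using coprime_semigroup[OF pq(1,2) M(2)] by blast
    show "\<exists>A. holomorphic2_on A UNIV \<and> (\<forall>p. A (dil a b p) = \<beta> powi M * A p) \<and>
              (\<forall>z. z \<noteq> 0 \<longrightarrow> A (x0 * z ^ q, y0 * z ^ p) = z powi M)"
    proof (rule exI[of _ "\<lambda>r. fst r ^ i * snd r ^ j / (x0 ^ i * y0 ^ j)"], intro conjI allI impI)
      show "holomorphic2_on (\<lambda>r. fst r ^ i * snd r ^ j / (x0 ^ i * y0 ^ j)) UNIV"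
        using xy by (intro holomorphic2_intros) auto
      have zM: "z powi M = (z ^ q) ^ i * (z ^ p) ^ j" for z :: complex
        unfolding M(1) power_int_of_nat m power_add power_mult ..
      then show "fst (dil a b r) ^ i * snd (dil a b r) ^ j / (x0 ^ i * y0 ^ j) =
          \<beta> powi M * (fst r ^ i * snd r ^ j / (x0 ^ i * y0 ^ j))" for r
        by (simp add: dil_def power_mult_distrib \<beta>)
      show "fst (x0 * z ^ q, y0 * z ^ p) ^ i * snd (x0 * z ^ q, y0 * z ^ p) ^ j / (x0 ^ i * y0 ^ j) = z powi M" for z
        using xy by (simp add: zM power_mult_distrib)
    qed
  qed (use \<beta> \<beta>0 \<beta>1 in \<open>auto simp: dil_def power_mult_distrib intro!: holomorphic_intros\<close>)
qed

section \<open>Factors of semi-invariant functions and their removal\<close>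

lemma open_punctured_plane: "open (- {0 :: complex \<times> complex})"
  by (rule open_Compl) simp

text \<open>Dividing by \<open>u\<close> divides the weight by \<open>w\<close>. Off the zero set
  this is cancellation, and density extends it to all of \<open>S\<close>.\<close>

lemma semi_invariant_at_dil:
  assumes ab: "a \<noteq> 0" "b \<noteq> 0" and u: "curve_factor a b u w" and S: "open S" "0 \<notin> S"
    and inv: "\<And>p. p \<in> S \<Longrightarrow> dil a b p \<in> S"
    and g: "holomorphic2_on g S" and fg: "\<And>p. p \<in> S \<Longrightarrow> f p = u p * g p"
    and f: "\<And>p. p \<in> S \<Longrightarrow> f (dil a b p) = s * f p" and p: "p \<in> S"
  shows "g (dil a b p) = s / w * g p"
proof -
  have w: "w \<noteq> 0" and uw: "\<And>p. u (dil a b p) = w * u p" and cl: "closure {p. u p \<noteq> 0} = UNIV"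
    using u unfolding curve_factor_def by blast+
  show ?thesis
  proof (rule eq_on_dense[where f = "\<lambda>p. g (dil a b p)" and g = "\<lambda>p. s / w * g p" and S = S and D = "{p. u p \<noteq> 0}"])
    show "continuous_on S (\<lambda>p. g (dil a b p))"
      by (rule continuous_on_compose2[OF holomorphic2_on_continuous[OF g]]) (auto intro!: continuous_intros inv)
    show "continuous_on S (\<lambda>p. s / w * g p)"
      by (intro continuous_intros holomorphic2_on_continuous[OF g])
    fix q assume q: "q \<in> S" "q \<in> {p. u p \<noteq> 0}"
    have "w * u q * g (dil a b q) = f (dil a b q)" using fg[OF inv[OF q(1)]] uw by simp
    also have "\<dots> = s * (u q * g q)" using f[OF q(1)] fg[OF q(1)] by simp
    finally have "w * u q * g (dil a b q) = s * (u q * g q)" .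
    then show "g (dil a b q) = s / w * g q" using q w by (simp add: field_simps)
  qed (use S p cl in auto)
qed

text \<open>An implication, so that it also holds when \<open>a\<close> and \<open>b\<close> are not
  resonant at all; in that case only the axes can occur as factors.\<close>

definition coprime_relation :: "complex \<Rightarrow> complex \<Rightarrow> bool" where
  "coprime_relation a b \<longleftrightarrow>
     (\<exists>m n. 0 < m \<and> 0 < n \<and> a ^ m = b ^ n) \<longrightarrow> (\<exists>p q. coprime p q \<and> 0 < p \<and> 0 < q \<and> a ^ p = b ^ q)"

text \<open>If \<open>f\<close> vanishes on an axis, a coordinate is a factor. Otherwise its
  restrictions to the axes are monomials without zeros, and their common weight gives
  \<open>b powi n = a powi m\<close>. For n = 0 the function is constant. For n > 0 this is a
  resonance, \<open>f\<close> has a zero off the axes, and the whole invariant curve through that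
  zero consists of zeros.\<close>

lemma semi_invariant_factor:
  assumes ab: "0 < cmod a" "cmod a < 1" "0 < cmod b" "cmod b < 1" and rel: "coprime_relation a b"
    and f: "holomorphic2_on f (- {0})"
    and sc: "\<And>p. p \<noteq> 0 \<Longrightarrow> f (dil a b p) = s * f p" and p1: "p1 \<noteq> 0" "f p1 \<noteq> 0"
    and nc: "\<not> (\<exists>c. \<forall>p. p \<noteq> 0 \<longrightarrow> f p = c)"
  shows "\<exists>u w. curve_factor a b u w \<and> cmod w \<le> max (cmod a) (cmod b) \<and>
    (\<forall>p. p \<noteq> 0 \<longrightarrow> u p = 0 \<longrightarrow> f p = 0)"
proof -
  have ab0: "a \<noteq> 0" "b \<noteq> 0" using ab by auto
  have nz: "dil a b p \<noteq> 0" if "p \<noteq> 0" for p using that ab0 by (simp add: dil_eq_0_iff)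
  have s1: "cmod s \<le> 1"
    by (rule semi_invariant_norm_le_1[OF ab f sc p1])
  consider "\<forall>y. y \<noteq> 0 \<longrightarrow> f (0, y) = 0" | "\<forall>x. x \<noteq> 0 \<longrightarrow> f (x, 0) = 0"
    | x1 y1 where "x1 \<noteq> 0" "y1 \<noteq> 0" "f (0, y1) \<noteq> 0" "f (x1, 0) \<noteq> 0" by blast
  then show ?thesis
  proof cases
    case 1
    then show ?thesis
      using curve_factor_fst[OF ab]
      by (intro exI[of _ fst] exI[of _ a]) (auto simp: zero_prod_def)
  next
    case 2
    then show ?thesis
      using curve_factor_snd[OF ab]
      by (intro exI[of _ snd] exI[of _ b]) (auto simp: zero_prod_def)
  next
    case (3 x1 y1)
    have "(\<lambda>y. f (0, y)) holomorphic_on - {0}"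
      by (rule holomorphic2_on_curve[OF f]) (auto simp: zero_prod_def)
    moreover have "f (0, b * y) = s * f (0, y)" if "y \<noteq> 0" for y
      using sc[of "(0, y)"] that by (simp add: dil_def zero_prod_def)
    ultimately obtain c n where cn: "c \<noteq> 0" "b powi n = s" "\<And>y. y \<noteq> 0 \<Longrightarrow> f (0, y) = c * y powi n"
      using punctured_scaling_monomial[of "\<lambda>y. f (0, y)" b s y1] ab 3 by blast
    have "(\<lambda>x. f (x, 0)) holomorphic_on - {0}"
      by (rule holomorphic2_on_curve[OF f]) (auto simp: zero_prod_def)
    moreover have "f (a * x, 0) = s * f (x, 0)" if "x \<noteq> 0" for x
      using sc[of "(x, 0)"] that by (simp add: dil_def zero_prod_def)
    ultimately obtain d m where dm: "d \<noteq> 0" "a powi m = s" "\<And>x. x \<noteq> 0 \<Longrightarrow> f (x, 0) = d * x powi m"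
      using punctured_scaling_monomial[of "\<lambda>x. f (x, 0)" a s x1] ab 3 by blast
    have "int 0 \<le> n" using cn(2) s1 ab by (intro power_int_norm_le_imp[of b]) auto
    have "int 0 \<le> m" using dm(2) s1 ab by (intro power_int_norm_le_imp[of a]) auto
    \<comment> \<open>For \<open>n = 0\<close> the weight is 1 and \<open>f - c\<close> is divisible
      by x. The quotient has weight \<open>1 / a\<close>, of modulus above 1, so it vanishes and
      \<open>f\<close> is constant.\<close>
    have "n \<noteq> 0"
    proof
      assume n: "n = 0"
      then have s: "s = 1" using cn by simp
      have "\<exists>g. holomorphic2_on g (- {0}) \<and> (\<forall>p\<in>- {0}. f p - c = fst p * g p)"
        by (rule holomorphic2_divide_simple_zeros)
           (use f cn n in \<open>auto intro!: holomorphic2_intros simp: zero_prod_def\<close>)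
      then obtain g where g: "holomorphic2_on g (- {0})" "\<And>p. p \<noteq> 0 \<Longrightarrow> f p - c = fst p * g p" by blast
      have ga: "g (dil a b p) = 1 / a * g p" if "p \<noteq> 0" for p
        by (rule semi_invariant_at_dil[OF ab0 curve_factor_fst[OF ab] _ _ _ g(1), where f = "\<lambda>p. f p - c"])
           (use that nz sc s g(2) in auto)
      have "\<not> cmod (1 / a) \<le> 1" using ab by (simp add: norm_divide)
      then have "g p = 0" if "p \<noteq> 0" for p
        using semi_invariant_norm_le_1[where f = g, OF ab g(1) ga that] by blast
      then have "f p = c" if "p \<noteq> 0" for p using g(2)[OF that] that by simp
      then show False using nc by blast
    qed
    with \<open>int 0 \<le> n\<close> obtain n' where n': "n = int n'" "0 < n'"
      by (metis int_eq_iff of_nat_0 of_nat_0_less_iff order_le_less)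
    have sb: "cmod s < 1"
    proof -
      have "cmod s = cmod b ^ n'" using cn(2) n' by (metis norm_power power_int_of_nat)
      then show ?thesis using power_strict_decreasing[of 0 n' "cmod b"] ab n' by simp
    qed
    then have "s \<noteq> 1" by auto
    then have "m \<noteq> 0" using dm by auto
    with \<open>int 0 \<le> m\<close> obtain m' where m': "m = int m'" "0 < m'"
      by (metis int_eq_iff of_nat_0 of_nat_0_less_iff order_le_less)
    have "a ^ m' = b ^ n'" using cn dm n' m' by simp
    then obtain p q where pq: "coprime p q" "0 < p" "0 < q" "a ^ p = b ^ q"
      using rel m' n' unfolding coprime_relation_def by blast
    \<comment> \<open>Without zeros, \<open>1 / f\<close> would be holomorphic with weight
      \<open>1 / s\<close>, whose modulus exceeds 1.\<close>
    have "\<exists>q. q \<noteq> 0 \<and> f q = 0"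
    proof (rule ccontr)
      assume no: "\<not> ?thesis"
      have h: "holomorphic2_on (\<lambda>p. inverse (f p)) (- {0})"
        by (intro holomorphic2_on_inverse f) (use no in auto)
      have "s \<noteq> 0"
      proof
        assume "s = 0"
        then have "f (dil a b p1) = 0" using sc[OF p1(1)] by simp
        then show False using no nz[OF p1(1)] by blast
      qed
      then have "\<not> cmod (inverse s) \<le> 1" using sb by (simp add: norm_inverse inverse_le_1_iff)
      moreover have "inverse (f (dil a b p)) = inverse s * inverse (f p)" if "p \<noteq> 0" for p
        using arg_cong[OF sc[OF that], of inverse] by simp
      ultimately show False
        using semi_invariant_norm_le_1[where f = "\<lambda>p. inverse (f p)" and s = "inverse s", OF ab h _ p1(1)] p1(2) by simp
    qed
    then obtain x0 y0 where z: "(x0, y0) \<noteq> 0" "f (x0, y0) = 0" by (metis surj_pair)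
    have x0: "x0 \<noteq> 0" using z cn by (auto simp: zero_prod_def)
    have y0: "y0 \<noteq> 0" using z dm by (auto simp: zero_prod_def)
    define e where "e = x0 ^ p / y0 ^ q"
    define u where "u = (\<lambda>r. fst r ^ p - e * snd r ^ q)"
    have cf: "curve_factor a b u (a ^ p)"
      unfolding u_def e_def by (rule curve_factor_binomial[OF ab pq x0 y0])
    have "f r = 0" if r: "r \<noteq> 0" "u r = 0" for r
    proof -
      obtain \<beta> where \<beta>0: "0 < cmod \<beta>" and \<beta>1: "cmod \<beta> < 1" and \<beta>: "\<beta> ^ q = a" "\<beta> ^ p = b"
        using coprime_common_contraction[OF pq(1,3) ab(1-3) pq(4)] .
      obtain x y where xy: "r = (x, y)" by (cases r)
      have e0: "e \<noteq> 0" using x0 y0 by (simp add: e_def)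
      have eq: "x ^ p = e * y ^ q" using r by (simp add: u_def xy)
      have "x = 0 \<longleftrightarrow> y = 0"
        using arg_cong[OF eq, of "\<lambda>z. z = 0"] e0 pq(2,3) by simp
      then have "y \<noteq> 0" "x \<noteq> 0" using r by (auto simp: xy zero_prod_def)
      moreover have "(x / x0) ^ p = (y / y0) ^ q" using eq x0 y0 by (simp add: e_def power_divide)
      ultimately obtain \<zeta> where \<zeta>: "\<zeta> \<noteq> 0" "\<zeta> ^ q = x / x0" "\<zeta> ^ p = y / y0"
        using coprime_common_root[OF pq(1), of "x / x0" "y / y0"] x0 y0 by auto
      \<comment> \<open>The restriction of \<open>f\<close> to the curve. It is zero or a monomial,
        and a nonzero monomial does not vanish at the parameter 1 of the known zero.\<close>
      define k where "k = (\<lambda>z. f (x0 * z ^ q, y0 * z ^ p))"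
      have hk: "k holomorphic_on - {0}" unfolding k_def
        by (rule holomorphic2_on_curve[OF f]) (use x0 y0 in \<open>auto simp: zero_prod_def intro!: holomorphic_intros\<close>)
      have ks: "k (\<beta> * z) = s * k z" if "z \<noteq> 0" for z
        using sc[of "(x0 * z ^ q, y0 * z ^ p)"] that x0
        by (simp add: k_def dil_def zero_prod_def power_mult_distrib \<beta> mult.left_commute)
      have "k \<zeta> = 0"
      proof (rule ccontr)
        assume "k \<zeta> \<noteq> 0"
        then obtain c N where "c \<noteq> 0" "\<And>z. z \<noteq> 0 \<Longrightarrow> k z = c * z powi N"
          using punctured_scaling_monomial[OF hk \<beta>0 \<beta>1 ks \<zeta>(1)] by auto
        then have "k 1 \<noteq> 0" by simp
        then show False using z by (simp add: k_def)
      qed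
      then show ?thesis using \<zeta> x0 y0 by (simp add: k_def xy)
    qed
    moreover have "cmod (a ^ p) \<le> max (cmod a) (cmod b)"
      using ab pq(2) power_decreasing[of 1 p "cmod a"] by (simp add: norm_power le_max_iff_disj)
    ultimately show ?thesis using cf by blast
  qed
qed

text \<open>The induction removes one curve factor \<open>u\<close> of \<open>\<delta>\<close> at a time: on the curve \<open>u = 0\<close> the
  functions \<open>\<alpha> i\<close> agree, hence are induced by a semi-invariant polynomial \<open>A\<close>, and
  \<open>(\<alpha> i - A) / u\<close> replaces \<open>\<alpha> i\<close>.\<close>

lemma cocycle_splits_coprime:
  fixes U :: "'i \<Rightarrow> (complex \<times> complex) set"
  assumes ab: "0 < cmod a" "cmod a < 1" "0 < cmod b" "cmod b < 1" and rel: "coprime_relation a b"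
    and t: "1 \<le> cmod t"
    and U: "\<And>i. i \<in> I \<Longrightarrow> open (U i)" "(\<Union>i\<in>I. U i) = - {0}"
      "\<And>i p. i \<in> I \<Longrightarrow> p \<in> U i \<Longrightarrow> dil a b p \<in> U i"
      "\<And>i p. i \<in> I \<Longrightarrow> dil a b p \<in> U i \<Longrightarrow> p \<in> U i"
    and g: "\<And>i j. i \<in> I \<Longrightarrow> j \<in> I \<Longrightarrow> continuous_on (U i \<inter> U j) (g i j)"
    and \<delta>: "holomorphic2_on \<delta> (- {0})" "\<And>p. p \<noteq> 0 \<Longrightarrow> \<delta> (dil a b p) = s * t * \<delta> p"
      "p1 \<noteq> 0" "\<delta> p1 \<noteq> 0"
    and \<alpha>: "\<And>i. i \<in> I \<Longrightarrow> holomorphic2_on (\<alpha> i) (U i)"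
      "\<And>i p. i \<in> I \<Longrightarrow> p \<in> U i \<Longrightarrow> \<alpha> i (dil a b p) = s * \<alpha> i p"
      "\<And>i j p. i \<in> I \<Longrightarrow> j \<in> I \<Longrightarrow> p \<in> U i \<inter> U j \<Longrightarrow> \<alpha> i p - \<alpha> j p = \<delta> p * g i j p"
  shows "\<exists>h. (\<forall>i\<in>I. holomorphic2_on (h i) (U i) \<and> (\<forall>p\<in>U i. t * h i (dil a b p) = h i p)) \<and>
    (\<forall>i\<in>I. \<forall>j\<in>I. \<forall>p\<in>U i \<inter> U j. h i p - h j p = g i j p)"
proof -
  have ab0: "a \<noteq> 0" "b \<noteq> 0" using ab by auto
  have nz: "dil a b p \<noteq> 0" if "p \<noteq> 0" for p using that ab0 by (simp add: dil_eq_0_iff)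
  define c where "c = max (cmod a) (cmod b)"
  have c: "0 < c" "c < 1" using ab by (auto simp: c_def less_max_iff_disj)
  have U0: "0 \<notin> U i" if "i \<in> I" for i using U(2) that by blast
  have t0: "t \<noteq> 0" using t by auto
  \<comment> \<open>\<open>dil a b\<close> is surjective, so weight 0 would make \<delta> vanish
    everywhere.\<close>
  have st: "s * t \<noteq> 0" if \<delta>: "holomorphic2_on \<delta> (- {0})" "\<And>p. p \<noteq> 0 \<Longrightarrow> \<delta> (dil a b p) = s * t * \<delta> p"
      "p1 \<noteq> 0" "\<delta> p1 \<noteq> 0" for \<delta> s and p1 :: "complex \<times> complex"
  proof
    assume "s * t = 0"
    define q where "q = (fst p1 / a, snd p1 / b)"
    have "dil a b q = p1" using ab0 by (simp add: q_def dil_def)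
    moreover then have "q \<noteq> 0" using \<delta>(3) by (auto simp: dil_def zero_prod_def)
    ultimately show False using \<delta>(2)[of q] \<delta>(4) \<open>s * t = 0\<close> by simp
  qed
  \<comment> \<open>\<open>n\<close> bounds the number of removable factors: each removal divides
    \<open>s\<close> by some \<open>w\<close> with \<open>cmod w \<le> c\<close>, whereas
    \<open>cmod (s * t)\<close> never exceeds 1. The claim mentions only \<open>t\<close> and
    \<open>g\<close>, so the induction is free to change \<delta>, \<open>s\<close> and
    \<alpha>.\<close>
  obtain n where "c ^ n < cmod (s * t)"
    using real_arch_pow_inv[of "cmod (s * t)" c] c st[OF \<delta>] by auto
  then show ?thesis using \<delta> \<alpha>
  proof (induction n arbitrary: \<delta> s p1 \<alpha>)
    case 0
    have "cmod (s * t) \<le> 1" by (rule semi_invariant_norm_le_1[OF ab 0(2-5)])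
    then show ?case using 0(1) by simp
  next
    case (Suc n)
    note \<delta> = Suc.prems(2-5) and \<alpha> = Suc.prems(6-8)
    have st0: "s * t \<noteq> 0" by (rule st[OF \<delta>])
    show ?case
    proof (cases "\<exists>c. \<forall>p. p \<noteq> 0 \<longrightarrow> \<delta> p = c")
      case True
      then obtain d where d: "\<And>p. p \<noteq> 0 \<Longrightarrow> \<delta> p = d" by blast
      have d0: "d \<noteq> 0" using d[OF \<delta>(3)] \<delta>(4) by simp
      \<comment> \<open>A nonzero constant has weight 1. The quotients \<alpha> i / d then have
        weight \<open>1 / t\<close>, the one a splitting must have.\<close>
      have st1: "s * t = 1" using \<delta>(2)[OF \<delta>(3)] d[OF \<delta>(3)] d[OF nz[OF \<delta>(3)]] d0 by simp
      show ?thesis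
      proof (intro exI[of _ "\<lambda>i p. \<alpha> i p / d"] conjI ballI)
        fix i assume i: "i \<in> I"
        show "holomorphic2_on (\<lambda>p. \<alpha> i p / d) (U i)"
          by (intro holomorphic2_intros \<alpha>(1) i d0)
        show "t * (\<alpha> i (dil a b p) / d) = \<alpha> i p / d" if "p \<in> U i" for p
          using \<alpha>(2)[OF i that] st1 by (simp add: mult.assoc[symmetric] mult.commute[of t])
        fix j p assume j: "j \<in> I" "p \<in> U i \<inter> U j"
        then have "p \<noteq> 0" using U0 i by blast
        then show "\<alpha> i p / d - \<alpha> j p / d = g i j p"
          using \<alpha>(3)[OF i j] d d0 by (simp add: diff_divide_distrib[symmetric])
      qed
    next
      case False
      obtain u w where uw: "curve_factor a b u w" "cmod w \<le> c" and \<delta>u: "\<And>p. p \<noteq> 0 \<Longrightarrow> u p = 0 \<Longrightarrow> \<delta> p = 0"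
        using semi_invariant_factor[OF ab rel \<delta>(1,2,3,4) False] unfolding c_def by blast
      have w: "w \<noteq> 0" and u: "holomorphic2_on u UNIV" and cl: "closure {p. u p \<noteq> 0} = UNIV"
        and dv: "\<And>S f. open S \<Longrightarrow> 0 \<notin> S \<Longrightarrow> holomorphic2_on f S \<Longrightarrow> (\<And>p. p \<in> S \<Longrightarrow> u p = 0 \<Longrightarrow> f p = 0) \<Longrightarrow>
          \<exists>g. holomorphic2_on g S \<and> (\<forall>p\<in>S. f p = u p * g p)"
        using uw(1) unfolding curve_factor_def by blast+
      obtain \<kappa>1 \<kappa>2 \<beta> where cp: "curve_param a b u w \<kappa>1 \<kappa>2 \<beta>"
        using uw(1) unfolding curve_factor_def by (elim conjE exE)
      have \<beta>: "0 < cmod \<beta>" "cmod \<beta> < 1" and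
        \<kappa>: "\<kappa>1 holomorphic_on UNIV" "\<kappa>2 holomorphic_on UNIV"
          "{p. p \<noteq> 0 \<and> u p = 0} = (\<lambda>z. (\<kappa>1 z, \<kappa>2 z)) ` (- {0})"
          "\<And>z. (\<kappa>1 (\<beta> * z), \<kappa>2 (\<beta> * z)) = dil a b (\<kappa>1 z, \<kappa>2 z)" and
        ext: "\<And>M. cmod (\<beta> powi M) \<le> cmod w \<Longrightarrow>
           (\<exists>A. holomorphic2_on A UNIV \<and> (\<forall>p. A (dil a b p) = \<beta> powi M * A p) \<and>
              (\<forall>z. z \<noteq> 0 \<longrightarrow> A (\<kappa>1 z, \<kappa>2 z) = z powi M))"
        using cp unfolding curve_param_def by (blast, blast, blast, blast, blast, blast, blast)
      have \<kappa>0: "(\<kappa>1 z, \<kappa>2 z) \<noteq> 0" "u (\<kappa>1 z, \<kappa>2 z) = 0" if "z \<noteq> 0" for z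
        using \<kappa>(3) that by blast+
      obtain \<delta>' where \<delta>': "holomorphic2_on \<delta>' (- {0})" "\<And>p. p \<noteq> 0 \<Longrightarrow> \<delta> p = u p * \<delta>' p"
        using dv[OF open_punctured_plane _ \<delta>(1)] \<delta>u by blast
      have \<delta>'w: "\<delta>' (dil a b p) = s / w * t * \<delta>' p" if "p \<noteq> 0" for p
        using semi_invariant_at_dil[OF ab0 uw(1) open_punctured_plane _ _ \<delta>'(1), of \<delta> "s * t" p] \<delta>'(2) \<delta>(2) nz that by simp
      have \<delta>'1: "\<delta>' p1 \<noteq> 0" using \<delta>'(2)[OF \<delta>(3)] \<delta>(4) by auto
      \<comment> \<open>This is where \<open>1 \<le> cmod t\<close> enters: the quotient \<delta>'
        has weight \<open>s / w * t\<close> of modulus at most 1, and dropping \<open>t\<close> only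
        makes the left side of the bound smaller.\<close>
      have sw: "cmod s \<le> cmod w"
      proof -
        have "cmod (s / w * t) \<le> 1"
          by (rule semi_invariant_norm_le_1[OF ab \<delta>'(1) \<delta>'w \<delta>(3) \<delta>'1])
        then have "cmod s * cmod t \<le> cmod w" using w by (simp add: norm_mult norm_divide divide_simps)
        moreover have "cmod s * 1 \<le> cmod s * cmod t" using t by (intro mult_left_mono) auto
        ultimately show ?thesis by simp
      qed
      have small: "c ^ n < cmod (s / w * t)"
      proof -
        have "c ^ n * cmod w \<le> c ^ n * c" using c uw by (intro mult_left_mono) auto
        also have "\<dots> < cmod (s * t)" using Suc.prems(1) by (simp add: mult.commute)
        finally show ?thesis using w by (simp add: norm_mult norm_divide divide_simps)
      qed
      \<comment> \<open>The common restriction of the \<alpha> i to the curve. Their differences are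
        multiples of \<delta>, which vanishes there, so any chart containing the point gives the
        same value.\<close>
      define v where "v = (\<lambda>z. \<alpha> (SOME i. i \<in> I \<and> (\<kappa>1 z, \<kappa>2 z) \<in> U i) (\<kappa>1 z, \<kappa>2 z))"
      have v: "v z = \<alpha> i (\<kappa>1 z, \<kappa>2 z)" if "i \<in> I" "(\<kappa>1 z, \<kappa>2 z) \<in> U i" "z \<noteq> 0" for i z
      proof -
        define j where "j = (SOME i. i \<in> I \<and> (\<kappa>1 z, \<kappa>2 z) \<in> U i)"
        have j: "j \<in> I \<and> (\<kappa>1 z, \<kappa>2 z) \<in> U j"
          unfolding j_def by (rule someI[of _ i]) (use that in auto)
        have "\<alpha> j (\<kappa>1 z, \<kappa>2 z) - \<alpha> i (\<kappa>1 z, \<kappa>2 z) = 0"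
          using \<alpha>(3)[of j i "(\<kappa>1 z, \<kappa>2 z)"] j that \<delta>u \<kappa>0 by simp
        then show ?thesis by (simp add: v_def j_def)
      qed
      have Ui: "\<exists>i\<in>I. (\<kappa>1 z, \<kappa>2 z) \<in> U i" if "z \<noteq> 0" for z
        using \<kappa>0(1)[OF that] U(2) by blast
      have hv: "v holomorphic_on - {0}"
      proof (rule holomorphic_onI)
        fix z :: complex assume z: "z \<in> - {0}"
        then obtain i where i: "i \<in> I" "(\<kappa>1 z, \<kappa>2 z) \<in> U i" using Ui by blast
        define Z where "Z = (- {0}) \<inter> (\<lambda>z. (\<kappa>1 z, \<kappa>2 z)) -` U i"
        have Z: "open Z" unfolding Z_def
          by (intro continuous_open_preimage continuous_on_Pair holomorphic_on_imp_continuous_on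
              holomorphic_on_subset[OF \<kappa>(1)] holomorphic_on_subset[OF \<kappa>(2)] U(1) i) auto
        have "(\<lambda>z. \<alpha> i (\<kappa>1 z, \<kappa>2 z)) holomorphic_on Z"
          by (rule holomorphic2_on_curve[OF \<alpha>(1)[OF i(1)] holomorphic_on_subset[OF \<kappa>(1)]
              holomorphic_on_subset[OF \<kappa>(2)] Z]) (auto simp: Z_def)
        then have "v holomorphic_on Z"
        proof (rule holomorphic_transform)
          fix z assume "z \<in> Z"
          then show "\<alpha> i (\<kappa>1 z, \<kappa>2 z) = v z" using v[OF i(1), of z] by (simp add: Z_def)
        qed
        moreover have "z \<in> Z" using z i(2) by (simp add: Z_def)
        ultimately have "v field_differentiable at z"
          using Z holomorphic_on_imp_differentiable_at by blast
        then show "v field_differentiable at z within - {0}"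
          by (rule field_differentiable_at_within)
      qed
      have vs: "v (\<beta> * z) = s * v z" if z: "z \<noteq> 0" for z
      proof -
        obtain i where i: "i \<in> I" "(\<kappa>1 z, \<kappa>2 z) \<in> U i" using Ui[OF z] by blast
        have "v (\<beta> * z) = \<alpha> i (dil a b (\<kappa>1 z, \<kappa>2 z))"
          using v[OF i(1), of "\<beta> * z", unfolded \<kappa>(4), OF U(3)[OF i]] z \<beta>(1) by simp
        also have "\<dots> = s * v z" unfolding v[OF i z] by (rule \<alpha>(2)[OF i])
        finally show ?thesis .
      qed
      have "\<exists>A. holomorphic2_on A UNIV \<and> (\<forall>p. A (dil a b p) = s * A p) \<and> (\<forall>z. z \<noteq> 0 \<longrightarrow> A (\<kappa>1 z, \<kappa>2 z) = v z)"
      proof (cases "\<forall>z. z \<noteq> 0 \<longrightarrow> v z = 0")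
        case True
        then show ?thesis by (intro exI[of _ "\<lambda>_. 0"]) auto
      next
        case False
        then obtain z1 where z1: "z1 \<noteq> 0" "v z1 \<noteq> 0" by blast
        obtain d M where d: "\<beta> powi M = s" "\<And>z. z \<noteq> 0 \<Longrightarrow> v z = d * z powi M"
          using punctured_scaling_monomial[OF hv \<beta> vs z1] by blast
        then obtain A where "holomorphic2_on A UNIV" "\<And>p. A (dil a b p) = s * A p"
            "\<And>z. z \<noteq> 0 \<Longrightarrow> A (\<kappa>1 z, \<kappa>2 z) = z powi M"
          using ext[of M] sw by auto
        then show ?thesis using d by (intro exI[of _ "\<lambda>p. d * A p"]) (auto intro!: holomorphic2_intros)
      qed
      then obtain A where A: "holomorphic2_on A UNIV" "\<And>p. A (dil a b p) = s * A p"
          "\<And>z. z \<noteq> 0 \<Longrightarrow> A (\<kappa>1 z, \<kappa>2 z) = v z" by blast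
      have "\<exists>\<gamma>. holomorphic2_on \<gamma> (U i) \<and> (\<forall>p\<in>U i. \<alpha> i p - A p = u p * \<gamma> p)" if i: "i \<in> I" for i
      proof (rule dv[OF U(1)[OF i] U0[OF i]])
        show "holomorphic2_on (\<lambda>p. \<alpha> i p - A p) (U i)"
          by (intro holomorphic2_intros \<alpha>(1) i holomorphic2_on_subset[OF A(1)]) auto
        fix p assume p: "p \<in> U i" "u p = 0"
        then have "p \<in> {p. p \<noteq> 0 \<and> u p = 0}" using U0[OF i] by auto
        then obtain z where "z \<noteq> 0" "p = (\<kappa>1 z, \<kappa>2 z)" unfolding \<kappa>(3) by blast
        then show "\<alpha> i p - A p = 0" using A(3) v[OF i] p by simp
      qed
      then obtain \<gamma> where \<gamma>: "\<And>i. i \<in> I \<Longrightarrow> holomorphic2_on (\<gamma> i) (U i)"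
          "\<And>i p. i \<in> I \<Longrightarrow> p \<in> U i \<Longrightarrow> \<alpha> i p - A p = u p * \<gamma> i p" by metis
      show ?thesis
      proof (rule Suc.IH[OF small \<delta>'(1) \<delta>'w \<delta>(3) \<delta>'1, of \<gamma>])
        fix i assume i: "i \<in> I"
        show "holomorphic2_on (\<gamma> i) (U i)" by (rule \<gamma>(1)[OF i])
        show "\<gamma> i (dil a b p) = s / w * \<gamma> i p" if "p \<in> U i" for p
          by (rule semi_invariant_at_dil[OF ab0 uw(1) U(1)[OF i] U0[OF i] _ \<gamma>(1)[OF i], where f = "\<lambda>p. \<alpha> i p - A p"])
             (use i U(3) \<gamma>(2) \<alpha>(2) A(2) that in \<open>auto simp: algebra_simps\<close>)
        fix j p assume j: "j \<in> I" and p: "p \<in> U i \<inter> U j"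
        show "\<gamma> i p - \<gamma> j p = \<delta>' p * g i j p"
        proof (rule eq_on_dense[where f = "\<lambda>p. \<gamma> i p - \<gamma> j p" and g = "\<lambda>p. \<delta>' p * g i j p" and S = "U i \<inter> U j" and D = "{p. u p \<noteq> 0}"])
          show "continuous_on (U i \<inter> U j) (\<lambda>p. \<gamma> i p - \<gamma> j p)"
            by (intro continuous_intros holomorphic2_on_continuous holomorphic2_on_subset[OF \<gamma>(1)[OF i]]
                holomorphic2_on_subset[OF \<gamma>(1)[OF j]]) auto
          show "continuous_on (U i \<inter> U j) (\<lambda>p. \<delta>' p * g i j p)"
            using U0[OF i] by (intro continuous_intros holomorphic2_on_continuous holomorphic2_on_subset[OF \<delta>'(1)] g i j) auto
          fix q assume q: "q \<in> U i \<inter> U j" "q \<in> {p. u p \<noteq> 0}"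
          then have "q \<noteq> 0" using U0[OF i] by blast
          have "u q * (\<gamma> i q - \<gamma> j q) = \<alpha> i q - \<alpha> j q"
            using \<gamma>(2)[OF i, of q] \<gamma>(2)[OF j, of q] q by (simp add: algebra_simps)
          also have "\<dots> = u q * (\<delta>' q * g i j q)"
            using \<alpha>(3)[OF i j q(1)] \<delta>'(2)[OF \<open>q \<noteq> 0\<close>] by simp
          finally show "\<gamma> i q - \<gamma> j q = \<delta>' q * g i j q" using q by simp
        qed (use U(1) i j p cl in auto)
      qed
    qed
  qed
qed

section \<open>From a power of the contraction back to the contraction\<close>

lemma dil_power: "(dil a b ^^ k) p = dil (a ^ k) (b ^ k) p"
  by (induction k) (auto simp: dil_def mult.assoc)

text \<open>If \<open>a ^ m = b ^ n\<close>, passing to the \<open>gcd m n\<close>-th power of \<open>dil a b\<close> makes the relation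
  coprime; averaging over the powers makes the splitting semi-invariant under \<open>dil a b\<close> again.\<close>

lemma cocycle_splits:
  fixes U :: "'i \<Rightarrow> (complex \<times> complex) set"
  assumes ab: "0 < cmod a" "cmod a < 1" "0 < cmod b" "cmod b < 1"
    and t: "1 \<le> cmod t"
    and U: "\<And>i. i \<in> I \<Longrightarrow> open (U i)" "(\<Union>i\<in>I. U i) = - {0}"
      "\<And>i p. i \<in> I \<Longrightarrow> dil a b p \<in> U i \<longleftrightarrow> p \<in> U i"
    and g: "\<And>i j. i \<in> I \<Longrightarrow> j \<in> I \<Longrightarrow> continuous_on (U i \<inter> U j) (g i j)"
      "\<And>i j p. i \<in> I \<Longrightarrow> j \<in> I \<Longrightarrow> p \<in> U i \<inter> U j \<Longrightarrow> t * g i j (dil a b p) = g i j p"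
    and \<delta>: "holomorphic2_on \<delta> (- {0})" "\<And>p. p \<noteq> 0 \<Longrightarrow> \<delta> (dil a b p) = s * t * \<delta> p"
      "p1 \<noteq> 0" "\<delta> p1 \<noteq> 0"
    and \<alpha>: "\<And>i. i \<in> I \<Longrightarrow> holomorphic2_on (\<alpha> i) (U i)"
      "\<And>i p. i \<in> I \<Longrightarrow> p \<in> U i \<Longrightarrow> \<alpha> i (dil a b p) = s * \<alpha> i p"
      "\<And>i j p. i \<in> I \<Longrightarrow> j \<in> I \<Longrightarrow> p \<in> U i \<inter> U j \<Longrightarrow> \<alpha> i p - \<alpha> j p = \<delta> p * g i j p"
  shows "\<exists>h. (\<forall>i\<in>I. holomorphic2_on (h i) (U i) \<and> (\<forall>p\<in>U i. t * h i (dil a b p) = h i p)) \<and>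
    (\<forall>i\<in>I. \<forall>j\<in>I. \<forall>p\<in>U i \<inter> U j. h i p - h j p = g i j p)"
proof -
  have ab0: "a \<noteq> 0" "b \<noteq> 0" using ab by auto
  obtain d :: nat where d: "0 < d" "coprime_relation (a ^ d) (b ^ d)"
  proof (cases "\<exists>m n. 0 < m \<and> 0 < n \<and> a ^ m = b ^ n")
    case True
    then obtain m n where mn: "0 < m" "0 < n" "a ^ m = b ^ n" by blast
    define d where "d = gcd m n"
    have "0 < d" using mn by (simp add: d_def)
    have "coprime (m div d) (n div d)" unfolding d_def using mn by (intro div_gcd_coprime) auto
    moreover have "0 < m div d" "0 < n div d"
      using mn by (simp_all add: d_def div_greater_zero_iff gcd_le1_nat gcd_le2_nat)
    moreover have "(a ^ d) ^ (m div d) = (b ^ d) ^ (n div d)"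
      using mn by (simp add: power_mult[symmetric] d_def)
    ultimately have "coprime_relation (a ^ d) (b ^ d)" unfolding coprime_relation_def by blast
    with \<open>0 < d\<close> show ?thesis using that by blast
  next
    case False
    then have "coprime_relation (a ^ 1) (b ^ 1)" unfolding coprime_relation_def power_one_right by blast
    then show ?thesis using that[of 1] zero_less_one by blast
  qed
  have Uk: "dil (a ^ k) (b ^ k) p \<in> U i \<longleftrightarrow> p \<in> U i" if "i \<in> I" for i p k
  proof -
    have "(dil a b ^^ k) p \<in> U i \<longleftrightarrow> p \<in> U i" by (induction k) (simp_all add: U(3)[OF that])
    then show ?thesis by (simp add: dil_power)
  qed
  have fk: "f ((dil a b ^^ k) p) = c ^ k * f p"
    if "\<And>p. p \<in> S \<Longrightarrow> f (dil a b p) = c * f p" "\<And>p. p \<in> S \<Longrightarrow> dil a b p \<in> S" "p \<in> S"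
    for f :: "complex \<times> complex \<Rightarrow> complex" and c k p S
  proof -
    have "(dil a b ^^ k) p \<in> S \<and> f ((dil a b ^^ k) p) = c ^ k * f p"
      using that by (induction k) auto
    then show ?thesis by simp
  qed
  have p1': "cmod (x ^ d) < 1" if "cmod x < 1" for x :: complex
    using power_strict_decreasing[of 0 d "cmod x"] that d(1) by (cases "x = 0") (simp_all add: norm_power zero_power)
  have "\<exists>h. (\<forall>i\<in>I. holomorphic2_on (h i) (U i) \<and> (\<forall>p\<in>U i. t ^ d * h i (dil (a ^ d) (b ^ d) p) = h i p)) \<and>
    (\<forall>i\<in>I. \<forall>j\<in>I. \<forall>p\<in>U i \<inter> U j. h i p - h j p = g i j p)"
  proof (rule cocycle_splits_coprime[OF _ p1'[OF ab(2)] _ p1'[OF ab(4)] d(2) _ U(1,2) _ _ g(1) \<delta>(1) _ \<delta>(3,4) \<alpha>(1) _ \<alpha>(3), where s = "s ^ d"])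
    show "0 < cmod (a ^ d)" "0 < cmod (b ^ d)" using ab0 by auto
    show "1 \<le> cmod (t ^ d)" using t by (simp add: norm_power one_le_power)
    show "\<delta> (dil (a ^ d) (b ^ d) p) = s ^ d * t ^ d * \<delta> p" if "p \<noteq> 0" for p
      using fk[of "- {0}" \<delta> "s * t" p d] \<delta>(2) that ab0
      by (simp add: dil_power dil_eq_0_iff power_mult_distrib)
    show "\<alpha> i (dil (a ^ d) (b ^ d) p) = s ^ d * \<alpha> i p" if "i \<in> I" "p \<in> U i" for i p
      using fk[of "U i" "\<alpha> i" s p d] \<alpha>(2) U(3) that by (simp add: dil_power)
  qed (use Uk in auto)
  then obtain h where h: "\<And>i. i \<in> I \<Longrightarrow> holomorphic2_on (h i) (U i)"
      "\<And>i p. i \<in> I \<Longrightarrow> p \<in> U i \<Longrightarrow> t ^ d * h i (dil (a ^ d) (b ^ d) p) = h i p"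
      "\<And>i j p. i \<in> I \<Longrightarrow> j \<in> I \<Longrightarrow> p \<in> U i \<inter> U j \<Longrightarrow> h i p - h j p = g i j p" by blast
  \<comment> \<open>Each summand is a translate of the splitting, normalised by \<open>t ^ n\<close>
    so that it still splits \<open>g\<close>.\<close>
  define k where "k = (\<lambda>i p. (\<Sum>n<d. t ^ n * h i (dil (a ^ n) (b ^ n) p)) / of_nat d)"
  show ?thesis
  proof (intro exI[of _ k] conjI ballI)
    fix i assume i: "i \<in> I"
    show "holomorphic2_on (k i) (U i)" unfolding k_def
      by (intro holomorphic2_intros holomorphic2_on_dil[OF h(1)[OF i]]) (use Uk i d in auto)
    fix p assume p: "p \<in> U i"
    have dd: "dil (a ^ n) (b ^ n) (dil a b p) = dil (a ^ Suc n) (b ^ Suc n) p" for n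
      by (simp add: dil_def mult_ac)
    have "t * (\<Sum>n<d. t ^ n * h i (dil (a ^ n) (b ^ n) (dil a b p))) =
        (\<Sum>n<d. t ^ Suc n * h i (dil (a ^ Suc n) (b ^ Suc n) p))"
      unfolding dd by (simp add: sum_distrib_left mult.assoc)
    \<comment> \<open>The shift trades the term \<open>n = 0\<close> for the term
      \<open>n = d\<close>; these two are equal by the weight of \<open>h\<close> under the power
      \<open>d\<close> of F.\<close>
    also have "\<dots> = (\<Sum>n<d. t ^ n * h i (dil (a ^ n) (b ^ n) p)) + t ^ d * h i (dil (a ^ d) (b ^ d) p) - h i p"
      using sum.lessThan_Suc_shift[of "\<lambda>n. t ^ n * h i (dil (a ^ n) (b ^ n) p)" d]
      by (simp add: dil_def)
    finally show "t * k i (dil a b p) = k i p"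
      using h(2)[OF i p] by (simp add: k_def)
  next
    fix i j p assume i: "i \<in> I" "j \<in> I" and p: "p \<in> U i \<inter> U j"
    \<comment> \<open>The cocycle has weight \<open>1 / t\<close>, so every summand has the same
      differences \<open>g i j p\<close>, and hence so does their average.\<close>
    have "t ^ n * h i (dil (a ^ n) (b ^ n) p) - t ^ n * h j (dil (a ^ n) (b ^ n) p) = g i j p" for n
    proof -
      have "dil (a ^ n) (b ^ n) p \<in> U i \<inter> U j" using Uk i p by auto
      from h(3)[OF i this]
      have "t ^ n * h i (dil (a ^ n) (b ^ n) p) - t ^ n * h j (dil (a ^ n) (b ^ n) p) = t ^ n * g i j ((dil a b ^^ n) p)"
        by (simp add: dil_power right_diff_distrib[symmetric])
      also have "\<dots> = g i j p"
      proof (induction n)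
        case (Suc n)
        have "(dil a b ^^ n) p \<in> U i \<inter> U j" using Uk i p by (auto simp: dil_power)
        from g(2)[OF i this]
        have "t ^ Suc n * g i j ((dil a b ^^ Suc n) p) = t ^ n * g i j ((dil a b ^^ n) p)"
          by (simp add: mult.assoc mult.left_commute[of t])
        then show ?case using Suc by simp
      qed simp
      finally show ?thesis .
    qed
    then have "k i p - k j p = (\<Sum>n<d. g i j p) / of_nat d"
      by (simp add: k_def diff_divide_distrib[symmetric] sum_subtractf[symmetric])
    then show "k i p - k j p = g i j p" using d by simp
  qed
qed

section \<open>Trace-free endomorphisms of a non-split extension\<close>

definition dot2 :: "complex ^ 2 \<Rightarrow> complex ^ 2 \<Rightarrow> complex" where
  "dot2 u v = u $ 1 * v $ 1 + u $ 2 * v $ 2"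

definition det2 :: "complex ^ 2 \<Rightarrow> complex ^ 2 \<Rightarrow> complex" where
  "det2 u v = u $ 1 * v $ 2 - u $ 2 * v $ 1"

lemma vec2_eq_iff: "(u :: complex ^ 2) = v \<longleftrightarrow> u $ 1 = v $ 1 \<and> u $ 2 = v $ 2"
  by (simp add: vec_eq_iff forall_2)

lemma mult_mat2_vec2:
  "((A :: complex ^ 2 ^ 2) *v v) $ r = A $ r $ 1 * v $ 1 + A $ r $ 2 * v $ 2"
  by (simp add: matrix_vector_mult_def sum_2)

lemma dot2_linear:
  "dot2 l (u + v) = dot2 l u + dot2 l v" "dot2 l (u - v) = dot2 l u - dot2 l v"
  "dot2 l (c *s u) = c * dot2 l u"
  by (simp_all add: dot2_def algebra_simps)

lemma det2_linear:
  "det2 (u + v) w = det2 u w + det2 v w" "det2 (u - v) w = det2 u w - det2 v w"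
  "det2 (c *s u) w = c * det2 u w"
  by (simp_all add: det2_def algebra_simps)

lemma det2_self [simp]: "det2 v v = 0"
  by (simp add: det2_def)

text \<open>In the plane, \<open>(l . v) w\<close> is \<open>(l . w) v\<close> plus
  \<open>det2 w v\<close> times the vector \<open>(l 2, - l 1)\<close>, where the dot stands for
  \<open>dot2\<close>.\<close>

lemma vec2_zeroI:
  assumes "dot2 l w = 0" "dot2 l v = 1" "det2 w v = 0"
  shows "w = 0"
proof -
  have "w $ 1 = w $ 1 * dot2 l v" "w $ 2 = w $ 2 * dot2 l v" using assms by simp_all
  moreover have "w $ 1 * dot2 l v = v $ 1 * dot2 l w + l $ 2 * det2 w v"
    "w $ 2 * dot2 l v = v $ 2 * dot2 l w - l $ 1 * det2 w v"
    by (simp_all add: dot2_def det2_def algebra_simps)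
  ultimately show ?thesis using assms by (simp add: vec2_eq_iff)
qed

text \<open>Cramer's rule in the basis \<open>v, e\<close>: the functional \<open>l\<close> reads
  off the first coordinate, because it is 1 on \<open>v\<close> and 0 on \<open>e\<close>.\<close>

lemma vec2_decomp:
  assumes "dot2 l e = 0" "dot2 l v = 1" "e \<noteq> 0"
  shows "det2 e v \<noteq> 0" and "w = dot2 l w *s v + (det2 w v / det2 e v) *s e"
proof -
  show 1: "det2 e v \<noteq> 0" using vec2_zeroI[OF assms(1,2)] assms(3) by blast
  have "w - (dot2 l w *s v + (det2 w v / det2 e v) *s e) = 0"
    by (rule vec2_zeroI[OF _ assms(2)]) (use assms 1 in \<open>simp_all add: dot2_linear det2_linear\<close>)
  then show "w = dot2 l w *s v + (det2 w v / det2 e v) *s e" by simp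
qed

text \<open>The trace as the first-order change of the determinant under
  \<open>1 + \<epsilon> A\<close>. It turns trace-freeness into a relation between the two diagonal
  entries.\<close>

lemma trace_det2:
  "det2 (A *v u) v + det2 u (A *v v) = trace A * det2 u v"
  by (simp add: trace_def sum_2 det2_def mult_mat2_vec2 algebra_simps)

lemma vec2_scale_cancel:
  assumes "c *s e = d *s e" "(e :: complex ^ 2) \<noteq> 0"
  shows "c = d"
  using assms by (auto simp: vec2_eq_iff)

lemma holomorphic2_glue:
  assumes "\<And>i. i \<in> I \<Longrightarrow> open (U i)" "\<And>i. i \<in> I \<Longrightarrow> holomorphic2_on (f i) (U i)"
    and eq: "\<And>i j p. i \<in> I \<Longrightarrow> j \<in> I \<Longrightarrow> p \<in> U i \<Longrightarrow> p \<in> U j \<Longrightarrow> f i p = f j p"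
  shows "\<exists>g. holomorphic2_on g (\<Union>i\<in>I. U i) \<and> (\<forall>i\<in>I. \<forall>p\<in>U i. g p = f i p)"
proof -
  define g where "g = (\<lambda>p. f (SOME i. i \<in> I \<and> p \<in> U i) p)"
  have g: "g p = f i p" if "i \<in> I" "p \<in> U i" for i p
  proof -
    have "(SOME i. i \<in> I \<and> p \<in> U i) \<in> I \<and> p \<in> U (SOME i. i \<in> I \<and> p \<in> U i)"
      by (rule someI[of _ i]) (use that in auto)
    then show ?thesis unfolding g_def using eq that by blast
  qed
  have "holomorphic2_on g (\<Union>i\<in>I. U i)"
  proof (rule holomorphic2_on_local)
    fix p assume "p \<in> (\<Union>i\<in>I. U i)"
    then obtain i where i: "i \<in> I" "p \<in> U i" by blast
    then have "holomorphic2_on g (U i)"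
      using holomorphic2_on_cong[OF assms(2)[OF i(1)] assms(1)[OF i(1)]] g by metis
    then show "\<exists>T. p \<in> T \<and> holomorphic2_on g T" using i by blast
  qed
  then show ?thesis using g by blast
qed

text \<open>\<open>e\<close>, \<open>l\<close> and \<open>v\<close> are local frames of the inclusion, of the quotient map and of a splitting,
  \<open>A\<close> is the Higgs field.  In the basis \<open>e, v\<close> its entries below and on the diagonal are the
  \<open>\<delta>\<close> of two successive applications of \<open>cocycle_splits\<close>, hence vanish.\<close>

lemma nonsplit_trace_free_nilpotent:
  fixes U :: "'i \<Rightarrow> (complex \<times> complex) set"
    and e v l :: "'i \<Rightarrow> complex \<times> complex \<Rightarrow> complex ^ 2"
    and A :: "'i \<Rightarrow> complex \<times> complex \<Rightarrow> complex ^ 2 ^ 2"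
    and T :: "'i \<Rightarrow> 'i \<Rightarrow> complex \<times> complex \<Rightarrow> complex ^ 2 ^ 2"
  assumes ab: "0 < cmod a" "cmod a < 1" "0 < cmod b" "cmod b < 1"
    and t: "1 \<le> cmod t"
    and U: "\<And>i. i \<in> I \<Longrightarrow> open (U i)" "(\<Union>i\<in>I. U i) = - {0}"
      "\<And>i p. i \<in> I \<Longrightarrow> dil a b p \<in> U i \<longleftrightarrow> p \<in> U i"
    and hol: "\<And>i r. i \<in> I \<Longrightarrow> holomorphic2_on (\<lambda>p. e i p $ r) (U i)"
      "\<And>i r. i \<in> I \<Longrightarrow> holomorphic2_on (\<lambda>p. v i p $ r) (U i)"
      "\<And>i r. i \<in> I \<Longrightarrow> holomorphic2_on (\<lambda>p. l i p $ r) (U i)"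
      "\<And>i r c. i \<in> I \<Longrightarrow> holomorphic2_on (\<lambda>p. A i p $ r $ c) (U i)"
      "\<And>i j r c. i \<in> I \<Longrightarrow> j \<in> I \<Longrightarrow> holomorphic2_on (\<lambda>p. T i j p $ r $ c) (U i \<inter> U j)"
    and wt: "\<And>i p. i \<in> I \<Longrightarrow> p \<in> U i \<Longrightarrow> e i (dil a b p) = e i p"
      "\<And>i p. i \<in> I \<Longrightarrow> p \<in> U i \<Longrightarrow> t *s v i (dil a b p) = v i p"
      "\<And>i p. i \<in> I \<Longrightarrow> p \<in> U i \<Longrightarrow> l i (dil a b p) = t *s l i p"
      "\<And>i p w. i \<in> I \<Longrightarrow> p \<in> U i \<Longrightarrow> A i (dil a b p) *v w = \<tau> *s (A i p *v w)"
      "\<And>i j p. i \<in> I \<Longrightarrow> j \<in> I \<Longrightarrow> p \<in> U i \<inter> U j \<Longrightarrow> T i j (dil a b p) = T i j p"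
    and loc: "\<And>i p. i \<in> I \<Longrightarrow> p \<in> U i \<Longrightarrow> dot2 (l i p) (e i p) = 0"
      "\<And>i p. i \<in> I \<Longrightarrow> p \<in> U i \<Longrightarrow> dot2 (l i p) (v i p) = 1"
      "\<And>i p. i \<in> I \<Longrightarrow> p \<in> U i \<Longrightarrow> e i p \<noteq> 0"
      "\<And>i p. i \<in> I \<Longrightarrow> p \<in> U i \<Longrightarrow> trace (A i p) = 0"
    and tr: "\<And>i j p w. i \<in> I \<Longrightarrow> j \<in> I \<Longrightarrow> p \<in> U i \<inter> U j \<Longrightarrow> dot2 (l i p) (T i j p *v w) = dot2 (l j p) w"
      "\<And>i j p. i \<in> I \<Longrightarrow> j \<in> I \<Longrightarrow> p \<in> U i \<inter> U j \<Longrightarrow> T i j p *v e j p = e i p"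
      "\<And>i j p w. i \<in> I \<Longrightarrow> j \<in> I \<Longrightarrow> p \<in> U i \<inter> U j \<Longrightarrow> A i p *v (T i j p *v w) = T i j p *v (A j p *v w)"
    and ns: "\<not> (\<exists>h. (\<forall>i\<in>I. holomorphic2_on (h i) (U i) \<and> (\<forall>p\<in>U i. t * h i (dil a b p) = h i p)) \<and>
      (\<forall>i\<in>I. \<forall>j\<in>I. \<forall>p\<in>U i \<inter> U j. v i p - T i j p *v v j p = (h i p - h j p) *s e i p))"
  shows "\<exists>\<beta>. holomorphic2_on \<beta> (- {0}) \<and> (\<forall>p. p \<noteq> 0 \<longrightarrow> t * \<beta> (dil a b p) = \<tau> * \<beta> p) \<and>
    (\<forall>i\<in>I. \<forall>p\<in>U i. \<forall>w. A i p *v w = (\<beta> p * dot2 (l i p) w) *s e i p)"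
proof -
  have t0: "t \<noteq> 0" using t by auto
  have ab0: "a \<noteq> 0" "b \<noteq> 0" using ab by auto
  have U0: "p \<noteq> 0" if "i \<in> I" "p \<in> U i" for i p using U(2) that by blast
  have Ui: "\<exists>i\<in>I. p \<in> U i" if "p \<noteq> 0" for p using U(2) that by blast
  note comp = dot2_def det2_def mult_mat2_vec2 vector_minus_component
  define D where "D = (\<lambda>i p. det2 (e i p) (v i p))"
  have D0: "D i p \<noteq> 0" if "i \<in> I" "p \<in> U i" for i p
    unfolding D_def by (rule vec2_decomp(1)[OF loc(1-3)[OF that]])
  have dec: "w = dot2 (l i p) w *s v i p + (det2 w (v i p) / D i p) *s e i p" if "i \<in> I" "p \<in> U i" for i p w
    unfolding D_def by (rule vec2_decomp(2)[OF loc(1-3)[OF that]])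
  \<comment> \<open>The extension cocycle: two local splittings differ by a multiple of
    \<open>e\<close>, and Cramer's rule yields the coefficient.\<close>
  define g where "g = (\<lambda>i j p. det2 (v i p - T i j p *v v j p) (v i p) / D i p)"
  have g: "v i p - T i j p *v v j p = g i j p *s e i p" if "i \<in> I" "j \<in> I" "p \<in> U i \<inter> U j" for i j p
  proof -
    have "dot2 (l i p) (v i p - T i j p *v v j p) = 0"
      using tr(1)[OF that] loc(2) that by (simp add: dot2_linear)
    then show ?thesis using dec[of i p "v i p - T i j p *v v j p"] that by (simp add: g_def)
  qed
  have ns': "\<not> (\<exists>h. (\<forall>i\<in>I. holomorphic2_on (h i) (U i) \<and> (\<forall>p\<in>U i. t * h i (dil a b p) = h i p)) \<and>
      (\<forall>i\<in>I. \<forall>j\<in>I. \<forall>p\<in>U i \<inter> U j. h i p - h j p = g i j p))"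
  proof
    assume "\<exists>h. (\<forall>i\<in>I. holomorphic2_on (h i) (U i) \<and> (\<forall>p\<in>U i. t * h i (dil a b p) = h i p)) \<and>
      (\<forall>i\<in>I. \<forall>j\<in>I. \<forall>p\<in>U i \<inter> U j. h i p - h j p = g i j p)"
    then obtain h where h: "\<forall>i\<in>I. holomorphic2_on (h i) (U i) \<and> (\<forall>p\<in>U i. t * h i (dil a b p) = h i p)"
      "\<forall>i\<in>I. \<forall>j\<in>I. \<forall>p\<in>U i \<inter> U j. h i p - h j p = g i j p" by blast
    have "\<forall>i\<in>I. \<forall>j\<in>I. \<forall>p\<in>U i \<inter> U j. v i p - T i j p *v v j p = (h i p - h j p) *s e i p"
      using g h(2) by simp
    with h(1) ns show False by blast
  qed
  have sub: "holomorphic2_on f (U i \<inter> U j)" if "holomorphic2_on f (U i) \<or> holomorphic2_on f (U j)" for f i j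
    using that holomorphic2_on_subset by (metis Int_lower1 Int_lower2)
  have hD: "holomorphic2_on (D i) (U i)" if "i \<in> I" for i
    unfolding D_def comp by (intro holomorphic2_intros hol that)
  have hg: "continuous_on (U i \<inter> U j) (g i j)" if ij: "i \<in> I" "j \<in> I" for i j
  proof (rule holomorphic2_on_continuous)
    have "holomorphic2_on (\<lambda>p. v i p $ r) (U i \<inter> U j)" "holomorphic2_on (\<lambda>p. v j p $ r) (U i \<inter> U j)"
      "holomorphic2_on (D i) (U i \<inter> U j)" for r
      using sub hol(2) hD ij by blast+
    then show "holomorphic2_on (g i j) (U i \<inter> U j)"
      unfolding g_def comp by (intro holomorphic2_intros hol(5) ij) (use D0 ij in auto)
  qed
  have wv: "v i (dil a b p) = (1 / t) *s v i p" if "i \<in> I" "p \<in> U i" for i p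
    unfolding wt(2)[OF that, symmetric] using t0 by (simp add: vec_eq_iff)
  have wD: "D i (dil a b p) = D i p / t" if "i \<in> I" "p \<in> U i" for i p
    using t0 by (simp add: D_def wv[OF that] wt(1)[OF that] det2_def field_simps)
  have gw: "t * g i j (dil a b p) = g i j p" if "i \<in> I" "j \<in> I" "p \<in> U i \<inter> U j" for i j p
  proof -
    have p: "p \<in> U i" "p \<in> U j" using that by auto
    have "g i j (dil a b p) *s e i p = (1 / t) *s (g i j p *s e i p)"
      using g[OF that(1,2), of "dil a b p"] U(3) that p
      by (simp add: wt(1) wt(5)[OF that] wv g[OF that, symmetric] matrix_vector_mult_scaleR vec2_eq_iff mult_mat2_vec2 algebra_simps)
    then have "g i j (dil a b p) *s e i p = (g i j p / t) *s e i p"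
      by (simp add: vec2_eq_iff)
    then have "g i j (dil a b p) = g i j p / t"
      using vec2_scale_cancel loc(3)[OF that(1) p(1)] by blast
    then show ?thesis using t0 by simp
  qed
  \<comment> \<open>Three entries of the Higgs field in the basis \<open>e, v\<close>:
    \<open>d\<close> is the v-coordinate of \<open>A e\<close>, while \<alpha> and \<beta> are the
    v- and the e-coordinate of \<open>A v\<close>.\<close>
  define d where "d = (\<lambda>i p. dot2 (l i p) (A i p *v e i p))"
  define \<alpha> where "\<alpha> = (\<lambda>i p. dot2 (l i p) (A i p *v v i p))"
  define \<beta> where "\<beta> = (\<lambda>i p. det2 (A i p *v v i p) (v i p) / D i p)"
  have hd: "holomorphic2_on (d i) (U i)" and h\<alpha>: "holomorphic2_on (\<alpha> i) (U i)"
    and h\<beta>: "holomorphic2_on (\<beta> i) (U i)" if "i \<in> I" for i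
    unfolding d_def \<alpha>_def \<beta>_def comp
    by (intro holomorphic2_intros hol hD that; use D0 that in auto)+
  have wd: "d i (dil a b p) = \<tau> * t * d i p" if "i \<in> I" "p \<in> U i" for i p
    by (simp add: d_def wt(1,3,4)[OF that] dot2_def algebra_simps)
  have sA: "A i p *v (c *s w) = c *s (A i p *v w)" "T i j p *v (c *s w) = c *s (T i j p *v w)" for i j p c w
    by (simp_all add: vec2_eq_iff mult_mat2_vec2 algebra_simps)
  have aA: "A i p *v (w + w') = A i p *v w + A i p *v w'" "T i j p *v (w + w') = T i j p *v w + T i j p *v w'" for i j p w w'
    by (simp_all add: matrix_vector_right_distrib)
  have w\<alpha>: "\<alpha> i (dil a b p) = \<tau> * \<alpha> i p" if "i \<in> I" "p \<in> U i" for i p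
    using t0 by (simp add: \<alpha>_def wt(3,4)[OF that] wv[OF that] sA dot2_def algebra_simps)
  have w\<beta>: "\<beta> i (dil a b p) = \<tau> / t * \<beta> i p" if "i \<in> I" "p \<in> U i" for i p
    using t0 D0[OF that] by (simp add: \<beta>_def wD[OF that] wt(4)[OF that] wv[OF that] sA det2_def field_simps)
  have dd: "d i p = d j p" if "i \<in> I" "j \<in> I" "p \<in> U i" "p \<in> U j" for i j p
    using tr(1)[of i j p "A j p *v e j p"] tr(2)[of i j p] tr(3)[of i j p "e j p"] that
    by (simp add: d_def)
  have v: "v i p = T i j p *v v j p + g i j p *s e i p" if "i \<in> I" "j \<in> I" "p \<in> U i \<inter> U j" for i j p
    using g[OF that] by (metis add.commute diff_add_cancel)
  have \<alpha>\<alpha>: "\<alpha> i p - \<alpha> j p = d i p * g i j p" if "i \<in> I" "j \<in> I" "p \<in> U i \<inter> U j" for i j p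
  proof -
    have "A i p *v v i p = T i j p *v (A j p *v v j p) + g i j p *s (A i p *v e i p)"
      using v[OF that] by (simp only: aA sA tr(3)[OF that])
    then show ?thesis by (simp add: \<alpha>_def d_def dot2_linear tr(1)[OF that])
  qed
  obtain \<delta> where \<delta>: "holomorphic2_on \<delta> (- {0})" "\<And>i p. i \<in> I \<Longrightarrow> p \<in> U i \<Longrightarrow> \<delta> p = d i p"
    using holomorphic2_glue[of I U d, OF U(1) hd dd] unfolding U(2) by blast
  have "\<delta> p = 0" if p: "p \<noteq> 0" for p
  proof (rule ccontr)
    assume nz: "\<delta> p \<noteq> 0"
    have "\<delta> (dil a b q) = \<tau> * t * \<delta> q" if q: "q \<noteq> 0" for q
    proof -
      obtain i where "i \<in> I" "q \<in> U i" using Ui[OF q] by blast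
      then show ?thesis using \<delta>(2) wd U(3) by simp
    qed
    moreover have "\<alpha> i q - \<alpha> j q = \<delta> q * g i j q" if "i \<in> I" "j \<in> I" "q \<in> U i \<inter> U j" for i j q
      using \<alpha>\<alpha>[OF that] \<delta>(2) that by simp
    ultimately show False
      using cocycle_splits[OF ab t U hg gw \<delta>(1) _ p nz h\<alpha> w\<alpha>] ns' by blast
  qed
  then have d0: "d i p = 0" if "i \<in> I" "p \<in> U i" for i p
    using \<delta>(2)[OF that] U0[OF that] by simp
  have \<alpha>j: "\<alpha> i p = \<alpha> j p" if "i \<in> I" "j \<in> I" "p \<in> U i" "p \<in> U j" for i j p
    using \<alpha>\<alpha>[of i j p] d0 that by simp
  have Av: "A i p *v v i p = \<alpha> i p *s v i p + \<beta> i p *s e i p" if "i \<in> I" "p \<in> U i" for i p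
    using dec[OF that, of "A i p *v v i p"] by (simp add: \<alpha>_def \<beta>_def)
  \<comment> \<open>With \<open>d = 0\<close> the vector \<open>e\<close> is an eigenvector. On the
    quotient the eigenvalue is \<alpha>, so trace 0 leaves - \<alpha> for \<open>e\<close>.\<close>
  have Ae: "A i p *v e i p = (- \<alpha> i p) *s e i p" if "i \<in> I" "p \<in> U i" for i p
  proof -
    have "det2 (e i p) (A i p *v v i p) = \<alpha> i p * D i p"
      by (simp add: Av[OF that] det2_def D_def algebra_simps)
    then have "det2 (A i p *v e i p) (v i p) = - \<alpha> i p * D i p"
      using trace_det2[of "A i p" "e i p" "v i p"] loc(4)[OF that] by (simp add: eq_neg_iff_add_eq_0)
    moreover have "dot2 (l i p) (A i p *v e i p) = 0" using d0[OF that] by (simp add: d_def)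
    ultimately show ?thesis using dec[OF that, of "A i p *v e i p"] D0[OF that] by simp
  qed
  \<comment> \<open>Changing the splitting by \<open>g\<close> times \<open>e\<close> changes
    \<beta> by the difference of the eigenvalues on \<open>e\<close> and on the quotient, - \<alpha>
    minus \<alpha>, times \<open>g\<close>.\<close>
  have \<beta>\<beta>: "\<beta> i p - \<beta> j p = (- 2 * \<alpha> i p) * g i j p" if "i \<in> I" "j \<in> I" "p \<in> U i \<inter> U j" for i j p
  proof -
    have p: "p \<in> U i" "p \<in> U j" using that by auto
    have "A i p *v v i p = T i j p *v (A j p *v v j p) + g i j p *s (A i p *v e i p)"
      using v[OF that] by (simp only: aA sA tr(3)[OF that])
    also have "\<dots> = \<alpha> i p *s (T i j p *v v j p) + \<beta> j p *s e i p + g i j p *s ((- \<alpha> i p) *s e i p)"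
      unfolding Av[OF that(2) p(2)] aA sA tr(2)[OF that] Ae[OF that(1) p(1)] \<alpha>j[OF that(1,2) p] ..
    also have "T i j p *v v j p = v i p - g i j p *s e i p" using v[OF that] by simp
    finally have "\<alpha> i p *s v i p + \<beta> i p *s e i p =
        \<alpha> i p *s v i p + (\<beta> j p - 2 * \<alpha> i p * g i j p) *s e i p"
      unfolding Av[OF that(1) p(1)] by (simp add: vec2_eq_iff algebra_simps)
    then have "\<beta> i p *s e i p = (\<beta> j p - 2 * \<alpha> i p * g i j p) *s e i p" by simp
    then have "\<beta> i p = \<beta> j p - 2 * \<alpha> i p * g i j p"
      using vec2_scale_cancel loc(3)[OF that(1) p(1)] by blast
    then show ?thesis by simp
  qed
  obtain \<gamma> where \<gamma>: "holomorphic2_on \<gamma> (- {0})" "\<And>i p. i \<in> I \<Longrightarrow> p \<in> U i \<Longrightarrow> \<gamma> p = \<alpha> i p"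
    using holomorphic2_glue[of I U \<alpha>, OF U(1) h\<alpha> \<alpha>j] unfolding U(2) by blast
  have "\<gamma> p = 0" if p: "p \<noteq> 0" for p
  proof (rule ccontr)
    assume "\<gamma> p \<noteq> 0"
    then have nz: "- 2 * \<gamma> p \<noteq> 0" by simp
    \<comment> \<open>In this round \<beta> plays the role of the \<alpha> i with weight
      \<open>\<tau> / t\<close>, so \<open>s * t\<close> is \<tau>, the weight of the diagonal
      entry.\<close>
    have "- 2 * \<gamma> (dil a b q) = \<tau> / t * t * (- 2 * \<gamma> q)" if q: "q \<noteq> 0" for q
    proof -
      obtain i where "i \<in> I" "q \<in> U i" using Ui[OF q] by blast
      then show ?thesis using \<gamma>(2) w\<alpha> U(3) t0 by simp
    qed
    moreover have "\<beta> i q - \<beta> j q = (- 2 * \<gamma> q) * g i j q" if "i \<in> I" "j \<in> I" "q \<in> U i \<inter> U j" for i j q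
      using \<beta>\<beta>[OF that] \<gamma>(2) that by simp
    moreover have "holomorphic2_on (\<lambda>p. - 2 * \<gamma> p) (- {0})" by (intro holomorphic2_intros \<gamma>)
    ultimately show False
      using cocycle_splits[where \<delta> = "\<lambda>p. - 2 * \<gamma> p" and \<alpha> = \<beta> and s = "\<tau> / t", OF ab t U hg gw _ _ p nz h\<beta> w\<beta>] ns' by blast
  qed
  then have \<alpha>0: "\<alpha> i p = 0" if "i \<in> I" "p \<in> U i" for i p
    using \<gamma>(2)[OF that] U0[OF that] by simp
  have \<beta>j: "\<beta> i p = \<beta> j p" if "i \<in> I" "j \<in> I" "p \<in> U i" "p \<in> U j" for i j p
    using \<beta>\<beta>[of i j p] \<alpha>0 that by simp
  obtain B where B: "holomorphic2_on B (- {0})" "\<And>i p. i \<in> I \<Longrightarrow> p \<in> U i \<Longrightarrow> B p = \<beta> i p"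
    using holomorphic2_glue[of I U \<beta>, OF U(1) h\<beta> \<beta>j] unfolding U(2) by blast
  show ?thesis
  proof (intro exI[of _ B] conjI allI impI ballI B(1))
    fix p :: "complex \<times> complex" assume p: "p \<noteq> 0"
    obtain i where "i \<in> I" "p \<in> U i" using Ui[OF p] by blast
    then show "t * B (dil a b p) = \<tau> * B p" using B(2) w\<beta> U(3) t0 by simp
  next
    fix i p w assume i: "i \<in> I" "p \<in> U i"
    have "A i p *v w = dot2 (l i p) w *s (A i p *v v i p) + (det2 w (v i p) / D i p) *s (A i p *v e i p)"
      by (subst dec[OF i, of w]) (simp only: aA sA)
    then show "A i p *v w = (B p * dot2 (l i p) w) *s e i p"
      by (simp add: Av[OF i] Ae[OF i] \<alpha>0[OF i] B(2)[OF i] vec2_eq_iff)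
  qed
qed

section \<open>Line bundles on the Hopf surface\<close>

lemma hopf_act_0 [simp]: "hopf_act a b 0 p = p"
  by (simp add: hopf_act_def)

lemma hopf_act_add:
  "a \<noteq> 0 \<Longrightarrow> b \<noteq> 0 \<Longrightarrow> hopf_act a b (m + n) p = hopf_act a b m (hopf_act a b n p)"
  by (simp add: hopf_act_def power_int_add mult.assoc)

lemma hopf_act_1: "hopf_act a b 1 p = dil a b p"
  by (simp add: hopf_act_def dil_def)

lemma hopf_act_nat: "hopf_act a b (int n) p = (dil a b ^^ n) p"
  by (simp add: hopf_act_def dil_power dil_def)

lemma hopf_proj_self: "p \<in> hopf_proj a b p"
  unfolding hopf_proj_def by (rule range_eqI[of _ _ 0]) simp

lemma hopf_proj_eqI:
  assumes "a \<noteq> 0" "b \<noteq> 0" "q \<in> hopf_proj a b p"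
  shows "hopf_proj a b q = hopf_proj a b p"
proof -
  obtain n where q: "q = hopf_act a b n p" using assms(3) by (auto simp: hopf_proj_def)
  have "hopf_act a b m q = hopf_act a b (m + n) p" for m
    by (simp add: q hopf_act_add assms)
  moreover have "hopf_act a b m p = hopf_act a b (m - n) q" for m
    by (simp add: q hopf_act_add[OF assms(1,2), symmetric])
  ultimately show ?thesis unfolding hopf_proj_def by blast
qed

lemma hopf_proj_dil [simp]:
  "a \<noteq> 0 \<Longrightarrow> b \<noteq> 0 \<Longrightarrow> hopf_proj a b (dil a b p) = hopf_proj a b p"
  by (rule hopf_proj_eqI) (auto simp: hopf_proj_def hopf_act_1[symmetric])

lemma dil_mem_hopf_preimage:
  "a \<noteq> 0 \<Longrightarrow> b \<noteq> 0 \<Longrightarrow> dil a b p \<in> hopf_preimage a b V \<longleftrightarrow> p \<in> hopf_preimage a b V"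
  by (simp add: hopf_preimage_def dil_eq_0_iff)

text \<open>Negative exponents reduce to positive ones: \<open>p\<close> is a forward iterate of its
  image, and that image lies in \<open>S\<close> because membership in \<open>S\<close> is invariant
  in both directions.\<close>

lemma hopf_act_invariant:
  assumes ab: "a \<noteq> 0" "b \<noteq> 0" and S: "\<And>p. dil a b p \<in> S \<longleftrightarrow> p \<in> S"
    and f: "\<And>p. p \<in> S \<Longrightarrow> f (dil a b p) = f p" and p: "p \<in> S"
  shows "f (hopf_act a b n p) = f p"
proof -
  have iter: "(dil a b ^^ k) q \<in> S \<longleftrightarrow> q \<in> S" for k q
    using S by (induction k) simp_all
  have pos: "f ((dil a b ^^ k) q) = f q" if "q \<in> S" for k q
    using that by (induction k) (simp_all add: f iter)
  show ?thesis
  proof (cases "0 \<le> n")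
    case True
    then show ?thesis using pos[OF p, of "nat n"] by (simp add: hopf_act_nat[symmetric])
  next
    case False
    define q where "q = hopf_act a b n p"
    have "(dil a b ^^ nat (- n)) q = p"
      using False by (simp add: q_def hopf_act_nat[symmetric] hopf_act_add[OF ab, symmetric])
    then show ?thesis using pos[of q "nat (- n)"] iter[of "nat (- n)" q] p by (simp add: q_def)
  qed
qed

text \<open>Evaluates at an arbitrary representative of the orbit; the value is independent of the
  choice when \<open>f\<close> is invariant on an invariant set containing the orbit.\<close>

definition hopf_descend :: "(complex \<times> complex \<Rightarrow> 'c) \<Rightarrow> hopf_point \<Rightarrow> 'c" where
  "hopf_descend f x = f (SOME p. p \<in> x)"

lemma hopf_descend:
  assumes ab: "a \<noteq> 0" "b \<noteq> 0" and S: "\<And>p. dil a b p \<in> S \<longleftrightarrow> p \<in> S"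
    and f: "\<And>p. p \<in> S \<Longrightarrow> f (dil a b p) = f p" and p: "p \<in> S"
  shows "hopf_descend f (hopf_proj a b p) = f p"
proof -
  have "(SOME q. q \<in> hopf_proj a b p) \<in> hopf_proj a b p"
    by (rule someI[of _ p]) (rule hopf_proj_self)
  then obtain n where "(SOME q. q \<in> hopf_proj a b p) = hopf_act a b n p" by (auto simp: hopf_proj_def)
  then show ?thesis by (simp add: hopf_descend_def hopf_act_invariant[where f = f, OF ab S f p])
qed

section \<open>Open sets and holomorphic functions on the quotient\<close>

lemma hopf_preimage_Int: "hopf_preimage a b (V \<inter> V') = hopf_preimage a b V \<inter> hopf_preimage a b V'"
  by (auto simp: hopf_preimage_def)

lemma hopf_preimage_surface: "hopf_preimage a b (hopf_surface a b) = - {0}"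
  by (auto simp: hopf_preimage_def hopf_surface_def)

lemma hopf_surfaceE:
  assumes "x \<in> hopf_surface a b"
  obtains p where "p \<noteq> 0" "x = hopf_proj a b p"
  using assms by (auto simp: hopf_surface_def)

lemma hopf_open_preimage: "hopf_open a b V \<Longrightarrow> open (hopf_preimage a b V)"
  by (simp add: hopf_open_def)

lemma hopf_open_subset: "hopf_open a b V \<Longrightarrow> V \<subseteq> hopf_surface a b"
  by (simp add: hopf_open_def)

lemma hopf_open_Int: "hopf_open a b V \<Longrightarrow> hopf_open a b V' \<Longrightarrow> hopf_open a b (V \<inter> V')"
  by (auto simp: hopf_open_def hopf_preimage_Int)

lemma hopf_holo_subset: "hopf_holo a b V f \<Longrightarrow> V' \<subseteq> V \<Longrightarrow> hopf_holo a b V' f"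
  unfolding hopf_holo_def by (erule holomorphic2_on_subset) (auto simp: hopf_preimage_def)

lemma hopf_holo_cong:
  assumes "hopf_holo a b V f" "hopf_open a b V" "\<And>x. x \<in> V \<Longrightarrow> f x = g x"
  shows "hopf_holo a b V g"
  unfolding hopf_holo_def
  by (rule holomorphic2_on_cong[OF assms(1)[unfolded hopf_holo_def] hopf_open_preimage[OF assms(2)]])
     (simp add: hopf_preimage_def assms(3))

lemma hopf_holo_divide:
  assumes "hopf_holo a b V f" "hopf_holo a b V g" "\<And>x. x \<in> V \<Longrightarrow> g x \<noteq> 0"
  shows "hopf_holo a b V (\<lambda>x. f x / g x)"
  using assms unfolding hopf_holo_def by (intro holomorphic2_on_divide) (auto simp: hopf_preimage_def)

lemma hopf_open_nonzero:
  assumes V: "hopf_open a b V" and f: "hopf_holo a b V f"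
  shows "hopf_open a b {x \<in> V. f x \<noteq> 0}"
proof -
  have "hopf_preimage a b {x \<in> V. f x \<noteq> 0} =
      hopf_preimage a b V \<inter> (\<lambda>p. f (hopf_proj a b p)) -` (- {0})"
    by (auto simp: hopf_preimage_def)
  moreover have "open (hopf_preimage a b V \<inter> (\<lambda>p. f (hopf_proj a b p)) -` (- {0}))"
    by (rule continuous_open_preimage)
       (use f hopf_open_preimage[OF V] in \<open>auto simp: hopf_holo_def intro: holomorphic2_on_continuous\<close>)
  ultimately show ?thesis using hopf_open_subset[OF V] by (auto simp: hopf_open_def)
qed

text \<open>With a coordinate \<phi> that does not vanish at \<open>p\<close>, take the points whose
  \<phi> lies in an open annulus around \<open>cmod (\<phi> p)\<close> with ratio of radii
  \<open>1 / cmod \<mu>\<close>. A nontrivial power of F changes \<open>cmod \<phi>\<close> by at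
  least that ratio and so leaves the annulus.\<close>

lemma wandering_neighbourhood:
  fixes \<phi> :: "complex \<times> complex \<Rightarrow> complex" and \<mu> :: complex
  assumes l: "0 < cmod \<mu>" "cmod \<mu> < 1" and ab: "a \<noteq> 0" "b \<noteq> 0"
    and c: "continuous_on UNIV \<phi>" and \<phi>: "\<And>p. \<phi> (dil a b p) = \<mu> * \<phi> p" "\<phi> 0 = 0" and p: "\<phi> p \<noteq> 0"
  shows "\<exists>V. open V \<and> p \<in> V \<and> 0 \<notin> V \<and> (\<forall>n. n \<noteq> 0 \<longrightarrow> hopf_act a b n ` V \<inter> V = {})"
proof -
  define s where "s = sqrt (cmod \<mu>)"
  have s: "0 < s" "s < 1" "s * s = cmod \<mu>" using l by (auto simp: s_def)
  define V where "V = {q. cmod (\<phi> p) * s < cmod (\<phi> q) \<and> cmod (\<phi> q) * s < cmod (\<phi> p)}"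
  have V: "open V" "p \<in> V" "0 \<notin> V"
  proof -
    show "open V" unfolding V_def by (intro open_Collect_conj open_Collect_less continuous_intros c)
    show "p \<in> V" using p s by (simp add: V_def)
    show "0 \<notin> V" using p s \<phi>(2) by (simp add: V_def not_less)
  qed
  have iter: "(dil a b ^^ Suc k) q \<notin> V" if q: "q \<in> V" for q k
  proof
    assume qk: "(dil a b ^^ Suc k) q \<in> V"
    have it: "\<phi> ((dil a b ^^ k) q) = \<mu> ^ k * \<phi> q" for k
      by (induction k) (simp_all add: \<phi>)
    have "cmod (\<phi> ((dil a b ^^ Suc k) q)) = cmod \<mu> ^ Suc k * cmod (\<phi> q)"
      unfolding it by (simp only: norm_mult norm_power)
    also have "\<dots> \<le> cmod \<mu> * cmod (\<phi> q)"
      using l power_decreasing[of 1 "Suc k" "cmod \<mu>"] by (intro mult_right_mono) auto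
    also have "\<dots> = s * (cmod (\<phi> q) * s)" by (simp add: s(3)[symmetric] mult_ac)
    also have "\<dots> < s * cmod (\<phi> p)" using q s by (simp add: V_def)
    also have "\<dots> < cmod (\<phi> ((dil a b ^^ Suc k) q))" using qk by (simp add: V_def mult.commute)
    finally have "cmod (\<phi> ((dil a b ^^ Suc k) q)) < cmod (\<phi> ((dil a b ^^ Suc k) q))" .
    then show False by (rule less_irrefl[THEN notE])
  qed
  have pos: "hopf_act a b m q \<notin> V" if q: "q \<in> V" "0 < m" for q m
  proof -
    define k where "k = nat (m - 1)"
    have "m = int (Suc k)" using q(2) by (simp add: k_def)
    then have "hopf_act a b m q = (dil a b ^^ Suc k) q" by (simp only: hopf_act_nat)
    then show ?thesis using iter[OF q(1), of k] by simp
  qed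
  have "hopf_act a b n ` V \<inter> V = {}" if n: "n \<noteq> 0" for n
  proof (rule ccontr)
    assume "\<not> ?thesis"
    then obtain q where q: "q \<in> V" "hopf_act a b n q \<in> V" by blast
    show False
    proof (cases "0 < n")
      case True
      then show False using pos q by blast
    next
      case False
      have "hopf_act a b (- n) (hopf_act a b n q) = q" by (simp add: hopf_act_add[OF ab, symmetric])
      then show False using pos[OF q(2), of "- n"] q n False by simp
    qed
  qed
  then show ?thesis using V by blast
qed

section \<open>The charts of \<open>Lt\<close>\<close>

lemma Lt_idx_iff:
  "V \<in> idx (Lt a b t) \<longleftrightarrow> open V \<and> 0 \<notin> V \<and> (\<forall>n. n \<noteq> 0 \<longrightarrow> hopf_act a b n ` V \<inter> V = {})"
  by (simp add: Lt_def)

lemma Lt_idx_exists: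
  assumes ab: "0 < cmod a" "cmod a < 1" "0 < cmod b" "cmod b < 1" and p: "p \<noteq> 0"
  shows "\<exists>V\<in>idx (Lt a b t). p \<in> V"
proof -
  have ab0: "a \<noteq> 0" "b \<noteq> 0" using ab by auto
  consider "fst p \<noteq> 0" | "snd p \<noteq> 0" using p by (cases p) (auto simp: zero_prod_def)
  then show ?thesis
  proof cases
    case 1
    have "\<exists>V. open V \<and> p \<in> V \<and> 0 \<notin> V \<and> (\<forall>n. n \<noteq> 0 \<longrightarrow> hopf_act a b n ` V \<inter> V = {})"
      by (rule wandering_neighbourhood[of a a b fst p, OF ab(1,2) ab0 _ _ _ 1])
         (simp_all add: dil_def continuous_on_fst)
    then show ?thesis unfolding Lt_idx_iff Bex_def by blast
  next
    case 2
    have "\<exists>V. open V \<and> p \<in> V \<and> 0 \<notin> V \<and> (\<forall>n. n \<noteq> 0 \<longrightarrow> hopf_act a b n ` V \<inter> V = {})"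
      by (rule wandering_neighbourhood[of b a b snd p, OF ab(3,4) ab0 _ _ _ 2])
         (simp_all add: dil_def continuous_on_snd)
    then show ?thesis unfolding Lt_idx_iff Bex_def by blast
  qed
qed

lemma Lt_idx_act_mem:
  assumes "V \<in> idx (Lt a b t)" "p \<in> V" "hopf_act a b n p \<in> V"
  shows "n = 0"
  using assms unfolding Lt_idx_iff by blast

text \<open>The definite description in \<open>Lt\<close> is legitimate: an orbit meets each
  wandering set at most once, which fixes the representative in \<open>V'\<close> and then the
  exponent that carries it into \<open>V\<close>.\<close>

lemma Lt_trans:
  assumes ab: "a \<noteq> 0" "b \<noteq> 0" and V: "V \<in> idx (Lt a b t)" "V' \<in> idx (Lt a b t)"
    and p: "p \<in> V'" "hopf_act a b k p \<in> V"
  shows "trans (Lt a b t) V V' (hopf_proj a b p) = mat (t powi k)"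
proof -
  have "(THE n. \<exists>q\<in>V'. q \<in> hopf_proj a b p \<and> hopf_act a b n q \<in> V) = k"
  proof (rule the_equality)
    show "\<exists>q\<in>V'. q \<in> hopf_proj a b p \<and> hopf_act a b k q \<in> V"
      using p hopf_proj_self by blast
    fix n assume "\<exists>q\<in>V'. q \<in> hopf_proj a b p \<and> hopf_act a b n q \<in> V"
    then obtain q where q: "q \<in> V'" "q \<in> hopf_proj a b p" "hopf_act a b n q \<in> V" by blast
    then obtain m where m: "q = hopf_act a b m p" by (auto simp: hopf_proj_def)
    then have "m = 0" using Lt_idx_act_mem[OF V(2) p(1)] q(1) by simp
    then have "hopf_act a b (n - k) (hopf_act a b k p) \<in> V"
      using q(3) m by (simp add: hopf_act_add[OF ab, symmetric])
    from Lt_idx_act_mem[OF V(1) p(2) this] show "n = k" by simp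
  qed
  then show ?thesis by (simp add: Lt_def)
qed

lemma Lt_idx_dil:
  assumes ab: "a \<noteq> 0" "b \<noteq> 0" and V: "V \<in> idx (Lt a b t)"
  shows "dil a b ` V \<in> idx (Lt a b t)"
proof -
  have inv: "dil (1 / a) (1 / b) (dil a b p) = p" "dil a b (dil (1 / a) (1 / b) p) = p" for p
    using ab by (simp_all add: dil_def)
  have "dil a b ` V = dil (1 / a) (1 / b) -` V"
  proof (intro set_eqI iffI)
    fix q assume "q \<in> dil (1 / a) (1 / b) -` V"
    then show "q \<in> dil a b ` V" by (intro image_eqI[of _ _ "dil (1 / a) (1 / b) q"]) (simp_all add: inv)
  qed (auto simp: inv)
  moreover have "open (dil (1 / a) (1 / b) -` V)"
    using V by (intro open_vimage) (auto simp: Lt_idx_iff intro!: continuous_intros)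
  ultimately have "open (dil a b ` V)" by simp
  moreover have "0 \<notin> dil a b ` V" using V dil_eq_0_iff[OF ab] by (auto simp: Lt_idx_iff)
  moreover have "hopf_act a b n ` (dil a b ` V) \<inter> dil a b ` V = {}" if "n \<noteq> 0" for n
  proof -
    have "hopf_act a b n ` (dil a b ` V) = dil a b ` (hopf_act a b n ` V)"
      by (simp add: image_image dil_def hopf_act_def mult_ac)
    then have "hopf_act a b n ` (dil a b ` V) \<inter> dil a b ` V = dil a b ` (hopf_act a b n ` V \<inter> V)"
      using image_Int[of "dil a b"] inv(1) by (metis injI)
    then show ?thesis using V that by (simp add: Lt_idx_iff)
  qed
  ultimately show ?thesis by (simp add: Lt_idx_iff)
qed

section \<open>Frames of line bundles pulled back to the punctured plane\<close>

lemma matrix_mult_11: "((A :: complex ^ 1 ^ 'n) ** (B :: complex ^ 'm ^ 1)) $ i $ j = A $ i $ 1 * B $ 1 $ j"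
  by (simp add: matrix_matrix_mult_def sum_1)

text \<open>If \<open>f l\<close> are the coordinates of a section of \<open>L\<close>, the products
  of \<open>\<eta> l\<close> and \<open>f l\<close> agree on overlaps. Thus a frame turns sections
  of \<open>L\<close> into functions on subsets of the punctured plane with multiplier
  \<open>t\<close> under F.\<close>

definition frame_of :: "complex \<Rightarrow> complex \<Rightarrow> ('k, 1) hbundle \<Rightarrow> complex \<Rightarrow> ('k \<Rightarrow> complex \<times> complex \<Rightarrow> complex) \<Rightarrow> bool" where
  "frame_of a b L t \<eta> \<longleftrightarrow>
     (\<forall>l\<in>idx L. holomorphic2_on (\<eta> l) (hopf_preimage a b (cover L l)) \<and>
        (\<forall>p\<in>hopf_preimage a b (cover L l). \<eta> l p \<noteq> 0 \<and> \<eta> l (dil a b p) = t * \<eta> l p)) \<and>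
     (\<forall>l\<in>idx L. \<forall>l'\<in>idx L. \<forall>p\<in>hopf_preimage a b (cover L l \<inter> cover L l').
        \<eta> l' p = \<eta> l p * trans L l l' (hopf_proj a b p) $ 1 $ 1)"

lemma frame_ofD:
  assumes "frame_of a b L t \<eta>"
  shows "l \<in> idx L \<Longrightarrow> holomorphic2_on (\<eta> l) (hopf_preimage a b (cover L l))"
    and "l \<in> idx L \<Longrightarrow> p \<in> hopf_preimage a b (cover L l) \<Longrightarrow> \<eta> l p \<noteq> 0"
    and "l \<in> idx L \<Longrightarrow> p \<in> hopf_preimage a b (cover L l) \<Longrightarrow> \<eta> l (dil a b p) = t * \<eta> l p"
    and "l \<in> idx L \<Longrightarrow> l' \<in> idx L \<Longrightarrow> p \<in> hopf_preimage a b (cover L l) \<Longrightarrow>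
      p \<in> hopf_preimage a b (cover L l') \<Longrightarrow> \<eta> l' p = \<eta> l p * trans L l l' (hopf_proj a b p) $ 1 $ 1"
  using assms unfolding frame_of_def hopf_preimage_Int by blast+

lemma line_class_frame:
  assumes ab: "0 < cmod a" "cmod a < 1" "0 < cmod b" "cmod b < 1"
    and L: "holo_bundle a b L" and t: "line_class a b L t"
  shows "\<exists>\<eta>. frame_of a b L t \<eta>"
proof -
  have ab0: "a \<noteq> 0" "b \<noteq> 0" using ab by auto
  let ?P = "hopf_proj a b"
  obtain \<Phi> \<Psi> where \<Phi>: "bundle_mor a b L (Lt a b t) \<Phi>"
    and inv: "\<And>l V x. l \<in> idx L \<Longrightarrow> V \<in> idx (Lt a b t) \<Longrightarrow> x \<in> cover L l \<inter> cover (Lt a b t) V \<Longrightarrow>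
      \<Psi> l V x ** \<Phi> V l x = mat 1"
    using t unfolding line_class_def bundle_iso_def inverse_mors_def by blast
  have cov: "?P p \<in> cover (Lt a b t) V" if "p \<in> V" for p V using that by (simp add: Lt_def)
  have mor: "\<Phi> V l x ** trans L l l' x = trans (Lt a b t) V V' x ** \<Phi> V' l' x"
    if "l \<in> idx L" "l' \<in> idx L" "V \<in> idx (Lt a b t)" "V' \<in> idx (Lt a b t)"
      "x \<in> cover L l" "x \<in> cover L l'" "x \<in> cover (Lt a b t) V" "x \<in> cover (Lt a b t) V'" for l l' V V' x
    using \<Phi> that unfolding bundle_mor_def by blast
  have tr: "trans L l l x = mat 1" if "l \<in> idx L" "x \<in> cover L l" for l x
    using L that unfolding holo_bundle_def by blast
  define W where "W = (\<lambda>p. SOME V. V \<in> idx (Lt a b t) \<and> p \<in> V)"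
  have W: "W p \<in> idx (Lt a b t)" "p \<in> W p" if "p \<noteq> 0" for p
    using someI_ex[of "\<lambda>V. V \<in> idx (Lt a b t) \<and> p \<in> V"] Lt_idx_exists[OF ab that, of t]
    unfolding W_def by blast+
  \<comment> \<open>The image of the local generator of \<open>L\<close>, read in a chart of
    \<open>Lt\<close> around \<open>p\<close>. Another chart containing \<open>p\<close> gives the
    same value, because the transition at \<open>p\<close> is \<open>t\<close> to the power
    0.\<close>
  define \<eta> where "\<eta> = (\<lambda>l p. \<Phi> (W p) l (?P p) $ 1 $ 1)"
  have \<Phi>act: "\<Phi> V l (?P p) $ 1 $ 1 * trans L l l' (?P p) $ 1 $ 1 = t powi k * \<Phi> V' l' (?P p) $ 1 $ 1"
    if "l \<in> idx L" "l' \<in> idx L" "V \<in> idx (Lt a b t)" "V' \<in> idx (Lt a b t)"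
      "?P p \<in> cover L l" "?P p \<in> cover L l'" "p \<in> V'" "hopf_act a b k p \<in> V" for l l' V V' p k
  proof -
    have "?P (hopf_act a b k p) = ?P p"
      by (rule hopf_proj_eqI[OF ab0]) (simp add: hopf_proj_def)
    then have "?P p \<in> cover (Lt a b t) V" using cov[OF that(8)] by simp
    from mor[OF that(1-6) this cov[OF that(7)]]
    have "\<Phi> V l (?P p) ** trans L l l' (?P p) = mat (t powi k) ** \<Phi> V' l' (?P p)"
      using Lt_trans[OF ab0 that(3,4,7,8)] by simp
    from arg_cong[OF this, of "\<lambda>A. A $ 1 $ 1"] show ?thesis
      by (simp add: matrix_mult_11 mat_def)
  qed
  have \<eta>: "\<eta> l p = \<Phi> V l (?P p) $ 1 $ 1" if "l \<in> idx L" "V \<in> idx (Lt a b t)" "p \<noteq> 0" "p \<in> V" "?P p \<in> cover L l" for l V p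
    using \<Phi>act[of l l V "W p" p 0] W[OF that(3)] tr[OF that(1,5)] that by (simp add: \<eta>_def mat_def)
  show ?thesis unfolding frame_of_def
  proof (intro exI[of _ \<eta>] conjI ballI)
    fix l assume l: "l \<in> idx L"
    show "holomorphic2_on (\<eta> l) (hopf_preimage a b (cover L l))"
    proof (rule holomorphic2_on_local)
      fix p assume "p \<in> hopf_preimage a b (cover L l)"
      then have p: "p \<noteq> 0" "?P p \<in> cover L l" by (auto simp: hopf_preimage_def)
      have Wp: "open (W p)" "0 \<notin> W p" using W(1)[OF p(1)] by (auto simp: Lt_idx_iff)
      define T where "T = hopf_preimage a b (cover L l) \<inter> W p"
      have "open (hopf_preimage a b (cover L l))" using L l by (auto simp: holo_bundle_def hopf_open_def)
      then have T: "open T" using Wp by (auto simp: T_def)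
      have "hopf_holo a b (cover L l \<inter> cover (Lt a b t) (W p)) (\<lambda>x. \<Phi> (W p) l x $ 1 $ 1)"
        using \<Phi> l W(1)[OF p(1)] unfolding bundle_mor_def hopf_holo_mat_def by blast
      then have "holomorphic2_on (\<lambda>p'. \<Phi> (W p) l (?P p') $ 1 $ 1) T"
        unfolding hopf_holo_def
        by (rule holomorphic2_on_subset) (use cov in \<open>auto simp: T_def hopf_preimage_def\<close>)
      then have "holomorphic2_on (\<eta> l) T"
        by (rule holomorphic2_on_cong[OF _ T])
           (use \<eta>[OF l W(1)[OF p(1)]] in \<open>auto simp: T_def hopf_preimage_def\<close>)
      then show "\<exists>T. p \<in> T \<and> holomorphic2_on (\<eta> l) T"
        using p W(2) by (intro exI[of _ T]) (auto simp: T_def hopf_preimage_def)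
    qed
    fix p assume "p \<in> hopf_preimage a b (cover L l)"
    then have p: "p \<noteq> 0" "?P p \<in> cover L l" by (auto simp: hopf_preimage_def)
    have "\<Psi> l (W p) (?P p) ** \<Phi> (W p) l (?P p) = mat 1"
      using inv[OF l W(1)[OF p(1)]] p cov W(2)[OF p(1)] by blast
    from arg_cong[OF this, of "\<lambda>A. A $ 1 $ 1"] show "\<eta> l p \<noteq> 0"
      by (auto simp: matrix_mult_11 mat_def \<eta>_def)
    \<comment> \<open>The translate of \<open>W p\<close> by F is a chart around
      \<open>dil a b p\<close> over the same point of the quotient. Its transition from
      \<open>W p\<close> is \<open>t\<close>, which is where the multiplier of the frame comes
      from.\<close>
    have V: "dil a b ` W p \<in> idx (Lt a b t)" by (rule Lt_idx_dil[OF ab0 W(1)[OF p(1)]])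
    have d: "dil a b p \<noteq> 0" "dil a b p \<in> dil a b ` W p" using p W by (auto simp: dil_eq_0_iff[OF ab0])
    have "\<eta> l (dil a b p) = \<Phi> (dil a b ` W p) l (?P p) $ 1 $ 1"
      using \<eta>[OF l V d] p ab0 by simp
    also have "\<dots> = t * \<Phi> (W p) l (?P p) $ 1 $ 1"
      using \<Phi>act[OF l l V W(1)[OF p(1)] p(2) p(2) W(2)[OF p(1)], of 1] d tr[OF l p(2)]
      by (simp add: hopf_act_1 mat_def)
    finally show "\<eta> l (dil a b p) = t * \<eta> l p" by (simp add: \<eta>_def)
  next
    fix l l' p assume l: "l \<in> idx L" "l' \<in> idx L" and "p \<in> hopf_preimage a b (cover L l \<inter> cover L l')"
    then have p: "p \<noteq> 0" "?P p \<in> cover L l" "?P p \<in> cover L l'" by (auto simp: hopf_preimage_def)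
    show "\<eta> l' p = \<eta> l p * trans L l l' (?P p) $ 1 $ 1"
      using \<Phi>act[OF l W(1)[OF p(1)] W(1)[OF p(1)] p(2,3) W(2)[OF p(1)], of 0] W(2)[OF p(1)]
      by (simp add: \<eta>_def)
  qed
qed

lemma cover_preimage:
  assumes "holo_bundle a b E"
  shows "(\<Union>i\<in>idx E. hopf_preimage a b (cover E i)) = - {0}"
  using assms hopf_preimage_surface[of a b] unfolding holo_bundle_def hopf_preimage_def by blast

text \<open>The quotient of two frames is a nowhere vanishing function of weight
  \<open>t / t'\<close>. Applied to it and to its inverse, the bound on weights gives modulus 1; on
  the axis x = 0 it is a monomial, so the weight is a power of \<open>b\<close>, hence 1. This makes
  the class in \<open>line_deg\<close> well defined.\<close>

lemma line_class_unique:
  assumes ab: "0 < cmod a" "cmod a < 1" "0 < cmod b" "cmod b < 1"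
    and L: "holo_bundle a b L" and t: "line_class a b L t" and t': "line_class a b L t'"
  shows "t = t'"
proof -
  have ab0: "a \<noteq> 0" "b \<noteq> 0" using ab by auto
  have t0: "t \<noteq> 0" "t' \<noteq> 0" using t t' by (auto simp: line_class_def)
  obtain \<eta> \<eta>' where \<eta>: "frame_of a b L t \<eta>" and \<eta>': "frame_of a b L t' \<eta>'"
    using line_class_frame[OF ab L t] line_class_frame[OF ab L t'] by blast
  let ?U = "\<lambda>l. hopf_preimage a b (cover L l)"
  have U: "open (?U l)" if "l \<in> idx L" for l
    using L that by (auto simp: holo_bundle_def hopf_open_def)
  have h: "holomorphic2_on (\<lambda>p. \<eta> l p / \<eta>' l p) (?U l)" if "l \<in> idx L" for l
    by (intro holomorphic2_on_divide frame_ofD[OF \<eta>] frame_ofD[OF \<eta>'] that)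
  have eq: "\<eta> l p / \<eta>' l p = \<eta> l' p / \<eta>' l' p" if "l \<in> idx L" "l' \<in> idx L" "p \<in> ?U l" "p \<in> ?U l'" for l l' p
  proof -
    have "\<eta> l' p = \<eta> l p * trans L l l' (hopf_proj a b p) $ 1 $ 1"
      "\<eta>' l' p = \<eta>' l p * trans L l l' (hopf_proj a b p) $ 1 $ 1" "\<eta>' l' p \<noteq> 0"
      by (rule frame_ofD[OF \<eta>] frame_ofD[OF \<eta>'], fact+)+
    then show ?thesis by simp
  qed
  have "\<exists>f. holomorphic2_on f (\<Union>l\<in>idx L. ?U l) \<and> (\<forall>l\<in>idx L. \<forall>p\<in>?U l. f p = \<eta> l p / \<eta>' l p)"
    by (rule holomorphic2_glue) (fact U h eq)+
  then obtain f where f0: "holomorphic2_on f (- {0})" "\<forall>l\<in>idx L. \<forall>p\<in>?U l. f p = \<eta> l p / \<eta>' l p"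
    unfolding cover_preimage[OF L] by (elim exE conjE)
  have f: "holomorphic2_on f (- {0})" "\<And>l p. l \<in> idx L \<Longrightarrow> p \<in> ?U l \<Longrightarrow> f p = \<eta> l p / \<eta>' l p"
    using f0 by simp_all
  define s where "s = t / t'"
  have fs: "f p \<noteq> 0 \<and> f (dil a b p) = s * f p" if "p \<noteq> 0" for p
  proof -
    obtain l where l: "l \<in> idx L" "p \<in> ?U l" using cover_preimage[OF L] \<open>p \<noteq> 0\<close> by blast
    then have "dil a b p \<in> ?U l" by (simp add: dil_mem_hopf_preimage[OF ab0])
    then have "f (dil a b p) = \<eta> l (dil a b p) / \<eta>' l (dil a b p)" using f(2) l by blast
    moreover have "\<eta> l (dil a b p) = t * \<eta> l p" "\<eta>' l (dil a b p) = t' * \<eta>' l p" "\<eta> l p \<noteq> 0" "\<eta>' l p \<noteq> 0"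
      by (rule frame_ofD[OF \<eta>] frame_ofD[OF \<eta>'], fact+)+
    ultimately show ?thesis using f(2)[OF l] by (simp add: s_def)
  qed
  have one: "(1, 1) \<noteq> (0 :: complex \<times> complex)" by (simp add: zero_prod_def)
  have s1: "cmod s \<le> 1"
    by (rule semi_invariant_norm_le_1[OF ab f(1) _ one]) (use fs one in blast)+
  have "cmod (inverse s) \<le> 1"
  proof (rule semi_invariant_norm_le_1[where f = "\<lambda>p. inverse (f p)", OF ab _ _ one])
    show "holomorphic2_on (\<lambda>p. inverse (f p)) (- {0})"
      using fs by (intro holomorphic2_on_inverse f) auto
    show "inverse (f (dil a b p)) = inverse s * inverse (f p)" if "p \<noteq> 0" for p
      using fs[OF that] by simp
  qed (use fs[OF one] in simp)
  moreover have "s \<noteq> 0" using t0 by (simp add: s_def)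
  ultimately have s2: "1 \<le> cmod s" by (simp add: norm_inverse inverse_le_1_iff)
  have hol: "(\<lambda>y. f (0, y)) holomorphic_on - {0}"
    by (rule holomorphic2_on_curve[OF f(1)]) (auto simp: zero_prod_def)
  have sc: "f (0, b * y) = s * f (0, y)" if "y \<noteq> 0" for y
    using fs[of "(0, y)"] that by (simp add: dil_def zero_prod_def)
  have "f (0, 1) \<noteq> 0" using fs[of "(0, 1)"] by (simp add: zero_prod_def)
  from punctured_scaling_monomial[of "\<lambda>y. f (0, y)" b s 1, OF hol ab(3,4) sc _ this]
  obtain n where n: "b powi n = s" by auto
  have "int 0 \<le> n" using n s1 ab by (intro power_int_norm_le_imp[of b]) auto
  moreover have "int 0 \<le> - n"
    using n s2 ab by (intro power_int_norm_le_imp[of b]) (auto simp: power_int_minus norm_inverse intro: inverse_le_1_iff[THEN iffD2])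
  ultimately have "s = 1" using n by simp
  then show ?thesis using t0 by (simp add: s_def)
qed

text \<open>The denominator \<open>ln (cmod b)\<close> of the degree is negative, which turns the
  sign around.\<close>

lemma line_deg_nonpos_imp:
  assumes ab: "0 < cmod a" "cmod a < 1" "0 < cmod b" "cmod b < 1"
    and L: "holo_bundle a b L" and t: "line_class a b L t" and deg: "line_deg a b L \<le> 0"
  shows "1 \<le> cmod t"
proof -
  have "(THE t. line_class a b L t) = t"
    using t line_class_unique[OF ab L] by blast
  then have "ln (cmod t) / ln (cmod b) \<le> 0" using deg by (simp add: line_deg_def)
  moreover have "ln (cmod b) < 0" using ab by simp
  ultimately have "0 \<le> ln (cmod t)" by (simp add: divide_le_0_iff)
  moreover have "0 < cmod t" using t by (simp add: line_class_def)
  ultimately show ?thesis by simp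
qed

section \<open>The invariant sub-line bundle\<close>

lemma matrix_mult_column: "column c (A ** B) = A *v column c B"
  by (simp add: vec_eq_iff column_def matrix_matrix_mult_def matrix_vector_mult_def)

lemma mult_vec1: "(A :: complex ^ 1 ^ 'n) *v u = u $ 1 *s column 1 A"
  by (simp add: vec_eq_iff column_def matrix_vector_mult_def sum_1 mult.commute)

lemma dot2_row: "dot2 (B $ 1) w = ((B :: complex ^ 2 ^ 1) *v w) $ 1"
  by (simp add: dot2_def matrix_vector_mult_def sum_2)

lemma column_11: "column 1 (A :: complex ^ 1 ^ 1) $ 1 = A $ 1 $ 1"
  by (simp add: column_def)

lemma column_eq_imp_eq: "column 1 A = column 1 (B :: complex ^ 1 ^ 'n) \<Longrightarrow> A = B"
  by (simp add: vec_eq_iff column_def forall_1)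

lemma scale_mat_vec: "scale_mat c A *v w = c *s (A *v w)"
  by (simp add: vec_eq_iff scale_mat_def matrix_vector_mult_def sum_distrib_left mult.assoc)

lemma scale_mat_1 [simp]: "scale_mat 1 A = A"
  by (simp add: vec_eq_iff scale_mat_def)

lemma column_nth: "column c A $ r = A $ r $ c"
  by (simp add: column_def)

lemma mult_mat_vec_scale: "(A :: complex ^ 'n ^ 'm) *v (c *s u) = c *s (A *v u)"
  by (simp add: vec_eq_iff matrix_vector_mult_def sum_distrib_left mult_ac)

lemma dot2_scale_left: "dot2 (c *s u) v = c * dot2 u v"
  by (simp add: dot2_def algebra_simps)

lemma hopf_holo_local:
  assumes "\<And>x. x \<in> V \<Longrightarrow> \<exists>V'. x \<in> V' \<and> hopf_holo a b V' f"
  shows "hopf_holo a b V f"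
  unfolding hopf_holo_def
proof (rule holomorphic2_on_local)
  fix p assume "p \<in> hopf_preimage a b V"
  then have p: "p \<noteq> 0" "hopf_proj a b p \<in> V" by (auto simp: hopf_preimage_def)
  obtain V' where "hopf_proj a b p \<in> V'" "hopf_holo a b V' f" using assms[OF p(2)] by blast
  then show "\<exists>T. p \<in> T \<and> holomorphic2_on (\<lambda>p. f (hopf_proj a b p)) T"
    using p by (intro exI[of _ "hopf_preimage a b V'"]) (auto simp: hopf_holo_def hopf_preimage_def)
qed

lemma hopf_holo_const: "hopf_holo a b V (\<lambda>_. c)"
  by (simp add: hopf_holo_def)

lemma holo_bundleD:
  assumes "holo_bundle a b E"
  shows "i \<in> idx E \<Longrightarrow> hopf_open a b (cover E i)"
    and "x \<in> hopf_surface a b \<Longrightarrow> \<exists>i\<in>idx E. x \<in> cover E i"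
    and "i \<in> idx E \<Longrightarrow> x \<in> cover E i \<Longrightarrow> x \<in> hopf_surface a b"
    and "i \<in> idx E \<Longrightarrow> j \<in> idx E \<Longrightarrow> hopf_holo a b (cover E i \<inter> cover E j) (\<lambda>x. trans E i j x $ r $ c)"
    and "i \<in> idx E \<Longrightarrow> x \<in> cover E i \<Longrightarrow> trans E i i x = mat 1"
    and "i \<in> idx E \<Longrightarrow> j \<in> idx E \<Longrightarrow> k \<in> idx E \<Longrightarrow> x \<in> cover E i \<Longrightarrow> x \<in> cover E j \<Longrightarrow> x \<in> cover E k \<Longrightarrow>
      trans E i j x ** trans E j k x = trans E i k x"
  using assms unfolding holo_bundle_def hopf_holo_mat_def by blast+

lemma bundle_morD:
  assumes "bundle_mor a b E E' \<Phi>"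
  shows "i \<in> idx E \<Longrightarrow> j \<in> idx E' \<Longrightarrow> hopf_holo a b (cover E i \<inter> cover E' j) (\<lambda>x. \<Phi> j i x $ r $ c)"
    and "i \<in> idx E \<Longrightarrow> i' \<in> idx E \<Longrightarrow> j \<in> idx E' \<Longrightarrow> j' \<in> idx E' \<Longrightarrow>
      x \<in> cover E i \<Longrightarrow> x \<in> cover E i' \<Longrightarrow> x \<in> cover E' j \<Longrightarrow> x \<in> cover E' j' \<Longrightarrow>
      \<Phi> j i x ** trans E i i' x = trans E' j j' x ** \<Phi> j' i' x"
  using assms unfolding bundle_mor_def hopf_holo_mat_def by blast+

lemma trivial_bundle_simps [simp]:
  "idx (trivial_bundle a b) = UNIV" "cover (trivial_bundle a b) l = hopf_surface a b"
  "trans (trivial_bundle a b) l l' x = mat 1"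
  by (simp_all add: trivial_bundle_def)

lemma hopf_open_surface: "hopf_open a b (hopf_surface a b)"
  by (simp add: hopf_open_def hopf_preimage_surface open_punctured_plane)

lemma holo_trivial_bundle: "holo_bundle a b (trivial_bundle a b)"
  by (simp add: holo_bundle_def hopf_open_surface hopf_holo_mat_def hopf_holo_const)

section \<open>Extensions of a line bundle by the trivial bundle\<close>

locale hopf_extension =
  fixes a b :: complex
    and E :: "('i, 2) hbundle"
    and H :: "('h, 1) hbundle"
    and \<iota> :: "'i \<Rightarrow> unit \<Rightarrow> hopf_point \<Rightarrow> complex ^ 1 ^ 2"
    and \<rho> :: "'h \<Rightarrow> 'i \<Rightarrow> hopf_point \<Rightarrow> complex ^ 2 ^ 1"
  assumes ab: "0 < cmod a" "cmod a < 1" "0 < cmod b" "cmod b < 1"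
    and holE: "holo_bundle a b E"
    and holH: "holo_bundle a b H"
    and exact: "short_exact a b (trivial_bundle a b) E H \<iota> \<rho>"
begin

abbreviation incl :: "'i \<Rightarrow> hopf_point \<Rightarrow> complex ^ 2" where
  "incl i x \<equiv> column 1 (\<iota> i () x)"

lemmas holE' = holo_bundleD[OF holE] and holH' = holo_bundleD[OF holH]

lemma mor: "bundle_mor a b (trivial_bundle a b) E \<iota>" "bundle_mor a b E H \<rho>"
  using exact by (auto simp: short_exact_def)

lemma ab0: "a \<noteq> 0" "b \<noteq> 0"
  using ab by auto

lemma exact_pointwise:
  assumes "i \<in> idx E" "h \<in> idx H" "x \<in> cover E i" "x \<in> cover H h"
  shows "dot2 (\<rho> h i x $ 1) (incl i x) = 0" and "\<exists>r. \<rho> h i x $ 1 $ r \<noteq> 0"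
    and "dot2 (\<rho> h i x $ 1) w = 0 \<Longrightarrow> \<exists>c. w = c *s incl i x"
proof -
  have "x \<in> hopf_surface a b" using holE'(3) assms by blast
  then have ex: "range ((*v) (\<iota> i () x)) = {v. \<rho> h i x *v v = 0}" "surj ((*v) (\<rho> h i x))"
    using exact assms unfolding short_exact_def by auto
  have "incl i x \<in> range ((*v) (\<iota> i () x))"
    by (rule range_eqI[of _ _ 1]) (simp add: mult_vec1)
  then show "dot2 (\<rho> h i x $ 1) (incl i x) = 0" unfolding ex(1) by (simp add: dot2_row)
  show "\<exists>r. \<rho> h i x $ 1 $ r \<noteq> 0"
  proof (rule ccontr)
    assume *: "\<not> ?thesis"
    obtain v where "\<rho> h i x *v v = 1" using ex(2) by (metis surjD)
    from arg_cong[OF this, of "\<lambda>v. v $ 1"] show False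
      using * by (simp add: dot2_row[symmetric] dot2_def)
  qed
  assume "dot2 (\<rho> h i x $ 1) w = 0"
  then have "\<rho> h i x *v w = 0" by (simp add: dot2_row vec_eq_iff forall_1)
  then have "w \<in> range ((*v) (\<iota> i () x))" unfolding ex(1) by simp
  then show "\<exists>c. w = c *s incl i x" by (auto simp: mult_vec1)
qed

lemma incl_nonzero:
  assumes "i \<in> idx E" "x \<in> cover E i"
  shows "incl i x \<noteq> 0"
proof
  assume 0: "incl i x = 0"
  have x: "x \<in> hopf_surface a b" using holE'(3) assms by blast
  then obtain h where "h \<in> idx H" "x \<in> cover H h" using holH'(2) by blast
  then have "inj ((*v) (\<iota> i () x))" using exact assms x unfolding short_exact_def by auto
  moreover have "\<iota> i () x *v 1 = \<iota> i () x *v 0" using 0 by (simp add: mult_vec1)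
  ultimately have "(1 :: complex ^ 1) = 0" by (rule injD)
  then show False by simp
qed

lemma incl_trans:
  assumes "i \<in> idx E" "i' \<in> idx E" "x \<in> cover E i" "x \<in> cover E i'"
  shows "trans E i i' x *v incl i' x = incl i x"
proof -
  have "x \<in> hopf_surface a b" using holE'(3) assms by blast
  then have "\<iota> i () x ** mat 1 = trans E i i' x ** \<iota> i' () x"
    using bundle_morD(2)[OF mor(1), of "()" "()" i i' x] assms by simp
  then show ?thesis by (simp add: matrix_mult_column[symmetric])
qed

lemma rho_trans:
  assumes "i \<in> idx E" "i' \<in> idx E" "h \<in> idx H" "h' \<in> idx H"
    "x \<in> cover E i" "x \<in> cover E i'" "x \<in> cover H h" "x \<in> cover H h'"
  shows "dot2 (\<rho> h i x $ 1) (trans E i i' x *v w) = trans H h h' x $ 1 $ 1 * dot2 (\<rho> h' i' x $ 1) w"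
proof -
  have "\<rho> h i x *v (trans E i i' x *v w) = trans H h h' x *v (\<rho> h' i' x *v w)"
    using bundle_morD(2)[OF mor(2) assms] by (simp add: matrix_vector_mul_assoc)
  then show ?thesis by (simp add: dot2_row mult_vec1 column_11)
qed

lemma incl_holo:
  "i \<in> idx E \<Longrightarrow> hopf_holo a b (cover E i) (\<lambda>x. incl i x $ r)"
  using bundle_morD(1)[OF mor(1), of "()" i r 1] hopf_open_subset[OF holE'(1)]
  by (auto simp: column_def Int_absorb1)

lemma phi0_apply:
  assumes "h \<in> idx H" "x \<in> cover H h"
  shows "phi0 H \<iota> \<rho> (i, h) x *v w = dot2 (\<rho> h i x $ 1) w *s incl i x"
proof -
  have "phi0 H \<iota> \<rho> (i, h) x *v w = scale_mat (mat 1 $ 1 $ (1 :: 1)) (\<iota> i () x) *v (\<rho> h i x *v w)"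
    using holH'(5)[OF assms] by (simp add: phi0_def tensor_id_def matrix_vector_mul_assoc)
  then show ?thesis by (simp add: mat_def scale_mat_vec mult_vec1 dot2_row)
qed

text \<open>If \<open>f e\<close> comes from the trivial bundle, then \<rho> kills
  \<open>f e\<close>. As \<open>f\<close> has nonzero values in every nonempty open set, \<rho>
  kills \<open>e\<close> as well, so \<open>e\<close> is pointwise a multiple of the inclusion.
  Since the inclusion vanishes nowhere, the factor is holomorphic.\<close>

lemma sub_line_bundle_incl: "sub_line_bundle a b (trivial_bundle a b) E \<iota>"
  unfolding sub_line_bundle_def
proof (intro conjI allI impI ballI)
  show "holo_bundle a b (trivial_bundle a b)" by (rule holo_trivial_bundle)
  show "bundle_mor a b (trivial_bundle a b) E \<iota>" by (rule mor)
next
  fix V m l x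
  assume A: "hopf_open a b V \<and> holo_section a b (trivial_bundle a b) V m \<and>
    maps_section (trivial_bundle a b) E \<iota> V m (\<lambda>_ _. 0)" and x: "x \<in> V \<inter> cover (trivial_bundle a b) l"
  then obtain i where i: "i \<in> idx E" "x \<in> cover E i" using holE'(2) by auto
  then have "0 = \<iota> i () x *v m () x" using A x unfolding maps_section_def by simp
  then have "m () x $ 1 = 0" using incl_nonzero[OF i] by (simp add: mult_vec1)
  then show "m l x = 0" by (simp add: vec_eq_iff forall_1)
next
  fix V f e m x
  assume A: "hopf_open a b V \<and> hopf_holo a b V f \<and> nowhere_locally_zero a b V f \<and>
    holo_section a b E V e \<and> holo_section a b (trivial_bundle a b) V m \<and>
    maps_section (trivial_bundle a b) E \<iota> V m (\<lambda>i x. f x *s e i x)" and x: "x \<in> V"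
  have V: "hopf_open a b V" using A by blast
  have he: "hopf_holo a b (V \<inter> cover E i) (\<lambda>x. e i x $ r)" if "i \<in> idx E" for i r
    using A that unfolding holo_section_def hopf_holo_vec_def by blast
  have te: "e i y = trans E i i' y *v e i' y" if "i \<in> idx E" "i' \<in> idx E" "y \<in> V" "y \<in> cover E i" "y \<in> cover E i'" for i i' y
    using A that unfolding holo_section_def by blast
  have me: "f y *s e i y = m () y $ 1 *s incl i y" if "i \<in> idx E" "y \<in> V" "y \<in> cover E i" for i y
    using A that holE'(3) unfolding maps_section_def by (simp add: mult_vec1)
  have ker: "dot2 (\<rho> h i y $ 1) (e i y) = 0"
    if i: "i \<in> idx E" and h: "h \<in> idx H" and y: "y \<in> V" "y \<in> cover E i" "y \<in> cover H h" for i h y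
  proof (rule ccontr)
    assume nz: "dot2 (\<rho> h i y $ 1) (e i y) \<noteq> 0"
    define N where "N = V \<inter> cover E i \<inter> cover H h"
    have N: "hopf_open a b N" unfolding N_def by (intro hopf_open_Int V holE'(1) holH'(1) i h)
    have "hopf_holo a b N (\<lambda>y. e i y $ r)" for r
      by (rule hopf_holo_subset[OF he[OF i]]) (auto simp: N_def)
    moreover have "hopf_holo a b N (\<lambda>y. \<rho> h i y $ 1 $ r)" for r
      by (rule hopf_holo_subset[OF bundle_morD(1)[OF mor(2) i h]]) (auto simp: N_def)
    ultimately have "hopf_holo a b N (\<lambda>y. dot2 (\<rho> h i y $ 1) (e i y))"
      unfolding dot2_def hopf_holo_def by (intro holomorphic2_intros)
    from hopf_open_nonzero[OF N this]
    have N': "hopf_open a b {y \<in> N. dot2 (\<rho> h i y $ 1) (e i y) \<noteq> 0}" .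
    have "nowhere_locally_zero a b V f" using A by blast
    then have "\<exists>z\<in>{y \<in> N. dot2 (\<rho> h i y $ 1) (e i y) \<noteq> 0}. f z \<noteq> 0"
      unfolding nowhere_locally_zero_def
      by (elim allE[of _ "{y \<in> N. dot2 (\<rho> h i y $ 1) (e i y) \<noteq> 0}"] mp)
         (use N' y nz in \<open>auto simp: N_def\<close>)
    then obtain z where z: "z \<in> N" "dot2 (\<rho> h i z $ 1) (e i z) \<noteq> 0" "f z \<noteq> 0" by auto
    then have "dot2 (\<rho> h i z $ 1) (f z *s e i z) = 0"
      using me[OF i, of z] exact_pointwise(1)[OF i h, of z] by (simp add: N_def dot2_linear)
    then show False using z by (simp add: dot2_linear)
  qed
  have ex: "\<exists>c. e i y = c *s incl i y" if "i \<in> idx E" "y \<in> V" "y \<in> cover E i" for i y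
  proof -
    obtain h where "h \<in> idx H" "y \<in> cover H h" using holH'(2) holE'(3) \<open>i \<in> idx E\<close> \<open>y \<in> cover E i\<close> by blast
    then show ?thesis using exact_pointwise(3)[of i h y] ker that by blast
  qed
  obtain i where i: "i \<in> idx E" "x \<in> cover E i" using holE'(2) hopf_open_subset[OF V] x by blast
  \<comment> \<open>Near \<open>x\<close> the coefficient of \<open>e\<close> is the quotient of the
    components with this index.\<close>
  obtain r where r: "incl i x $ r \<noteq> 0" using incl_nonzero[OF i] by (auto simp: vec_eq_iff)
  define N where "N = {y \<in> V \<inter> cover E i. incl i y $ r \<noteq> 0}"
  have hi: "hopf_holo a b (V \<inter> cover E i) (\<lambda>y. incl i y $ r)"
    by (rule hopf_holo_subset[OF incl_holo[OF i(1)]]) auto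
  have N: "hopf_open a b N"
    unfolding N_def by (intro hopf_open_nonzero hopf_open_Int V holE'(1) i hi)
  define n :: "unit \<Rightarrow> hopf_point \<Rightarrow> complex ^ 1" where "n = (\<lambda>_ y. vec (e i y $ r / incl i y $ r))"
  have "hopf_holo a b N (\<lambda>y. e i y $ r / incl i y $ r)"
    by (rule hopf_holo_divide) (auto simp: N_def intro: hopf_holo_subset[OF he[OF i(1)]] hopf_holo_subset[OF hi])
  then have "holo_section a b (trivial_bundle a b) N n"
    using hopf_open_subset[OF N] by (simp add: holo_section_def hopf_holo_vec_def n_def Int_absorb2)
  moreover have "maps_section (trivial_bundle a b) E \<iota> N n e"
    unfolding maps_section_def
  proof (intro ballI)
    fix u i' y assume i': "i' \<in> idx E" and y: "y \<in> N \<inter> cover (trivial_bundle a b) u \<inter> cover E i'"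
    then have y': "y \<in> V" "y \<in> cover E i" "y \<in> cover E i'" "incl i y $ r \<noteq> 0" by (auto simp: N_def)
    obtain c where c: "e i y = c *s incl i y" using ex[OF i(1) y'(1,2)] by blast
    have "e i' y = c *s incl i' y"
      unfolding te[OF i' i(1) y'(1,3,2)] c incl_trans[OF i' i(1) y'(3,2), symmetric]
      by (simp add: vec2_eq_iff mult_mat2_vec2 algebra_simps)
    then show "e i' y = \<iota> i' u y *v n u y"
      using y'(4) by (simp add: mult_vec1 n_def c)
  qed
  ultimately show "\<exists>V' n. hopf_open a b V' \<and> x \<in> V' \<and> V' \<subseteq> V \<and>
           holo_section a b (trivial_bundle a b) V' n \<and> maps_section (trivial_bundle a b) E \<iota> V' n e"
    using N x i r by (intro exI[of _ N] exI[of _ n]) (auto simp: N_def)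
qed

text \<open>\<phi>0 starts with \<rho>, which kills the image of the inclusion, so the zero section
  serves as the preimage.\<close>

lemma invariant_incl: "invariant_sub a b (trivial_bundle a b) E H \<iota> (phi0 H \<iota> \<rho>)"
  unfolding invariant_sub_def
proof (intro allI impI)
  fix V m e
  assume A: "hopf_open a b V \<and> holo_section a b (trivial_bundle a b) V m \<and> holo_section a b E V e \<and>
    maps_section (trivial_bundle a b) E \<iota> V m e"
  have "phi0 H \<iota> \<rho> (i, h) x *v e i x = 0"
    if "i \<in> idx E" "h \<in> idx H" "x \<in> V" "x \<in> cover E i" "x \<in> cover H h" for i h x
  proof -
    have "e i x = m () x $ 1 *s incl i x"
      using A that holE'(3) unfolding maps_section_def by (simp add: mult_vec1)
    then show ?thesis
      using that by (simp add: phi0_apply dot2_linear exact_pointwise(1))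
  qed
  then show "\<exists>n. holo_section a b (twist (trivial_bundle a b) H) V n \<and>
       maps_section (twist (trivial_bundle a b) H) (twist E H) (tensor_id H \<iota>) V n
         (\<lambda>(i, k) x. phi0 H \<iota> \<rho> (i, k) x *v e i x)"
    by (intro exI[of _ "\<lambda>_ _. 0"])
       (auto simp: holo_section_def hopf_holo_vec_def hopf_holo_const maps_section_def twist_def)
qed

text \<open>The image of \<phi>0 lies in the inclusion, so an invariant line on which \<rho> is
  nonzero at a point would be mapped nontrivially off itself. Hence \<open>j\<close> is a multiple
  \<open>c\<close> of the inclusion; torsion-freeness of the quotient shows that \<open>c\<close>
  vanishes nowhere, and \<open>c\<close> is the required isomorphism.\<close>

lemma invariant_sub_unique:
  fixes M :: "('l, 1) hbundle"
  assumes sub: "sub_line_bundle a b M E j" and inv: "invariant_sub a b M E H j (phi0 H \<iota> \<rho>)"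
  shows "same_sub a b M (trivial_bundle a b) E j \<iota>"
proof -
  have holM: "holo_bundle a b M" and morj: "bundle_mor a b M E j"
    using sub unfolding sub_line_bundle_def by blast+
  note M' = holo_bundleD[OF holM]
  define jc where "jc = (\<lambda>i l x. column 1 (j i l x))"
  \<comment> \<open>The local generator of \<open>M\<close> belonging to the trivialisation
    \<open>l\<close>, in the coordinates of \<open>l'\<close>.\<close>
  define fr where "fr = (\<lambda>l l' x. column 1 (trans M l' l x))"
  have jc_trans: "jc i l x = trans E i i' x *v jc i' l x"
    if "i \<in> idx E" "i' \<in> idx E" "l \<in> idx M" "x \<in> cover E i" "x \<in> cover E i'" "x \<in> cover M l" for i i' l x
    using bundle_morD(2)[OF morj, of l l i i' x] M'(5)[of l x] that
    by (simp add: jc_def matrix_mult_column[symmetric])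
  have jc_fr: "jc i l x = j i l' x *v fr l l' x"
    if "i \<in> idx E" "l \<in> idx M" "l' \<in> idx M" "x \<in> cover E i" "x \<in> cover M l" "x \<in> cover M l'" for i l l' x
    using bundle_morD(2)[OF morj, of l' l i i x] holE'(5)[of i x] that
    by (simp add: jc_def fr_def matrix_mult_column[symmetric])
  have frame: "holo_section a b M V (fr l)" if l: "l \<in> idx M" "V \<subseteq> cover M l" for l V
    unfolding holo_section_def hopf_holo_vec_def
  proof (intro conjI ballI allI)
    fix l' and r :: 1 assume l': "l' \<in> idx M"
    show "hopf_holo a b (V \<inter> cover M l') (\<lambda>x. fr l l' x $ r)"
      unfolding fr_def column_def
      by (simp, rule hopf_holo_subset[OF M'(4)[OF l' l(1)]]) (use l in auto)
  next
    fix l' l'' x assume "l' \<in> idx M" "l'' \<in> idx M" "x \<in> V \<inter> cover M l' \<inter> cover M l''"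
    then show "fr l l' x = trans M l' l'' x *v fr l l'' x"
      using M'(6)[of l' l'' l x] l by (auto simp: fr_def matrix_mult_column[symmetric])
  qed
  have hjc: "hopf_holo a b (cover M l \<inter> cover E i) (\<lambda>x. jc i l x $ r)" if "i \<in> idx E" "l \<in> idx M" for i l r
    using bundle_morD(1)[OF morj that(2,1), of r 1] by (simp add: jc_def column_def)
  have ker: "dot2 (\<rho> h i x $ 1) (jc i l x) = 0"
    if i: "i \<in> idx E" and l: "l \<in> idx M" and h: "h \<in> idx H"
      and x: "x \<in> cover E i" "x \<in> cover M l" "x \<in> cover H h" for i l h x
  proof (rule ccontr)
    assume nz: "dot2 (\<rho> h i x $ 1) (jc i l x) \<noteq> 0"
    have "holo_section a b E (cover M l) (\<lambda>i. jc i l)"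
      unfolding holo_section_def hopf_holo_vec_def
    proof (intro conjI ballI allI)
      fix i i' y assume "i \<in> idx E" "i' \<in> idx E" "y \<in> cover M l \<inter> cover E i \<inter> cover E i'"
      then show "jc i l y = trans E i i' y *v jc i' l y" by (intro jc_trans l) auto
    qed (rule hjc[OF _ l])
    moreover have "maps_section M E j (cover M l) (fr l) (\<lambda>i. jc i l)"
      unfolding maps_section_def
    proof (intro ballI)
      fix l' i y assume "l' \<in> idx M" "i \<in> idx E" "y \<in> cover M l \<inter> cover M l' \<inter> cover E i"
      then show "jc i l y = j i l' y *v fr l l' y" by (intro jc_fr l) auto
    qed
    ultimately obtain n where n: "maps_section (twist M H) (twist E H) (tensor_id H j) (cover M l) n
         (\<lambda>(i, k) x. phi0 H \<iota> \<rho> (i, k) x *v jc i l x)"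
      using inv M'(1)[OF l] frame[OF l order_refl] unfolding invariant_sub_def by blast
    have "(l, h) \<in> idx (twist M H)" "(i, h) \<in> idx (twist E H)"
      "x \<in> cover M l \<inter> cover (twist M H) (l, h) \<inter> cover (twist E H) (i, h)"
      using i l h x by (simp_all add: twist_def)
    then have "(\<lambda>(i, k) x. phi0 H \<iota> \<rho> (i, k) x *v jc i l x) (i, h) x = tensor_id H j (i, h) (l, h) x *v n (l, h) x"
      using n unfolding maps_section_def by blast
    then have "dot2 (\<rho> h i x $ 1) (jc i l x) *s incl i x = n (l, h) x $ 1 *s jc i l x"
      using holH'(5)[OF h x(3)]
      by (simp add: phi0_apply[OF h x(3)] tensor_id_def mat_def scale_mat_vec mult_vec1 jc_def)
    \<comment> \<open>Applying \<rho> kills the inclusion on the left side, so the coefficient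
      \<open>n\<close> on the right vanishes at \<open>x\<close>. The equation then contradicts that
      the inclusion is nonzero.\<close>
    moreover from arg_cong[OF this, of "dot2 (\<rho> h i x $ 1)"]
    have "n (l, h) x $ 1 = 0"
      using exact_pointwise(1)[OF i h x(1,3)] nz by (simp add: dot2_linear)
    ultimately show False using nz incl_nonzero[OF i x(1)] by simp
  qed
  define c where "c = (\<lambda>l x. SOME c. \<forall>i\<in>idx E. x \<in> cover E i \<longrightarrow> jc i l x = c *s incl i x)"
  have c: "jc i l x = c l x *s incl i x" if i: "i \<in> idx E" and l: "l \<in> idx M" and x: "x \<in> cover E i" "x \<in> cover M l" for i l x
  proof -
    obtain h where h: "h \<in> idx H" "x \<in> cover H h" using holH'(2) holE'(3) i x by blast
    obtain d where d: "jc i l x = d *s incl i x"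
      using exact_pointwise(3)[OF i h(1) x(1) h(2) ker[OF i l h(1) x h(2)]] by blast
    have "jc i' l x = d *s incl i' x" if "i' \<in> idx E" "x \<in> cover E i'" for i'
      unfolding jc_trans[OF that(1) i l that(2) x] d incl_trans[OF that(1) i that(2) x(1), symmetric]
      by (simp add: vec2_eq_iff mult_mat2_vec2 algebra_simps)
    then have "\<exists>c. \<forall>i\<in>idx E. x \<in> cover E i \<longrightarrow> jc i l x = c *s incl i x" by blast
    from someI_ex[OF this] show ?thesis using i x unfolding c_def by blast
  qed
  have hc: "hopf_holo a b (cover M l) (c l)" if l: "l \<in> idx M" for l
  proof (rule hopf_holo_local)
    fix x assume x: "x \<in> cover M l"
    then obtain i where i: "i \<in> idx E" "x \<in> cover E i" using holE'(2) M'(3)[OF l] by blast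
    obtain r where r: "incl i x $ r \<noteq> 0" using incl_nonzero[OF i] by (auto simp: vec_eq_iff)
    have O: "hopf_open a b (cover M l \<inter> cover E i)" by (intro hopf_open_Int M'(1) holE'(1) l i)
    have hi: "hopf_holo a b (cover M l \<inter> cover E i) (\<lambda>y. incl i y $ r)"
      by (rule hopf_holo_subset[OF incl_holo[OF i(1)]]) auto
    define N where "N = {y \<in> cover M l \<inter> cover E i. incl i y $ r \<noteq> 0}"
    have N: "hopf_open a b N" unfolding N_def by (rule hopf_open_nonzero[OF O hi])
    have "hopf_holo a b N (\<lambda>y. jc i l y $ r / incl i y $ r)"
      by (rule hopf_holo_divide) (auto simp: N_def intro: hopf_holo_subset[OF hjc[OF i(1) l]] hopf_holo_subset[OF hi])
    then have "hopf_holo a b N (c l)"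
      by (rule hopf_holo_cong[OF _ N]) (use c[OF i(1) l] in \<open>auto simp: N_def\<close>)
    then show "\<exists>V'. x \<in> V' \<and> hopf_holo a b V' (c l)" using x i r by (intro exI[of _ N]) (auto simp: N_def)
  qed
  have fr_self: "fr l l x = 1" if "l \<in> idx M" "x \<in> cover M l" for l x
    using M'(5)[OF that] by (simp add: fr_def vec_eq_iff forall_1 column_11 mat_def)
  have c0: "c l x \<noteq> 0" if l: "l \<in> idx M" and x: "x \<in> cover M l" for l x
  proof -
    \<comment> \<open>On an open set where \<open>c l\<close> vanishes, \<open>j\<close> would kill
      the local generator of \<open>M\<close>, against injectivity on sections.\<close>
    have nlz: "nowhere_locally_zero a b (cover M l) (c l)"
      unfolding nowhere_locally_zero_def
    proof (intro allI impI, rule ccontr)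
      fix V' assume V': "hopf_open a b V' \<and> V' \<subseteq> cover M l \<and> V' \<noteq> {}" and z: "\<not> (\<exists>x\<in>V'. c l x \<noteq> 0)"
      then obtain y where y: "y \<in> V'" "y \<in> cover M l" by blast
      have "maps_section M E j V' (fr l) (\<lambda>_ _. 0)"
        unfolding maps_section_def
      proof (intro ballI)
        fix l' i x assume A: "l' \<in> idx M" "i \<in> idx E" "x \<in> V' \<inter> cover M l' \<inter> cover E i"
        then have "j i l' x *v fr l l' x = c l x *s incl i x"
          using jc_fr[OF A(2) l A(1), of x] c[OF A(2) l, of x] V' by auto
        then show "0 = j i l' x *v fr l l' x" using z A by auto
      qed
      then have "fr l l y = 0"
        using V' frame[OF l] l y
        by (intro sub[unfolded sub_line_bundle_def, THEN conjunct2, THEN conjunct2, THEN conjunct1, rule_format, of V' "fr l"]) auto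
      then show False using fr_self[OF l y(2)] by simp
    qed
    have hol: "holo_section a b E (cover M l) incl"
      unfolding holo_section_def hopf_holo_vec_def
    proof (intro conjI ballI allI)
      fix i i' y assume "i \<in> idx E" "i' \<in> idx E" "y \<in> cover M l \<inter> cover E i \<inter> cover E i'"
      then show "incl i y = trans E i i' y *v incl i' y" by (intro incl_trans[symmetric]) auto
    qed (rule hopf_holo_subset[OF incl_holo], auto)
    have ms: "maps_section M E j (cover M l) (fr l) (\<lambda>i x. c l x *s incl i x)"
      unfolding maps_section_def
    proof (intro ballI)
      fix l' i y assume "l' \<in> idx M" "i \<in> idx E" "y \<in> cover M l \<inter> cover M l' \<inter> cover E i"
      then show "c l y *s incl i y = j i l' y *v fr l l' y"
        using jc_fr[of i l l' y] c[of i l y] l by simp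
    qed
    \<comment> \<open>Torsion-freeness for \<open>c l\<close> times the inclusion, which is the
      image of the local generator: near \<open>x\<close> the inclusion itself comes from a section
      of \<open>M\<close>, which excludes \<open>c l x = 0\<close>.\<close>
    have "\<exists>V' n. hopf_open a b V' \<and> x \<in> V' \<and> V' \<subseteq> cover M l \<and>
           holo_section a b M V' n \<and> maps_section M E j V' n incl"
      by (rule sub[unfolded sub_line_bundle_def, THEN conjunct2, THEN conjunct2, THEN conjunct2, rule_format, where f = "c l" and m = "fr l", OF _ x])
         (intro conjI M'(1)[OF l] hc[OF l] nlz frame[OF l order_refl] hol ms)
    then obtain V' n where V': "x \<in> V'" "V' \<subseteq> cover M l" "maps_section M E j V' n incl"
      by blast
    obtain i where i: "i \<in> idx E" "x \<in> cover E i" using holE'(2) M'(3)[OF l x] by blast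
    have "incl i x = j i l x *v n l x" using V' i l unfolding maps_section_def by blast
    then have "incl i x = n l x $ 1 *s jc i l x" by (simp add: mult_vec1 jc_def)
    then show ?thesis using c[OF i(1) l i(2) x] incl_nonzero[OF i] by auto
  qed
  define u :: "unit \<Rightarrow> 'l \<Rightarrow> hopf_point \<Rightarrow> complex ^ 1 ^ 1" where "u = (\<lambda>_ l x. mat (c l x))"
  define w :: "'l \<Rightarrow> unit \<Rightarrow> hopf_point \<Rightarrow> complex ^ 1 ^ 1" where "w = (\<lambda>l _ x. mat (1 / c l x))"
  have ct: "c l x * trans M l l' x $ 1 $ 1 = c l' x"
    if l: "l \<in> idx M" "l' \<in> idx M" and x: "x \<in> cover M l" "x \<in> cover M l'" for l l' x
  proof -
    obtain i where i: "i \<in> idx E" "x \<in> cover E i" using holE'(2) M'(3)[OF l(1) x(1)] by blast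
    have "jc i l' x = fr l' l x $ 1 *s jc i l x"
      using jc_fr[OF i(1) l(2,1) i(2) x(2,1)] by (simp add: mult_vec1 jc_def)
    then have "c l' x *s incl i x = (fr l' l x $ 1 * c l x) *s incl i x"
      using c[OF i(1) l(1) i(2) x(1)] c[OF i(1) l(2) i(2) x(2)] by simp
    then have "c l' x = fr l' l x $ 1 * c l x" using vec2_scale_cancel incl_nonzero[OF i] by blast
    then show ?thesis by (simp add: fr_def column_11 mult.commute)
  qed
  have eq1: "A = B \<longleftrightarrow> A $ 1 $ 1 = B $ 1 $ 1" for A B :: "complex ^ 1 ^ 1"
    by (simp add: vec_eq_iff forall_1)
  have mor_u: "bundle_mor a b M (trivial_bundle a b) u"
    unfolding bundle_mor_def
  proof (intro conjI ballI)
    fix l and k :: unit assume l: "l \<in> idx M"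
    have "cover M l \<inter> hopf_surface a b = cover M l" using M'(3)[OF l] by blast
    then show "hopf_holo_mat a b (cover M l \<inter> cover (trivial_bundle a b) k) (u k l)"
      using hc[OF l] by (simp add: hopf_holo_mat_def u_def mat_def num1_eq_iff hopf_holo_const)
  qed (use ct in \<open>auto simp: eq1 u_def matrix_mult_11 mat_def\<close>)
  have mor_w: "bundle_mor a b (trivial_bundle a b) M w"
    unfolding bundle_mor_def
  proof (intro conjI ballI)
    fix l and k :: unit assume l: "l \<in> idx M"
    have "hopf_surface a b \<inter> cover M l = cover M l" using M'(3)[OF l] by blast
    moreover have "hopf_holo a b (cover M l) (\<lambda>x. 1 / c l x)"
      by (rule hopf_holo_divide[OF hopf_holo_const hc[OF l] c0[OF l]])
    ultimately show "hopf_holo_mat a b (cover (trivial_bundle a b) k \<inter> cover M l) (w l k)"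
      by (simp add: hopf_holo_mat_def w_def mat_def num1_eq_iff)
  next
    fix k k' :: unit and l l' x
    assume l: "l \<in> idx M" "l' \<in> idx M"
      and x: "x \<in> cover (trivial_bundle a b) k \<inter> cover (trivial_bundle a b) k' \<inter> cover M l \<inter> cover M l'"
    then show "w l k x ** trans (trivial_bundle a b) k k' x = trans M l l' x ** w l' k' x"
      using ct[OF l, of x] c0[OF l(1), of x] c0[OF l(2), of x]
      by (simp add: eq1 w_def matrix_mult_11 mat_def divide_simps mult.commute)
  qed
  have "inverse_mors a b M (trivial_bundle a b) u w"
    unfolding inverse_mors_def using mor_u mor_w c0
    by (auto simp: eq1 u_def w_def matrix_mult_11 mat_def)
  moreover have "j i l x = \<iota> i k x ** u k l x"
    if "i \<in> idx E" "l \<in> idx M" "x \<in> cover E i" "x \<in> cover M l" for i l k x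
    using c[OF that]
    by (intro column_eq_imp_eq) (simp add: matrix_mult_column mult_vec1 column_11 u_def mat_def jc_def)
  ultimately show ?thesis unfolding same_sub_def bundle_iso_def by blast
qed

section \<open>Higgs fields\<close>

text \<open>Translates the bundle data into weighted functions on the punctured plane, where
  \<open>nonsplit_trace_free_nilpotent\<close> applies. Frames of \<open>H\<close> and
  \<open>lam\<close> absorb the twists, and the resulting function descends again to a
  section.\<close>

lemma higgs_field_multiple:
  fixes lam :: "('k, 1) hbundle"
  assumes t: "line_class a b H t" "1 \<le> cmod t"
    and holL: "holo_bundle a b lam" and \<tau>: "line_class a b lam \<tau>"
    and \<phi>: "higgs_field a b E lam \<phi>"
    and ns: "\<not> (\<exists>\<sigma>. split_by a b E H \<rho> \<sigma>)"
  shows "\<exists>s. holo_section a b (twist lam (dual_line H)) (hopf_surface a b) s \<and>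
    (\<forall>i\<in>idx E. \<forall>k\<in>idx lam. \<forall>h\<in>idx H. \<forall>x\<in>cover E i \<inter> cover lam k \<inter> cover H h.
       \<phi> (i, k) x = scale_mat (s (k, h) x $ 1) (phi0 H \<iota> \<rho> (i, h) x))"
proof -
  have t0: "t \<noteq> 0" "\<tau> \<noteq> 0" using t \<tau> by (auto simp: line_class_def)
  let ?P = "hopf_proj a b" and ?pre = "hopf_preimage a b"
  obtain \<eta> where \<eta>: "frame_of a b H t \<eta>" using line_class_frame[OF ab holH t(1)] by blast
  obtain \<mu> where \<mu>: "frame_of a b lam \<tau> \<mu>" using line_class_frame[OF ab holL \<tau>] by blast
  note L' = holo_bundleD[OF holL]
  have preI: "p \<in> ?pre V \<longleftrightarrow> p \<noteq> 0 \<and> ?P p \<in> V" for p V by (simp add: hopf_preimage_def)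
  have Pd: "?P (dil a b p) = ?P p" for p using ab0 by simp
  have d0: "dil a b p = 0 \<longleftrightarrow> p = 0" for p by (rule dil_eq_0_iff[OF ab0])
  \<comment> \<open>The last index selects a component of \<rho> that is nonzero on the chart, so
    that the quotient map has an explicit local splitting there.\<close>
  define I where "I = {(i, k, h, r :: 2). i \<in> idx E \<and> k \<in> idx lam \<and> h \<in> idx H}"
  define U where "U = (\<lambda>(i, k, h, r :: 2). {p. p \<noteq> 0 \<and> ?P p \<in> cover E i \<and> ?P p \<in> cover lam k \<and> ?P p \<in> cover H h \<and>
      \<rho> h i (?P p) $ 1 $ r \<noteq> 0})"
  define e where "e = (\<lambda>(i, k :: 'k, h :: 'h, r :: 2) p. incl i (?P p))"
  \<comment> \<open>The quotient map followed by the frame of \<open>H\<close>: a functional with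
    values in functions of weight \<open>t\<close>, independent of \<open>h\<close>.\<close>
  define l where "l = (\<lambda>(i, k :: 'k, h, r :: 2) p. \<eta> h p *s (\<rho> h i (?P p) $ 1))"
  \<comment> \<open>A multiple of the basis vector \<open>r\<close>, normalised to value 1 under
    \<open>l\<close>.\<close>
  define v :: "'i \<times> 'k \<times> 'h \<times> 2 \<Rightarrow> complex \<times> complex \<Rightarrow> complex ^ 2"
    where "v = (\<lambda>(i, k, h, r) p. axis r (1 / (\<eta> h p * \<rho> h i (?P p) $ 1 $ r)))"
  \<comment> \<open>The frame \<mu> removes the twist by \<open>lam\<close> and leaves an
    endomorphism of the pullback of \<open>E\<close> with multiplier \<tau>.\<close>
  define A where "A = (\<lambda>(i, k, h :: 'h, r :: 2) p. scale_mat (\<mu> k p) (\<phi> (i, k) (?P p)))"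
  define T where "T = (\<lambda>(i, k :: 'k, h :: 'h, r :: 2) (i', k' :: 'k, h' :: 'h, r' :: 2) p. trans E i i' (?P p))"
  have II: "(i, k, h, r) \<in> I \<longleftrightarrow> i \<in> idx E \<and> k \<in> idx lam \<and> h \<in> idx H" for i k h r
    by (simp add: I_def)
  have UU: "p \<in> U (i, k, h, r) \<longleftrightarrow> p \<noteq> 0 \<and> ?P p \<in> cover E i \<and> ?P p \<in> cover lam k \<and> ?P p \<in> cover H h \<and>
      \<rho> h i (?P p) $ 1 $ r \<noteq> 0" for p i k h r
    by (simp add: U_def)
  have ex: "\<exists>r. p \<in> U (i, k, h, r)"
    if "p \<noteq> 0" "i \<in> idx E" "h \<in> idx H" "?P p \<in> cover E i" "?P p \<in> cover lam k" "?P p \<in> cover H h" for p i k h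
    using exact_pointwise(2)[of i h "?P p"] that by (simp add: UU)
  have surf: "?P p \<in> hopf_surface a b" if "p \<noteq> 0" for p using that by (simp add: hopf_surface_def)
  have surfD: "\<exists>p. p \<noteq> 0 \<and> x = ?P p" if "x \<in> hopf_surface a b" for x
    using that by (rule hopf_surfaceE) blast
  have exE: "\<exists>k h r. (i, k, h, r) \<in> I \<and> p \<in> U (i, k, h, r)"
    if p: "p \<noteq> 0" and i: "i \<in> idx E" "?P p \<in> cover E i" for p i
  proof -
    obtain k h where "k \<in> idx lam" "?P p \<in> cover lam k" "h \<in> idx H" "?P p \<in> cover H h"
      using L'(2)[OF surf[OF p]] holH'(2)[OF surf[OF p]] by blast
    then show ?thesis using ex[OF p i(1) _ i(2)] i by (fastforce simp: II)
  qed
  have hol\<rho>: "holomorphic2_on (\<lambda>p. \<rho> h i (?P p) $ 1 $ r) S"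
    if "i \<in> idx E" "h \<in> idx H" "S \<subseteq> ?pre (cover E i \<inter> cover H h)" for i h r S
    using bundle_morD(1)[OF mor(2) that(1,2), of 1 r] that(3) holomorphic2_on_subset
    unfolding hopf_holo_def by blast
  have hol\<iota>: "holomorphic2_on (\<lambda>p. incl i (?P p) $ r) S" if "i \<in> idx E" "S \<subseteq> ?pre (cover E i)" for i r S
    using incl_holo[OF that(1), of r] that(2) holomorphic2_on_subset unfolding hopf_holo_def by blast
  have hol\<eta>: "holomorphic2_on (\<eta> h) S" if "h \<in> idx H" "S \<subseteq> ?pre (cover H h)" for h S
    using frame_ofD(1)[OF \<eta> that(1)] that(2) holomorphic2_on_subset by blast
  have hol\<mu>: "holomorphic2_on (\<mu> k) S" if "k \<in> idx lam" "S \<subseteq> ?pre (cover lam k)" for k S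
    using frame_ofD(1)[OF \<mu> that(1)] that(2) holomorphic2_on_subset by blast
  have hol\<phi>: "holomorphic2_on (\<lambda>p. \<phi> (i, k) (?P p) $ r $ c) S"
    if "i \<in> idx E" "k \<in> idx lam" "S \<subseteq> ?pre (cover E i \<inter> cover lam k)" for i k r c S
  proof -
    have "hopf_holo a b (cover E i \<inter> cover lam k) (\<lambda>x. \<phi> (i, k) x $ r $ c)"
      using \<phi> that(1,2) unfolding higgs_field_def hopf_holo_mat_def by simp
    then show ?thesis using that(3) holomorphic2_on_subset unfolding hopf_holo_def by blast
  qed
  have Uopen: "open (U j)" if j: "j \<in> I" for j
  proof -
    obtain i k h r where jj: "j = (i, k, h, r)" "i \<in> idx E" "k \<in> idx lam" "h \<in> idx H"
      using j by (cases j) (auto simp: II)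
    define S where "S = ?pre (cover E i \<inter> cover lam k \<inter> cover H h)"
    have "hopf_open a b (cover E i \<inter> cover lam k \<inter> cover H h)"
      by (intro hopf_open_Int holE'(1) L'(1) holH'(1) jj)
    then have S: "open S" unfolding S_def by (rule hopf_open_preimage)
    have "continuous_on S (\<lambda>p. \<rho> h i (?P p) $ 1 $ r)"
      by (rule holomorphic2_on_continuous[OF hol\<rho>]) (use jj in \<open>auto simp: S_def preI\<close>)
    then have "open (S \<inter> (\<lambda>p. \<rho> h i (?P p) $ 1 $ r) -` (- {0}))"
      by (rule continuous_open_preimage[OF _ S]) (simp add: open_Compl)
    moreover have "S \<inter> (\<lambda>p. \<rho> h i (?P p) $ 1 $ r) -` (- {0}) = U j"
      by (auto simp: jj S_def preI UU)
    ultimately show ?thesis by simp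
  qed
  have Ucov: "(\<Union>j\<in>I. U j) = - {0}"
  proof (intro set_eqI iffI)
    fix p :: "complex \<times> complex" assume p: "p \<in> - {0}"
    then obtain i where "i \<in> idx E" "?P p \<in> cover E i" using holE'(2) surf by blast
    then show "p \<in> (\<Union>j\<in>I. U j)" using exE p by blast
  qed (auto simp: U_def)
  have Udil: "dil a b p \<in> U j \<longleftrightarrow> p \<in> U j" for j p
    by (cases j) (simp add: UU Pd d0)
  have he: "holomorphic2_on (\<lambda>p. e j p $ r) (U j)" and hv: "holomorphic2_on (\<lambda>p. v j p $ r) (U j)"
    and hl: "holomorphic2_on (\<lambda>p. l j p $ r) (U j)" and hA: "holomorphic2_on (\<lambda>p. A j p $ r $ c) (U j)"
    if j: "j \<in> I" for j r c
  proof -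
    obtain i k h s where jj: "j = (i, k, h, s)" "i \<in> idx E" "k \<in> idx lam" "h \<in> idx H"
      using j by (cases j) (auto simp: II)
    have sub: "U j \<subseteq> ?pre (cover E i)" "U j \<subseteq> ?pre (cover lam k)" "U j \<subseteq> ?pre (cover H h)"
      "U j \<subseteq> ?pre (cover E i \<inter> cover lam k)" "U j \<subseteq> ?pre (cover E i \<inter> cover H h)"
      by (auto simp: jj UU preI)
    show "holomorphic2_on (\<lambda>p. e j p $ r) (U j)" using hol\<iota>[OF jj(2) sub(1)] by (simp add: jj e_def)
    have "holomorphic2_on (\<lambda>p. 1 / (\<eta> h p * \<rho> h i (?P p) $ 1 $ s)) (U j)"
      by (intro holomorphic2_intros hol\<eta>[OF jj(4) sub(3)] hol\<rho>[OF jj(2,4) sub(5)])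
         (use frame_ofD(2)[OF \<eta> jj(4)] in \<open>auto simp: jj UU preI\<close>)
    then show "holomorphic2_on (\<lambda>p. v j p $ r) (U j)" by (cases "r = s") (simp_all add: jj v_def axis_def)
    show "holomorphic2_on (\<lambda>p. l j p $ r) (U j)"
      using holomorphic2_on_mult[OF hol\<eta>[OF jj(4) sub(3)] hol\<rho>[OF jj(2,4) sub(5)]] by (simp add: jj l_def)
    show "holomorphic2_on (\<lambda>p. A j p $ r $ c) (U j)"
      using holomorphic2_on_mult[OF hol\<mu>[OF jj(3) sub(2)] hol\<phi>[OF jj(2,3) sub(4)]]
      by (simp add: jj A_def scale_mat_def)
  qed
  have we: "e j (dil a b p) = e j p" for j p
    by (cases j) (simp add: e_def Pd)
  have wv: "t *s v j (dil a b p) = v j p" and lv: "dot2 (l j p) (v j p) = 1" if j: "j \<in> I" and p: "p \<in> U j" for j p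
  proof -
    obtain i k h s where jj: "j = (i, k, h, s)" "i \<in> idx E" "k \<in> idx lam" "h \<in> idx H"
      using j by (cases j) (auto simp: II)
    have x: "p \<noteq> 0" "?P p \<in> cover H h" "\<rho> h i (?P p) $ 1 $ s \<noteq> 0" using p by (auto simp: jj UU)
    have \<eta>p: "\<eta> h p \<noteq> 0" "\<eta> h (dil a b p) = t * \<eta> h p"
      using frame_ofD(2,3)[OF \<eta> jj(4)] x by (auto simp: preI)
    show "t *s v j (dil a b p) = v j p"
      using t0 by (simp add: jj v_def Pd \<eta>p(2) vec_eq_iff axis_def)
    show "dot2 (l j p) (v j p) = 1"
      using \<eta>p(1) x(3) exhaust_2[of s] by (auto simp: jj l_def v_def dot2_def axis_def)
  qed
  have le: "dot2 (l j p) (e j p) = 0" if j: "j \<in> I" and p: "p \<in> U j" for j p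
  proof -
    obtain i k h s where jj: "j = (i, k, h, s)" "i \<in> idx E" "k \<in> idx lam" "h \<in> idx H"
      using j by (cases j) (auto simp: II)
    then show ?thesis using exact_pointwise(1)[OF jj(2,4), of "?P p"] p
      by (simp add: UU l_def e_def dot2_scale_left)
  qed
  have Te: "T j j' p *v e j' p = e j p" and lT: "dot2 (l j p) (T j j' p *v w) = dot2 (l j' p) w"
    if j: "j \<in> I" "j' \<in> I" and p: "p \<in> U j \<inter> U j'" for j j' p w
  proof -
    obtain i k h s i' k' h' s' where jj: "j = (i, k, h, s)" "i \<in> idx E" "k \<in> idx lam" "h \<in> idx H"
        "j' = (i', k', h', s')" "i' \<in> idx E" "k' \<in> idx lam" "h' \<in> idx H"
      using j by (cases j, cases j') (auto simp: II)
    have x: "p \<noteq> 0" "?P p \<in> cover E i" "?P p \<in> cover E i'" "?P p \<in> cover H h" "?P p \<in> cover H h'"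
      using p by (auto simp: jj UU)
    show "T j j' p *v e j' p = e j p"
      using incl_trans[OF jj(2,6) x(2,3)] by (simp add: jj T_def e_def)
    have "\<eta> h' p = \<eta> h p * trans H h h' (?P p) $ 1 $ 1"
      using frame_ofD(4)[OF \<eta> jj(4,8)] x by (simp add: preI)
    then show "dot2 (l j p) (T j j' p *v w) = dot2 (l j' p) w"
      using rho_trans[OF jj(2,6,4,8) x(2,3,4,5), of w]
      by (simp add: jj l_def T_def dot2_scale_left)
  qed
  have \<phi>T: "\<phi> (i, k) x *v (trans E i i' x *v w) =
      trans lam k k' x $ 1 $ 1 *s (trans E i i' x *v (\<phi> (i', k') x *v w))"
    if "i \<in> idx E" "i' \<in> idx E" "k \<in> idx lam" "k' \<in> idx lam"
      "x \<in> cover E i" "x \<in> cover E i'" "x \<in> cover lam k" "x \<in> cover lam k'" for i i' k k' x w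
  proof -
    have 1: "\<phi> (i, k) x = scale_mat (trans lam k k' x $ 1 $ 1)
                         (trans E i i' x ** \<phi> (i', k') x ** trans E i' i x)"
      using \<phi> that unfolding higgs_field_def by blast
    have "trans E i' i x *v (trans E i i' x *v w) = w"
      using holE'(6)[of i' i i' x] holE'(5)[of i' x] that by (simp add: matrix_vector_mul_assoc)
    then show ?thesis unfolding 1 by (simp add: scale_mat_vec matrix_vector_mul_assoc[symmetric])
  qed
  have nonsplit: "\<not> (\<exists>g. (\<forall>j\<in>I. holomorphic2_on (g j) (U j) \<and> (\<forall>p\<in>U j. t * g j (dil a b p) = g j p)) \<and>
      (\<forall>j\<in>I. \<forall>j'\<in>I. \<forall>p\<in>U j \<inter> U j'. v j p - T j j' p *v v j' p = (g j p - g j' p) *s e j p))"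
  proof
    assume "\<exists>g. (\<forall>j\<in>I. holomorphic2_on (g j) (U j) \<and> (\<forall>p\<in>U j. t * g j (dil a b p) = g j p)) \<and>
      (\<forall>j\<in>I. \<forall>j'\<in>I. \<forall>p\<in>U j \<inter> U j'. v j p - T j j' p *v v j' p = (g j p - g j' p) *s e j p)"
    then obtain g where gg: "(\<forall>j\<in>I. holomorphic2_on (g j) (U j) \<and> (\<forall>p\<in>U j. t * g j (dil a b p) = g j p)) \<and>
      (\<forall>j\<in>I. \<forall>j'\<in>I. \<forall>p\<in>U j \<inter> U j'. v j p - T j j' p *v v j' p = (g j p - g j' p) *s e j p)" ..
    note g = gg[THEN conjunct1] gg[THEN conjunct2, rule_format]
    \<comment> \<open>The corrected local splittings \<open>v - g e\<close> agree on overlaps, so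
      any chart over the trivialisation \<open>i\<close> may be used to evaluate them.\<close>
    define S where "S = (\<lambda>i p. let j = (SOME j. j \<in> I \<and> fst j = i \<and> p \<in> U j) in v j p - g j p *s e j p)"
    have rel: "T j j' p *v (v j' p - g j' p *s e j' p) = v j p - g j p *s e j p"
      if "j \<in> I" "j' \<in> I" "p \<in> U j \<inter> U j'" for j j' p
    proof -
      have "T j j' p *v (v j' p - g j' p *s e j' p) = T j j' p *v v j' p - g j' p *s (T j j' p *v e j' p)"
        by (simp add: vec2_eq_iff mult_mat2_vec2 algebra_simps)
      also have "T j j' p *v v j' p = v j p - (g j p - g j' p) *s e j p"
        unfolding g(2)[OF that, symmetric] by simp
      finally show ?thesis unfolding Te[OF that] by (simp add: vec2_eq_iff algebra_simps)
    qed
    have S: "S i p = v j p - g j p *s e j p" if j: "j \<in> I" "fst j = i" "p \<in> U j" for i j p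
    proof -
      define j' where "j' = (SOME j. j \<in> I \<and> fst j = i \<and> p \<in> U j)"
      have j': "j' \<in> I" "fst j' = i" "p \<in> U j'"
        unfolding j'_def using someI[of "\<lambda>j. j \<in> I \<and> fst j = i \<and> p \<in> U j" j] j by blast+
      have "T j' j p = mat 1"
        using holE'(5)[of i "?P p"] j j' by (cases j, cases j') (auto simp: T_def II UU)
      then have "v j p - g j p *s e j p = v j' p - g j' p *s e j' p"
        using rel[of j' j p] j j' by simp
      then show ?thesis by (simp add: S_def j'_def Let_def)
    qed
    have Sex: "\<exists>j. j \<in> I \<and> fst j = i \<and> p \<in> U j" if "i \<in> idx E" "p \<in> ?pre (cover E i)" for i p
      using exE[of p i] that by (fastforce simp: preI)
    have Sd: "t *s S i (dil a b p) = S i p" if i: "i \<in> idx E" "p \<in> ?pre (cover E i)" for i p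
    proof -
      obtain j where j: "j \<in> I" "fst j = i" "p \<in> U j" using Sex[OF i] by blast
      have "t * g j (dil a b p) = g j p" using g(1) j by blast
      then have "t *s (v j (dil a b p) - g j (dil a b p) *s e j (dil a b p)) = v j p - g j p *s e j p"
        unfolding wv[OF j(1,3), symmetric] we by (simp add: vec2_eq_iff algebra_simps)
      then show ?thesis unfolding S[OF j] S[OF j(1,2) Udil[THEN iffD2, OF j(3)]] .
    qed
    have S1: "dot2 (\<rho> h i (?P p) $ 1) (\<eta> h p *s S i p) = 1"
      if i: "i \<in> idx E" "h \<in> idx H" and p: "p \<in> ?pre (cover E i)" "p \<in> ?pre (cover H h)" for i h p
    proof -
      obtain k where "k \<in> idx lam" "?P p \<in> cover lam k" using L'(2)[OF surf[of p]] p unfolding preI by blast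
      then obtain r where j: "(i, k, h, r) \<in> I" "p \<in> U (i, k, h, r)"
        using ex[of p i h k] i p by (auto simp: preI II)
      have "dot2 (l (i, k, h, r) p) (S i p) = 1"
        using S[OF j(1) _ j(2)] lv[OF j] le[OF j] by (simp add: dot2_linear)
      then show ?thesis by (simp add: l_def dot2_scale_left dot2_linear)
    qed
    have ST: "trans E i i' (?P p) *v S i' p = S i p"
      if i: "i \<in> idx E" "i' \<in> idx E" and p: "p \<in> ?pre (cover E i)" "p \<in> ?pre (cover E i')" for i i' p
    proof -
      obtain j j' where j: "j \<in> I" "fst j = i" "p \<in> U j" "j' \<in> I" "fst j' = i'" "p \<in> U j'"
        using Sex[OF i(1) p(1)] Sex[OF i(2) p(2)] by blast
      moreover have "T j j' p = trans E i i' (?P p)" using j by (cases j, cases j') (auto simp: T_def)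
      ultimately show ?thesis using rel[of j j' p] S by simp
    qed
    have hS: "holomorphic2_on (\<lambda>p. S i p $ r) (?pre (cover E i))" if i: "i \<in> idx E" for i r
    proof (rule holomorphic2_on_local)
      fix p assume "p \<in> ?pre (cover E i)"
      then obtain j where j: "j \<in> I" "fst j = i" "p \<in> U j" using Sex[OF i] by blast
      have "holomorphic2_on (\<lambda>p. v j p $ r - g j p * e j p $ r) (U j)"
        using g(1) j(1) by (intro holomorphic2_intros hv he) auto
      then have "holomorphic2_on (\<lambda>p. S i p $ r) (U j)"
        by (rule holomorphic2_on_cong[OF _ Uopen[OF j(1)]]) (simp add: S[OF j(1,2)])
      then show "\<exists>T. p \<in> T \<and> holomorphic2_on (\<lambda>p. S i p $ r) T" using j(3) by blast
    qed
    \<comment> \<open>\<open>S\<close> has weight \<open>1 / t\<close> and the frame \<eta> has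
      weight \<open>t\<close>, so their product is invariant and descends to the surface as a
      splitting of \<rho>.\<close>
    define \<sigma> where "\<sigma> = (\<lambda>i h. hopf_descend (\<lambda>p. (\<chi> r c. \<eta> h p * S i p $ r) :: complex ^ 1 ^ 2))"
    have \<sigma>: "column 1 (\<sigma> i h (?P p)) = \<eta> h p *s S i p"
      if i: "i \<in> idx E" "h \<in> idx H" and p: "p \<in> ?pre (cover E i \<inter> cover H h)" for i h p
    proof -
      have "\<sigma> i h (?P p) = (\<chi> r c. \<eta> h p * S i p $ r)"
        unfolding \<sigma>_def
      proof (rule hopf_descend[OF ab0 _ _ p])
        show "dil a b q \<in> ?pre (cover E i \<inter> cover H h) \<longleftrightarrow> q \<in> ?pre (cover E i \<inter> cover H h)" for q
          by (rule dil_mem_hopf_preimage[OF ab0])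
        fix q assume "q \<in> ?pre (cover E i \<inter> cover H h)"
        then have q: "q \<in> ?pre (cover E i)" "q \<in> ?pre (cover H h)" by (simp_all add: preI)
        have "\<eta> h (dil a b q) * S i (dil a b q) $ r = \<eta> h q * S i q $ r" for r
          unfolding frame_ofD(3)[OF \<eta> i(2) q(2)] Sd[OF i(1) q(1), symmetric] by simp
        then show "(\<chi> r c. \<eta> h (dil a b q) * S i (dil a b q) $ r) = ((\<chi> r c. \<eta> h q * S i q $ r) :: complex ^ 1 ^ 2)"
          by simp
      qed
      then show ?thesis by (simp add: vec_eq_iff column_nth)
    qed
    have "split_by a b E H \<rho> \<sigma>"
      unfolding split_by_def bundle_mor_def hopf_holo_mat_def
    proof (intro conjI ballI allI)
      fix h i and r :: 2 and c :: 1 assume hi: "h \<in> idx H" "i \<in> idx E"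
      define V where "V = cover E i \<inter> cover H h"
      have V: "hopf_open a b V" unfolding V_def by (intro hopf_open_Int holE'(1) holH'(1) hi)
      have "holomorphic2_on (\<lambda>p. \<eta> h p * S i p $ r) (?pre V)"
        by (intro holomorphic2_intros hol\<eta> hi holomorphic2_on_subset[OF hS[OF hi(2)]]) (auto simp: V_def preI)
      then have "holomorphic2_on (\<lambda>p. \<sigma> i h (?P p) $ r $ c) (?pre V)"
      proof (rule holomorphic2_on_cong[OF _ hopf_open_preimage[OF V]])
        fix p assume "p \<in> ?pre V"
        from arg_cong[OF \<sigma>[OF hi(2,1) this[unfolded V_def]], of "\<lambda>w. w $ r"]
        have "\<eta> h p * S i p $ r = \<sigma> i h (?P p) $ r $ 1" by (simp add: column_nth)
        then show "\<eta> h p * S i p $ r = \<sigma> i h (?P p) $ r $ c" by (subst num1_eqI[of c 1])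
      qed
      then have "hopf_holo a b V (\<lambda>x. \<sigma> i h x $ r $ c)" by (simp add: hopf_holo_def)
      then show "hopf_holo a b (cover H h \<inter> cover E i) (\<lambda>x. \<sigma> i h x $ r $ c)"
        by (simp add: V_def Int_commute)
    next
      fix h h' i i' x assume hi: "h \<in> idx H" "h' \<in> idx H" "i \<in> idx E" "i' \<in> idx E"
        and x: "x \<in> cover H h \<inter> cover H h' \<inter> cover E i \<inter> cover E i'"
      obtain p where p: "p \<noteq> 0" "x = ?P p" using x surfD[OF holE'(3)[OF hi(3)]] by blast
      have "\<eta> h' p = \<eta> h p * trans H h h' x $ 1 $ 1"
        using frame_ofD(4)[OF \<eta> hi(1,2), of p] x p by (simp add: preI)
      then have "trans H h h' x $ 1 $ 1 *s (\<eta> h p *s S i p) = trans E i i' x *v (\<eta> h' p *s S i' p)"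
        using ST[OF hi(3,4), of p] x p by (simp add: preI mult_mat_vec_scale mult.commute)
      then show "\<sigma> i h x ** trans H h h' x = trans E i i' x ** \<sigma> i' h' x"
        using \<sigma>[OF hi(3,1), of p] \<sigma>[OF hi(4,2), of p] x p
        by (intro column_eq_imp_eq) (simp add: matrix_mult_column mult_vec1 column_11 preI)
    next
      fix i h x assume hi: "i \<in> idx E" "h \<in> idx H" and x: "x \<in> cover E i \<inter> cover H h"
      obtain p where p: "p \<noteq> 0" "x = ?P p" using x surfD[OF holE'(3)[OF hi(1)]] by blast
      have "(\<rho> h i x *v column 1 (\<sigma> i h x)) $ 1 = 1"
        using S1[OF hi, of p] \<sigma>[OF hi, of p] x p by (simp add: preI dot2_row)
      then show "\<rho> h i x ** \<sigma> i h x = mat 1"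
        by (intro column_eq_imp_eq) (simp add: matrix_mult_column vec_eq_iff forall_1 column_nth mat_def)
    qed
    then show False using ns by blast
  qed
  have "\<exists>\<beta>. holomorphic2_on \<beta> (- {0}) \<and> (\<forall>p. p \<noteq> 0 \<longrightarrow> t * \<beta> (dil a b p) = \<tau> * \<beta> p) \<and>
    (\<forall>j\<in>I. \<forall>p\<in>U j. \<forall>w. A j p *v w = (\<beta> p * dot2 (l j p) w) *s e j p)"
  proof (rule nonsplit_trace_free_nilpotent[where U = U and e = e and v = v and l = l and A = A and T = T, OF ab t(2) Uopen Ucov Udil _ _ _ _ _ _ _ _ _ _ _ _ _ _ _ _ _ nonsplit])
    fix j j' r c assume "j \<in> I" "j' \<in> I"
    then obtain i k h s i' k' h' s' where jj: "j = (i, k, h, s)" "i \<in> idx E" "j' = (i', k', h', s')" "i' \<in> idx E"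
      by (cases j, cases j') (auto simp: II)
    have "holomorphic2_on (\<lambda>p. trans E i i' (?P p) $ r $ c) (?pre (cover E i \<inter> cover E i'))"
      using holE'(4)[OF jj(2,4)] unfolding hopf_holo_def .
    then have "holomorphic2_on (\<lambda>p. trans E i i' (?P p) $ r $ c) (U j \<inter> U j')"
      by (rule holomorphic2_on_subset) (auto simp: jj UU preI)
    then show "holomorphic2_on (\<lambda>p. T j j' p $ r $ c) (U j \<inter> U j')" by (simp add: jj T_def)
  next
    fix j p assume j: "j \<in> I" and p: "p \<in> U j"
    obtain i k h s where jj: "j = (i, k, h, s)" "i \<in> idx E" "k \<in> idx lam" "h \<in> idx H"
      using j by (cases j) (auto simp: II)
    have x: "p \<noteq> 0" "?P p \<in> cover E i" "?P p \<in> cover lam k" "?P p \<in> cover H h" "\<rho> h i (?P p) $ 1 $ s \<noteq> 0"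
      using p by (auto simp: jj UU)
    have \<eta>p: "\<eta> h p \<noteq> 0" "\<eta> h (dil a b p) = t * \<eta> h p"
      using frame_ofD(2,3)[OF \<eta> jj(4)] x by (auto simp: preI)
    have \<mu>p: "\<mu> k (dil a b p) = \<tau> * \<mu> k p"
      using frame_ofD(3)[OF \<mu> jj(3)] x by (auto simp: preI)
    show "l j (dil a b p) = t *s l j p" by (simp add: jj l_def Pd \<eta>p(2) vec_eq_iff)
    show "A j (dil a b p) *v w = \<tau> *s (A j p *v w)" for w
      by (simp add: jj A_def Pd \<mu>p scale_mat_vec vec_eq_iff)
    show "e j p \<noteq> 0" using incl_nonzero[OF jj(2) x(2)] by (simp add: jj e_def)
    have "trace (\<phi> (i, k) (?P p)) = 0" using \<phi> jj x unfolding higgs_field_def by blast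
    then show "trace (A j p) = 0" by (simp add: jj A_def scale_mat_def trace_def sum_2 distrib_left[symmetric])
  next
    fix j j' p assume "j \<in> I" "j' \<in> I" and p: "p \<in> U j \<inter> U j'"
    then obtain i k h s i' k' h' s' where jj: "j = (i, k, h, s)" "i \<in> idx E" "k \<in> idx lam" "h \<in> idx H"
        "j' = (i', k', h', s')" "i' \<in> idx E" "k' \<in> idx lam" "h' \<in> idx H"
      by (cases j, cases j') (auto simp: II)
    have x: "p \<noteq> 0" "?P p \<in> cover E i" "?P p \<in> cover lam k" "?P p \<in> cover H h"
        "?P p \<in> cover E i'" "?P p \<in> cover lam k'" "?P p \<in> cover H h'"
      using p by (auto simp: jj UU)
    show "T j j' (dil a b p) = T j j' p" by (simp add: jj T_def Pd)
    have "\<mu> k' p = \<mu> k p * trans lam k k' (?P p) $ 1 $ 1"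
      using frame_ofD(4)[OF \<mu> jj(3,7)] x by (simp add: preI)
    then show "A j p *v (T j j' p *v w) = T j j' p *v (A j' p *v w)" for w
      using \<phi>T[OF jj(2,6,3,7) x(2,5,3,6), of w]
      by (simp add: jj A_def T_def scale_mat_vec mult_mat_vec_scale)
  qed ((assumption | rule he hv hl hA we wv lv le Te lT)+)
  then obtain \<beta> where \<beta>: "holomorphic2_on \<beta> (- {0})" "\<And>p. p \<noteq> 0 \<Longrightarrow> t * \<beta> (dil a b p) = \<tau> * \<beta> p"
    "\<And>j p w. j \<in> I \<Longrightarrow> p \<in> U j \<Longrightarrow> A j p *v w = (\<beta> p * dot2 (l j p) w) *s e j p" by blast
  \<comment> \<open>The weights \<open>\<tau> / t\<close> of \<beta>, \<open>t\<close> of \<eta> and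
    \<tau> of \<mu> cancel. The transition rules of the two frames make the quotient a section of
    \<open>lam\<close> twisted by the dual of \<open>H\<close>.\<close>
  define s where "s = (\<lambda>(k, h). hopf_descend (\<lambda>p. vec (\<beta> p * \<eta> h p / \<mu> k p) :: complex ^ 1))"
  have s: "s (k, h) (?P p) $ 1 = \<beta> p * \<eta> h p / \<mu> k p"
    if kh: "k \<in> idx lam" "h \<in> idx H" and p: "p \<in> ?pre (cover lam k \<inter> cover H h)" for k h p
  proof -
    have "s (k, h) (?P p) = vec (\<beta> p * \<eta> h p / \<mu> k p)"
      unfolding s_def prod.case
    proof (rule hopf_descend[OF ab0 _ _ p])
      show "dil a b q \<in> ?pre (cover lam k \<inter> cover H h) \<longleftrightarrow> q \<in> ?pre (cover lam k \<inter> cover H h)" for q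
        by (rule dil_mem_hopf_preimage[OF ab0])
      fix q assume q: "q \<in> ?pre (cover lam k \<inter> cover H h)"
      then have "\<eta> h (dil a b q) = t * \<eta> h q" "\<mu> k (dil a b q) = \<tau> * \<mu> k q"
        using frame_ofD(3)[OF \<eta> kh(2)] frame_ofD(3)[OF \<mu> kh(1)] by (simp_all add: preI)
      then show "vec (\<beta> (dil a b q) * \<eta> h (dil a b q) / \<mu> k (dil a b q)) = (vec (\<beta> q * \<eta> h q / \<mu> k q) :: complex ^ 1)"
        using \<beta>(2)[of q] q t0 by (simp add: preI mult.assoc[symmetric] mult.commute[of _ t])
    qed
    then show ?thesis by simp
  qed
  show ?thesis
  proof (intro exI[of _ s] conjI ballI)
    show "holo_section a b (twist lam (dual_line H)) (hopf_surface a b) s"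
      unfolding holo_section_def hopf_holo_vec_def
    proof (intro conjI ballI allI)
      fix kh and r :: 1 assume "kh \<in> idx (twist lam (dual_line H))"
      then obtain k h where kh: "kh = (k, h)" "k \<in> idx lam" "h \<in> idx H" by (auto simp: twist_def dual_line_def)
      define V where "V = cover lam k \<inter> cover H h"
      have V: "hopf_open a b V" unfolding V_def by (intro hopf_open_Int L'(1) holH'(1) kh)
      have "holomorphic2_on (\<lambda>p. \<beta> p * \<eta> h p / \<mu> k p) (?pre V)"
        by (intro holomorphic2_intros holomorphic2_on_subset[OF \<beta>(1)] hol\<eta> hol\<mu> kh frame_ofD(2)[OF \<mu>])
           (auto simp: V_def preI)
      then have "holomorphic2_on (\<lambda>p. s (k, h) (?P p) $ 1) (?pre V)"
        by (rule holomorphic2_on_cong[OF _ hopf_open_preimage[OF V]]) (simp add: s kh V_def)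
      then have "hopf_holo a b V (\<lambda>x. s kh x $ r)"
        unfolding hopf_holo_def kh num1_eqI[of r 1] .
      then show "hopf_holo a b (hopf_surface a b \<inter> cover (twist lam (dual_line H)) kh) (\<lambda>x. s kh x $ r)"
        by (rule hopf_holo_subset) (auto simp: kh V_def twist_def dual_line_def)
    next
      fix kh kh' x assume "kh \<in> idx (twist lam (dual_line H))" "kh' \<in> idx (twist lam (dual_line H))"
        and x: "x \<in> hopf_surface a b \<inter> cover (twist lam (dual_line H)) kh \<inter> cover (twist lam (dual_line H)) kh'"
      then obtain k h k' h' where kh: "kh = (k, h)" "k \<in> idx lam" "h \<in> idx H" "kh' = (k', h')" "k' \<in> idx lam" "h' \<in> idx H"
        by (auto simp: twist_def dual_line_def)
      obtain p where p: "p \<noteq> 0" "x = ?P p" using x surfD by blast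
      have c: "?P p \<in> cover lam k" "?P p \<in> cover lam k'" "?P p \<in> cover H h" "?P p \<in> cover H h'"
        using x by (auto simp: kh p twist_def dual_line_def)
      have e1: "\<eta> h' p = \<eta> h p * trans H h h' (?P p) $ 1 $ 1" and e2: "\<mu> k' p = \<mu> k p * trans lam k k' (?P p) $ 1 $ 1"
        and n: "\<eta> h' p \<noteq> 0" "\<mu> k' p \<noteq> 0"
        using frame_ofD(4)[OF \<eta> kh(3,6), of p] frame_ofD(4)[OF \<mu> kh(2,5), of p]
          frame_ofD(2)[OF \<eta> kh(6), of p] frame_ofD(2)[OF \<mu> kh(5), of p] c p(1)
        by (simp_all add: preI)
      have s12: "s (k, h) (?P p) $ 1 = \<beta> p * \<eta> h p / \<mu> k p" "s (k', h') (?P p) $ 1 = \<beta> p * \<eta> h' p / \<mu> k' p"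
        using s[OF kh(2,3), of p] s[OF kh(5,6), of p] c p(1) by (simp_all add: preI)
      have "trans H h h' (?P p) $ 1 $ 1 \<noteq> 0" "trans lam k k' (?P p) $ 1 $ 1 \<noteq> 0"
        using n e1 e2 by auto
      then have "s (k, h) (?P p) $ 1 =
          (trans lam k k' (?P p) $ 1 $ 1 * inverse (trans H h h' (?P p) $ 1 $ 1)) * s (k', h') (?P p) $ 1"
        unfolding s12 e1 e2 by simp
      then show "s kh x = trans (twist lam (dual_line H)) kh kh' x *v s kh' x"
        by (simp add: vec_eq_iff forall_1 kh p twist_def dual_line_def mult_vec1 column_11 scale_mat_def mat_def mult_ac)
    qed
    fix i k h x assume i: "i \<in> idx E" "k \<in> idx lam" "h \<in> idx H" and x: "x \<in> cover E i \<inter> cover lam k \<inter> cover H h"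
    obtain p where p: "p \<noteq> 0" "x = ?P p" using x surfD[OF holE'(3)[OF i(1)]] by blast
    obtain r where r: "p \<in> U (i, k, h, r)" using ex[of p i h k] i x p by auto
    have \<mu>0: "\<mu> k p \<noteq> 0" using frame_ofD(2)[OF \<mu> i(2)] x p by (simp add: preI)
    have sx: "s (k, h) x $ 1 = \<beta> p * \<eta> h p / \<mu> k p" using s[OF i(2,3), of p] x p by (simp add: preI)
    show "\<phi> (i, k) x = scale_mat (s (k, h) x $ 1) (phi0 H \<iota> \<rho> (i, h) x)"
    proof (rule matrix_eq[THEN iffD2, rule_format])
      fix w
      have "\<mu> k p *s (\<phi> (i, k) x *v w) = (\<beta> p * \<eta> h p) *s (dot2 (\<rho> h i x $ 1) w *s incl i x)"
        using \<beta>(3)[of "(i, k, h, r)" p w] i r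
        by (simp add: II A_def l_def e_def scale_mat_vec p dot2_scale_left vec_eq_iff mult_ac)
      then have "(1 / \<mu> k p) *s (\<mu> k p *s (\<phi> (i, k) x *v w)) =
          (1 / \<mu> k p) *s ((\<beta> p * \<eta> h p) *s (dot2 (\<rho> h i x $ 1) w *s incl i x))" by simp
      then show "\<phi> (i, k) x *v w = scale_mat (s (k, h) x $ 1) (phi0 H \<iota> \<rho> (i, h) x) *v w"
        using \<mu>0 x by (simp add: scale_mat_vec phi0_apply[OF i(3)] sx vec_eq_iff)
    qed
  qed
qed

end

theorem lemma5p4:
  fixes a b :: complex
    and E :: "('i, 2) hbundle"
    and H :: "('h, 1) hbundle"
    and \<iota> :: "'i \<Rightarrow> unit \<Rightarrow> hopf_point \<Rightarrow> complex ^ 1 ^ 2"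
    and \<rho> :: "'h \<Rightarrow> 'i \<Rightarrow> hopf_point \<Rightarrow> complex ^ 2 ^ 1"
  assumes "0 < cmod a" and "cmod a \<le> cmod b" and "cmod b < 1"
    and "holo_bundle a b E"
    and "holo_bundle a b H"
    and "in_Div a b H" and "line_deg a b H \<le> 0"
    and "short_exact a b (trivial_bundle a b) E H \<iota> \<rho>"
    and "\<not> (\<exists>\<sigma>. split_by a b E H \<rho> \<sigma>)"
  shows "(\<forall>(lam :: ('k, 1) hbundle) \<phi>.
            holo_bundle a b lam \<and> in_Div a b lam \<and> higgs_field a b E lam \<phi> \<longrightarrow>
            (\<exists>s. holo_section a b (twist lam (dual_line H)) (hopf_surface a b) s \<and>
              (\<forall>i\<in>idx E. \<forall>k\<in>idx lam. \<forall>h\<in>idx H. \<forall>x\<in>cover E i \<inter> cover lam k \<inter> cover H h.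
                 \<phi> (i, k) x = scale_mat (s (k, h) x $ 1) (phi0 H \<iota> \<rho> (i, h) x)))) \<and>
         sub_line_bundle a b (trivial_bundle a b) E \<iota> \<and>
         invariant_sub a b (trivial_bundle a b) E H \<iota> (phi0 H \<iota> \<rho>) \<and>
         (\<forall>(M :: ('l, 1) hbundle) j.
            sub_line_bundle a b M E j \<and> invariant_sub a b M E H j (phi0 H \<iota> \<rho>) \<longrightarrow>
            same_sub a b M (trivial_bundle a b) E j \<iota>)"
proof -
  interpret hopf_extension a b E H \<iota> \<rho>
    by unfold_locales (use assms in linarith | fact)+
  obtain t where t: "line_class a b H t" using assms(6) by (auto simp: in_Div_def)
  have t1: "1 \<le> cmod t"
    by (rule line_deg_nonpos_imp[OF ab holH t assms(7)])
  show ?thesis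
  proof (intro conjI allI impI)
    fix lam :: "('k, 1) hbundle" and \<phi>
    assume "holo_bundle a b lam \<and> in_Div a b lam \<and> higgs_field a b E lam \<phi>"
    then obtain \<tau> where "holo_bundle a b lam" "line_class a b lam \<tau>" "higgs_field a b E lam \<phi>"
      by (auto simp: in_Div_def)
    then show "\<exists>s. holo_section a b (twist lam (dual_line H)) (hopf_surface a b) s \<and>
              (\<forall>i\<in>idx E. \<forall>k\<in>idx lam. \<forall>h\<in>idx H. \<forall>x\<in>cover E i \<inter> cover lam k \<inter> cover H h.
                 \<phi> (i, k) x = scale_mat (s (k, h) x $ 1) (phi0 H \<iota> \<rho> (i, h) x))"
      by (rule higgs_field_multiple[OF t t1 _ _ _ assms(9)])
  next
    show "sub_line_bundle a b (trivial_bundle a b) E \<iota>" by (rule sub_line_bundle_incl)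
    show "invariant_sub a b (trivial_bundle a b) E H \<iota> (phi0 H \<iota> \<rho>)" by (rule invariant_incl)
  next
    fix M :: "('l, 1) hbundle" and j
    assume "sub_line_bundle a b M E j \<and> invariant_sub a b M E H j (phi0 H \<iota> \<rho>)"
    then show "same_sub a b M (trivial_bundle a b) E j \<iota>" by (blast intro: invariant_sub_unique)
  qed
qed

end
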